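(* For integers $m\ge1$ and $0\le\ell\le m-1$ let $\tilde\gamma_{m,\ell}$ be the Hölder regularity of the dual pseudo-spline subdivision scheme with symbol $$\tilde a_{m,\ell}(z)=\frac{1+z}{z}\,\sigma^m(z)\sum_{k=0}^{\ell}\binom{m-1/2+k}{k}\delta^k(z),\qquad \sigma(z)=\frac{(1+z)^2}{4z},\quad \delta(z)=-\frac{(1-z)^2}{4z},$$ and let $\tilde\gamma_m=\tilde\gamma_{m,m-1}$. Then: (i) $\tilde\gamma_{m,\ell}$ is decreasing (in the non-strict sense) in $\ell$, and moreover, for $1\le\ell\le m-1$, $$\tilde\gamma_{m,\ell-1}-\log_2\left(\frac{m+\ell+1/2}{\ell}\right)\le\tilde\gamma_{m,\ell}\le\tilde\gamma_{m,\ell-1};$$ (ii) $\tilde\gamma_{m,\ell}$ is increasing in $m$, and moreover, for $0\le\ell\le m-1$, $$\tilde\gamma_{m,\ell}+\log_2\left(\frac{4(m+1/2)}{m+\ell+1/2}\right)\le\tilde\gamma_{m+1,\ell}\le\tilde\gamma_{m,\ell}+2;$$ (iii) $\tilde\gamma_m$ is increasing in $m$, and moreover, for $m\ge1$, $$\tilde\gamma_m+\log_2\left(\frac{4m(m+3/2)}{(2m+1/2)(2m+3/2)}\right)\le\tilde\gamma_{m+1}\le\tilde\gamma_m+2.$$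
   Context: Generalized binomials: $\binom{x+k}{k}=\prod_{i=1}^k\frac{x+i}{i}$ for real $x$ and integer $k\ge0$. A subdivision scheme with symbol $a(z)=\sum_k a_kz^k$ (a Laurent polynomial with real coefficients) acts on real initial data $(f_{0,k})_{k\in\mathbb{Z}}$, only finitely many of which are non-zero, by $f_{j+1,k}=\sum_\ell a_{k-2\ell}f_{j,\ell}$. Let $f_j$ be the piecewise linear function with value $f_{j,k}$ at $2^{-j}k$; the limit function is the pointwise limit $f=\lim_{j\to\infty}f_j$. Hölder classes: for $0<\alpha<1$, $f\in C^\alpha$ means $|f(x)-f(y)|\le C|x-y|^\alpha$ for all $x,y\in\mathbb{R}$ and some constant $C$. For $q\in\mathbb{N}_0$, $f\in C^q$ means $f$ is $q$ times continuously differentiable, and $f\in C^{q+\alpha}$ means $f\in C^q$ and $f^{(q)}\in C^\alpha$. The scheme has Hölder regularity $\gamma\ge0$ if for $\beta<\gamma$, $f\in C^\beta$ for all initial data, and for $\beta>\gamma$, $f\notin C^\beta$ for some initial data. *)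

theory Defs
  imports
    "HOL-Analysis.Analysis"
    "HOL-Computational_Algebra.Formal_Laurent_Series"
    "HOL-Library.Groups_Big_Fun"
begin

section \<open>Subdivision schemes\<close>

text \<open>
  A symbol is represented by the formal Laurent series with the same coefficients, and the
  indeterminate \<open>z\<close> is \<^const>\<open>fls_X\<close>. Only Laurent polynomials (finitely many nonzero
  coefficients) are meant as symbols. Together with finitely supported data this makes
  every \<^const>\<open>Sum_any\<close> below a sum with finitely many nonzero terms.
\<close>

definition subdivision_step :: "real fls \<Rightarrow> (int \<Rightarrow> real) \<Rightarrow> int \<Rightarrow> real" where
  "subdivision_step a f k = Sum_any (\<lambda>l. fls_nth a (k - 2 * l) * f l)"

definition subdivision_data :: "real fls \<Rightarrow> (int \<Rightarrow> real) \<Rightarrow> nat \<Rightarrow> int \<Rightarrow> real" where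
  "subdivision_data a f0 j = (subdivision_step a ^^ j) f0"

definition linear_interpolant :: "(int \<Rightarrow> real) \<Rightarrow> real \<Rightarrow> real" where
  "linear_interpolant f t = (1 - frac t) * f \<lfloor>t\<rfloor> + frac t * f (\<lfloor>t\<rfloor> + 1)"

definition subdivision_polygon :: "real fls \<Rightarrow> (int \<Rightarrow> real) \<Rightarrow> nat \<Rightarrow> real \<Rightarrow> real" where
  "subdivision_polygon a f0 j x = linear_interpolant (subdivision_data a f0 j) (2 ^ j * x)"

lemma subdivision_polygon_grid:
  "subdivision_polygon a f0 j (of_int k / 2 ^ j) = subdivision_data a f0 j k"
  by (simp add: subdivision_polygon_def linear_interpolant_def)

text \<open>Meaningful only at points where the polygons converge.\<close>

definition subdivision_limit :: "real fls \<Rightarrow> (int \<Rightarrow> real) \<Rightarrow> real \<Rightarrow> real" where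
  "subdivision_limit a f0 x = lim (\<lambda>j. subdivision_polygon a f0 j x)"

definition finitely_supported :: "(int \<Rightarrow> real) \<Rightarrow> bool" where
  "finitely_supported f \<longleftrightarrow> finite {k. f k \<noteq> 0}"


section \<open>Hoelder regularity\<close>

definition C_class :: "nat \<Rightarrow> (real \<Rightarrow> real) \<Rightarrow> bool" where
  "C_class q f \<longleftrightarrow>
     (\<forall>i<q. (deriv ^^ i) f differentiable_on UNIV) \<and> continuous_on UNIV ((deriv ^^ q) f)"

definition hoelder_continuous :: "real \<Rightarrow> (real \<Rightarrow> real) \<Rightarrow> bool" where
  "hoelder_continuous \<alpha> f \<longleftrightarrow> (\<exists>C. \<forall>x y. \<bar>f x - f y\<bar> \<le> C * \<bar>x - y\<bar> powr \<alpha>)"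

text \<open>
  For \<open>\<beta> \<ge> 0\<close>, written uniquely as \<open>\<beta> = q + \<alpha>\<close> with \<open>q\<close> a natural number and \<open>0 \<le> \<alpha> < 1\<close>.
  For integer \<open>\<beta>\<close> this is the class of \<open>\<beta>\<close> times continuously differentiable functions, with
  no Lipschitz condition.
\<close>

definition hoelder_class :: "real \<Rightarrow> (real \<Rightarrow> real) \<Rightarrow> bool" where
  "hoelder_class \<beta> f \<longleftrightarrow>
     C_class (nat \<lfloor>\<beta>\<rfloor>) f \<and>
     (frac \<beta> \<noteq> 0 \<longrightarrow> hoelder_continuous (frac \<beta>) ((deriv ^^ nat \<lfloor>\<beta>\<rfloor>) f))"

text \<open>
  The convergence clause says that the limit functions in the other two clauses exist. The
  bound \<open>0 \<le> \<beta>\<close> is needed because the Hoelder classes are defined for nonnegative orders only.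
\<close>

definition has_hoelder_regularity :: "real fls \<Rightarrow> real \<Rightarrow> bool" where
  "has_hoelder_regularity a \<gamma> \<longleftrightarrow>
     0 \<le> \<gamma> \<and>
     (\<forall>f0. finitely_supported f0 \<longrightarrow> (\<forall>x. convergent (\<lambda>j. subdivision_polygon a f0 j x))) \<and>
     (\<forall>\<beta>. 0 \<le> \<beta> \<and> \<beta> < \<gamma> \<longrightarrow>
        (\<forall>f0. finitely_supported f0 \<longrightarrow> hoelder_class \<beta> (subdivision_limit a f0))) \<and>
     (\<forall>\<beta>. \<gamma> < \<beta> \<longrightarrow>
        (\<exists>f0. finitely_supported f0 \<and> \<not> hoelder_class \<beta> (subdivision_limit a f0)))"

lemma has_hoelder_regularity_unique:
  assumes "has_hoelder_regularity a \<gamma>" and "has_hoelder_regularity a \<gamma>'"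
  shows "\<gamma> = \<gamma>'"
proof -
  have False if "has_hoelder_regularity a s" "has_hoelder_regularity a t" "s < t" for s t
  proof -
    from dense[OF \<open>s < t\<close>] obtain \<beta> where "s < \<beta>" "\<beta> < t" by blast
    with that show False
      unfolding has_hoelder_regularity_def by (meson less_eq_real_def order.trans)
  qed
  with assms show ?thesis by (meson linorder_neqE)
qed

definition hoelder_regularity :: "real fls \<Rightarrow> real" where
  "hoelder_regularity a = (THE \<gamma>. has_hoelder_regularity a \<gamma>)"

lemma hoelder_regularity_eqI: "has_hoelder_regularity a \<gamma> \<Longrightarrow> hoelder_regularity a = \<gamma>"
  unfolding hoelder_regularity_def by (blast intro: has_hoelder_regularity_unique)


section \<open>Dual pseudo-splines\<close>

lemma gbinomial_plus_eq_prod: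
  "(x + real k) gchoose k = (\<Prod>i = 1..k. (x + real i) / real i)"
proof (induction k)
  case (Suc k)
  have "(x + real (Suc k)) gchoose Suc k
      = (x + real (Suc k)) / real (Suc k) * ((x + real k) gchoose k)"
    using gbinomial_absorption'[of "Suc k" "x + real (Suc k)"] by simp
  with Suc show ?case by (simp add: mult.commute)
qed simp

definition sigma_symbol :: "real fls" where
  "sigma_symbol = (1 + fls_X) ^ 2 / (4 * fls_X)"

definition delta_symbol :: "real fls" where
  "delta_symbol = - ((1 - fls_X) ^ 2 / (4 * fls_X))"

definition dual_pseudo_spline_symbol :: "nat \<Rightarrow> nat \<Rightarrow> real fls" where
  "dual_pseudo_spline_symbol m l =
     (1 + fls_X) / fls_X * sigma_symbol ^ m *
     (\<Sum>k = 0..l. fls_const ((real m - 1/2 + real k) gchoose k) * delta_symbol ^ k)"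

definition dual_pseudo_spline_regularity :: "nat \<Rightarrow> nat \<Rightarrow> real" where
  "dual_pseudo_spline_regularity m l = hoelder_regularity (dual_pseudo_spline_symbol m l)"

end

theory Submission imports Defs begin

text \<open>
  Write the symbol as \<open>(1 + z) ^ (2 * m + 1) * B z\<close>; on the unit circle \<open>B\<close> has modulus \<open>b / 4 ^ m\<close>,
  where \<open>b t = (\<Sum>k\<le>l. ((m - 1/2 + k) gchoose k) * (sin (t / 2)) ^ (2 * k)) \<ge> 1\<close>. Let \<open>R\<close> be the exponential
  growth rate of the mean of \<open>(\<Prod>j<n. b (2 ^ j * t))\<close> over the circle. The regularity is \<open>2 * m - log 2 R\<close>.

  Smoothness: up to a constant, that mean divided by \<open>4 ^ (m * n)\<close> bounds the differences of order \<open>2 * m + 1\<close> of the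
  data at level \<open>n\<close>. Decay passes from the differences of order \<open>r + 1\<close> to those of order \<open>r\<close>, because a
  difference of order \<open>r\<close> is \<open>2 ^ - r\<close> times its parent up to differences of order \<open>r + 1\<close>.

  Sharpness: let \<open>\<phi>\<close> be the limit function of the unit impulse. A difference of order \<open>2 * m\<close> with step
  \<open>2 ^ - n\<close> of \<open>\<phi>' (x - 1) - \<phi>' x\<close>, centred at \<open>0\<close>, is up to sign a limit of means of nonnegative functions
  and hence at least a constant times \<open>2 ^ n / 4 ^ (m * n)\<close> times the mean above.

  If \<open>b \<le> K * b'\<close> pointwise, then \<open>R \<le> K * R'\<close>. All the inequalities follow from this, with \<open>K\<close> the value at
  \<open>x = 1\<close> of a quotient of polynomials in \<open>x = (sin (t / 2))\<^sup>2\<close> or a quotient of leading coefficients.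
\<close>

section \<open>Finitely supported sequences and their Fourier series\<close>

text \<open>A mean of moduli bounds single coefficients only from above, so sharpness hinges on a
  sequence whose Fourier series has no cancellation. The symbol carries the odd factor
  \<open>(1 + z) / z\<close> and is not real on the circle; what remains without this factor is real
  and nonnegative. Differentiating trades the odd factor for a difference of step 1, and one more
  difference of step 1 makes the series nonnegative: this is the origin of
  \<open>\<phi>' (x - 1) - \<phi>' x\<close>. It presupposes a differentiable limit function, which
  comes from \<open>R \<le> 4 ^ (m - 1)\<close>, that is, from regularity at least 2. The sines
  produced by the differences could make the weighted mean much smaller than the plain one. They
  vanish only at multiples of \<open>2 * pi / 2 ^ n\<close>, and a translation by half that distance
  changes the product by a bounded factor only, because \<open>b\<close> is Lipschitz and at least
  1. On the smooth side, equal decay rates in the passage from order \<open>r + 1\<close> to order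
  \<open>r\<close> would create a factor \<open>n\<close>. Noninteger exponents avoid this, and
  every order below the regularity has such an exponent between itself and the regularity.\<close>

definition fourier :: "(int \<Rightarrow> real) \<Rightarrow> real \<Rightarrow> complex" where
  "fourier f t = (\<Sum>k | f k \<noteq> 0. of_real (f k) * cis (of_int k * t))"

lemma finitely_supportedI: "finite A \<Longrightarrow> (\<And>k. k \<notin> A \<Longrightarrow> f k = 0) \<Longrightarrow> finitely_supported f"
  unfolding finitely_supported_def by (rule finite_subset[of _ A]) auto

lemma fourier_eq_sum:
  assumes "finite A" "\<And>k. k \<notin> A \<Longrightarrow> f k = 0"
  shows "fourier f t = (\<Sum>k\<in>A. of_real (f k) * cis (of_int k * t))"
  unfolding fourier_def by (rule sum.mono_neutral_left) (use assms in auto)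

lemma finitely_supported_add:
  assumes "finitely_supported f" "finitely_supported g"
  shows "finitely_supported (\<lambda>k. f k + g k)"
  by (rule finitely_supportedI[of "{k. f k \<noteq> 0} \<union> {k. g k \<noteq> 0}"])
     (use assms in \<open>auto simp: finitely_supported_def\<close>)

lemma finitely_supported_mult:
  assumes "finitely_supported f"
  shows "finitely_supported (\<lambda>k. c * f k)"
  by (rule finitely_supportedI[of "{k. f k \<noteq> 0}"])
     (use assms in \<open>auto simp: finitely_supported_def\<close>)

lemma finitely_supported_diff:
  assumes "finitely_supported f" "finitely_supported g"
  shows "finitely_supported (\<lambda>k. f k - g k)"
  using finitely_supported_add[OF assms(1) finitely_supported_mult[OF assms(2), of "-1"]] by simp

lemma finitely_supported_shift:
  assumes "finitely_supported f"
  shows "finitely_supported (\<lambda>k. f (k + c))"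
proof -
  have "{k. f (k + c) \<noteq> 0} = (\<lambda>k. k - c) ` {k. f k \<noteq> 0}"
  proof (intro equalityI subsetI)
    fix k assume "k \<in> {k. f (k + c) \<noteq> 0}"
    then show "k \<in> (\<lambda>k. k - c) ` {k. f k \<noteq> 0}" by (intro image_eqI[of _ _ "k + c"]) auto
  qed auto
  then show ?thesis using assms by (simp add: finitely_supported_def)
qed

lemma finitely_supported_sum:
  assumes "\<And>l. l \<in> L \<Longrightarrow> finitely_supported (f l)"
  shows "finitely_supported (\<lambda>k. \<Sum>l\<in>L. f l k)"
  using assms
proof (induction L rule: infinite_finite_induct)
  case (insert x F)
  then show ?case by (simp add: finitely_supported_add)
qed (auto simp: finitely_supported_def)

lemma fourier_add:
  assumes "finitely_supported f" "finitely_supported g"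
  shows "fourier (\<lambda>k. f k + g k) t = fourier f t + fourier g t"
proof -
  let ?A = "{k. f k \<noteq> 0} \<union> {k. g k \<noteq> 0}"
  have A: "finite ?A" using assms by (simp add: finitely_supported_def)
  have "fourier h t = (\<Sum>k\<in>?A. of_real (h k) * cis (of_int k * t))"
    if "h = f \<or> h = g \<or> h = (\<lambda>k. f k + g k)" for h
    by (rule fourier_eq_sum[OF A]) (use that in auto)
  then show ?thesis by (simp add: sum.distrib algebra_simps)
qed

lemma fourier_mult:
  assumes "finitely_supported f"
  shows "fourier (\<lambda>k. c * f k) t = of_real c * fourier f t"
proof -
  let ?A = "{k. f k \<noteq> 0}"
  have A: "finite ?A" using assms by (simp add: finitely_supported_def)
  have "fourier h t = (\<Sum>k\<in>?A. of_real (h k) * cis (of_int k * t))"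
    if "h = f \<or> h = (\<lambda>k. c * f k)" for h
    by (rule fourier_eq_sum[OF A]) (use that in auto)
  then show ?thesis by (simp add: sum_distrib_left algebra_simps)
qed

lemma fourier_diff:
  assumes "finitely_supported f" "finitely_supported g"
  shows "fourier (\<lambda>k. f k - g k) t = fourier f t - fourier g t"
  using fourier_add[OF assms(1) finitely_supported_mult[OF assms(2), of "-1"], of t]
    fourier_mult[OF assms(2), of "-1"] by simp

lemma fourier_shift:
  assumes "finitely_supported f"
  shows "fourier (\<lambda>k. f (k + c)) t = cis (- of_int c * t) * fourier f t"
proof -
  let ?A = "{k. f k \<noteq> 0}"
  have A: "finite ?A" using assms by (simp add: finitely_supported_def)
  have "fourier (\<lambda>k. f (k + c)) t
      = (\<Sum>k\<in>(\<lambda>k. k - c) ` ?A. of_real (f (k + c)) * cis (of_int k * t))"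
  proof (rule fourier_eq_sum)
    show "f (k + c) = 0" if "k \<notin> (\<lambda>k. k - c) ` ?A" for k
      using that by (metis (mono_tags, lifting) add_diff_cancel_right' image_eqI mem_Collect_eq)
  qed (use A in simp)
  also have "\<dots> = (\<Sum>k\<in>?A. of_real (f k) * cis (of_int (k - c) * t))"
    by (subst sum.reindex) (auto simp: inj_on_def)
  also have "\<dots> = cis (- of_int c * t) * fourier f t"
    unfolding fourier_def by (simp add: sum_distrib_left cis_mult algebra_simps)
  finally show ?thesis .
qed

lemma fourier_sum:
  assumes "finite L" "\<And>l. l \<in> L \<Longrightarrow> finitely_supported (f l)"
  shows "fourier (\<lambda>k. \<Sum>l\<in>L. f l k) t = (\<Sum>l\<in>L. fourier (f l) t)"
  using assms
proof (induction L rule: finite_induct)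
  case empty
  then show ?case by (simp add: fourier_def)
next
  case (insert x F)
  then show ?case by (simp add: fourier_add finitely_supported_sum)
qed

text \<open>The spacing \<open>d\<close> lets one computation serve twice: \<open>d = 1\<close> is
  multiplication of Laurent polynomials, \<open>d = 2\<close> a subdivision step, in which entry
  \<open>l\<close> of the data moves to position \<open>2 * l\<close> and the frequency therefore
  doubles.\<close>

lemma fourier_convolution:
  assumes "finitely_supported a" "finite L"
  shows "finitely_supported (\<lambda>k. \<Sum>l\<in>L. a (k - d * l) * f l)"
    and "fourier (\<lambda>k. \<Sum>l\<in>L. a (k - d * l) * f l) t
      = fourier a t * (\<Sum>l\<in>L. of_real (f l) * cis (of_int l * (of_int d * t)))"
proof -
  have fs: "finitely_supported (\<lambda>k. a (k - d * l) * f l)" for l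
    using finitely_supported_mult[OF finitely_supported_shift[OF assms(1), of "- d * l"], of "f l"]
    by (simp add: mult.commute)
  then show "finitely_supported (\<lambda>k. \<Sum>l\<in>L. a (k - d * l) * f l)"
    by (intro finitely_supported_sum)
  have "fourier (\<lambda>k. a (k - d * l) * f l) t
      = fourier a t * (of_real (f l) * cis (of_int l * (of_int d * t)))" for l
    using fourier_mult[OF finitely_supported_shift[OF assms(1), of "- d * l"], of "f l" t]
      fourier_shift[OF assms(1), of "- d * l" t]
    by (simp add: algebra_simps)
  then show "fourier (\<lambda>k. \<Sum>l\<in>L. a (k - d * l) * f l) t
      = fourier a t * (\<Sum>l\<in>L. of_real (f l) * cis (of_int l * (of_int d * t)))"
    by (simp add: fourier_sum[OF assms(2)] fs sum_distrib_left)
qed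

lemma norm_fourier_le: "norm (fourier f t) \<le> (\<Sum>k | f k \<noteq> 0. \<bar>f k\<bar>)"
  unfolding fourier_def by (rule order.trans[OF norm_sum]) (simp add: norm_mult)

lemma continuous_on_fourier [continuous_intros]: "continuous_on A (fourier f)"
  unfolding fourier_def cis_conv_exp by (intro continuous_intros)

section \<open>Coefficients as means over the circle\<close>

definition circle_mean :: "(real \<Rightarrow> real) \<Rightarrow> real" where
  "circle_mean h = integral {-pi..pi} h / (2 * pi)"

lemma integral_cis_int:
  "((\<lambda>t. cis (of_int k * t)) has_integral (if k = 0 then 2 * of_real pi else 0)) {-pi..pi}"
proof (cases "k = 0")
  case True
  then show ?thesis using has_integral_const_real[of "1::complex" "-pi" pi] 
    by (simp add: scaleR_conv_of_real)
next
  case False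
  let ?F = "\<lambda>t::real. cis (of_int k * t) / (\<i> * of_int k)"
  have "(?F has_vector_derivative cis (of_int k * t)) (at t within {-pi..pi})" for t
  proof -
    have "((\<lambda>z. exp (\<i> * of_int k * z) / (\<i> * of_int k)) has_field_derivative
        exp (\<i> * of_int k * of_real t)) (at (of_real t) within S)" for S
      using False by (auto intro!: derivative_eq_intros)
    from has_vector_derivative_real_field[OF this] show ?thesis
      by (simp add: cis_conv_exp mult.assoc)
  qed
  from fundamental_theorem_of_calculus[OF _ this]
  have "((\<lambda>t. cis (of_int k * t)) has_integral (?F pi - ?F (-pi))) {-pi..pi}" by simp
  moreover have "cis (of_int k * pi) = cis (of_int k * -pi)"
    using cis_multiple_2pi[of "of_int k"]
      cis_mult[of "2 * pi * of_int k" "of_int k * -pi"] by (simp add: algebra_simps)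
  ultimately show ?thesis using False by simp
qed

lemma fourier_coefficient:
  assumes "finitely_supported f"
  shows "f i = circle_mean (\<lambda>t. Re (fourier f t * cis (- of_int i * t)))"
proof -
  let ?A = "{k. f k \<noteq> 0}"
  have A: "finite ?A" using assms by (simp add: finitely_supported_def)
  have eq: "fourier f t * cis (- of_int i * t) = (\<Sum>k\<in>?A. of_real (f k) * cis (of_int (k - i) * t))" for t
    unfolding fourier_def sum_distrib_right
    by (intro sum.cong) (simp_all add: cis_mult algebra_simps)
  have "((\<lambda>t. fourier f t * cis (- of_int i * t)) has_integral
     (\<Sum>k\<in>?A. of_real (f k) * (if k - i = 0 then 2 * of_real pi else 0))) {-pi..pi}"
    unfolding eq by (intro has_integral_sum A has_integral_mult_right integral_cis_int)
  also have "(\<Sum>k\<in>?A. of_real (f k) * (if k - i = 0 then 2 * of_real pi else 0)) = complex_of_real (2 * pi * f i)"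
    by (simp add: if_distrib [of "\<lambda>x. _ * x"] A cong: if_cong)
  finally have "((\<lambda>t. Re (fourier f t * cis (- of_int i * t))) has_integral (2 * pi * f i)) {-pi..pi}"
    by (auto dest: has_integral_Re)
  then show ?thesis by (auto simp: circle_mean_def dest: integral_unique)
qed

text \<open>A coefficient is the mean of the series times a unimodular factor. This is how bounds on
  the circle become bounds on the data.\<close>

lemma abs_le_circle_mean:
  assumes "finitely_supported f" "\<And>t. norm (fourier f t) \<le> h t" "continuous_on UNIV h"
  shows "\<bar>f i\<bar> \<le> circle_mean h"
proof -
  have "norm (integral {-pi..pi} (\<lambda>t. Re (fourier f t * cis (- of_int i * t)))) \<le> integral {-pi..pi} h"
  proof (rule integral_norm_bound_integral)
    show "(\<lambda>t. Re (fourier f t * cis (- of_int i * t))) integrable_on {-pi..pi}"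
      unfolding cis_conv_exp by (intro integrable_continuous_real continuous_intros)
    show "h integrable_on {-pi..pi}"
      using assms(3) by (intro integrable_continuous_real) (auto intro: continuous_on_subset)
    show "norm (Re (fourier f t * cis (- of_int i * t))) \<le> h t" for t
      using abs_Re_le_cmod[of "fourier f t * cis (- of_int i * t)"] assms(2)[of t]
      by (simp add: norm_mult)
  qed
  then show ?thesis
    unfolding fourier_coefficient[OF assms(1), of i] circle_mean_def by (simp add: divide_right_mono)
qed

section \<open>Laurent polynomials\<close>

abbreviation laurent_polynomial :: "real fls \<Rightarrow> bool" where
  "laurent_polynomial a \<equiv> finitely_supported (fls_nth a)"

abbreviation on_circle :: "real fls \<Rightarrow> real \<Rightarrow> complex" where
  "on_circle a \<equiv> fourier (fls_nth a)"

text \<open>Outside the range of the Cauchy product the terms vanish by the subdegrees. The factor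
  in \<open>1 * i\<close> is kept to match \<open>fourier_convolution\<close> with
  \<open>d = 1\<close>.\<close>

lemma fls_times_nth_support:
  assumes "laurent_polynomial b"
  shows "fls_nth (a * b) = (\<lambda>n. \<Sum>i | fls_nth b i \<noteq> 0. fls_nth a (n - 1 * i) * fls_nth b i)"
proof
  fix n
  let ?S = "{i. fls_nth b i \<noteq> 0}"
  have "fls_nth (a * b) n
      = (\<Sum>i=fls_subdegree b..n - fls_subdegree a. fls_nth b i * fls_nth a (n - i))"
    by (metis fls_times_nth(2) mult.commute)
  also have "\<dots> = (\<Sum>i\<in>?S. fls_nth a (n - 1 * i) * fls_nth b i)"
  proof (rule sum.mono_neutral_cong)
    show "finite ?S" using assms by (simp add: finitely_supported_def)
    show "fls_nth a (n - 1 * i) * fls_nth b i = 0" if "i \<in> ?S - {fls_subdegree b..n - fls_subdegree a}" for i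
    proof -
      have "fls_subdegree b \<le> i" using that by (auto simp: fls_subdegree_leI)
      then have "n - i < fls_subdegree a" using that by auto
      then show ?thesis by simp
    qed
  qed (auto simp: mult.commute)
  finally show "fls_nth (a * b) n = (\<Sum>i\<in>?S. fls_nth a (n - 1 * i) * fls_nth b i)" .
qed

lemma laurent_polynomial_times:
  assumes "laurent_polynomial a" "laurent_polynomial b"
  shows "laurent_polynomial (a * b)" "on_circle (a * b) t = on_circle a t * on_circle b t"
proof -
  have "finite {i. fls_nth b i \<noteq> 0}" using assms by (simp add: finitely_supported_def)
  from fourier_convolution[OF assms(1) this, of 1 "fls_nth b"]
  show "laurent_polynomial (a * b)" "on_circle (a * b) t = on_circle a t * on_circle b t"
    unfolding fls_times_nth_support[OF assms(2)] by (simp_all add: fourier_def)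
qed

lemma laurent_polynomial_add:
  assumes "laurent_polynomial a" "laurent_polynomial b"
  shows "laurent_polynomial (a + b)" "on_circle (a + b) t = on_circle a t + on_circle b t"
proof -
  have "fls_nth (a + b) = (\<lambda>k. fls_nth a k + fls_nth b k)" by auto
  then show "laurent_polynomial (a + b)" "on_circle (a + b) t = on_circle a t + on_circle b t"
    using finitely_supported_add[OF assms] fourier_add[OF assms, of t] by simp_all
qed

lemma laurent_polynomial_const:
  "laurent_polynomial (fls_const c)" "on_circle (fls_const c) t = of_real c"
proof -
  show "laurent_polynomial (fls_const c)"
    by (rule finitely_supportedI[of "{0}"]) auto
  show "on_circle (fls_const c) t = of_real c"
    by (subst fourier_eq_sum[of "{0}"]) auto
qed

lemma laurent_polynomial_X:
  "laurent_polynomial fls_X" "on_circle fls_X t = cis t"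
proof -
  show "laurent_polynomial fls_X"
    by (rule finitely_supportedI[of "{1}"]) auto
  show "on_circle fls_X t = cis t"
    by (subst fourier_eq_sum[of "{1}"]) auto
qed

lemma laurent_polynomial_X_inv:
  "laurent_polynomial fls_X_inv" "on_circle fls_X_inv t = cis (-t)"
proof -
  show "laurent_polynomial fls_X_inv"
    by (rule finitely_supportedI[of "{-1}"]) auto
  show "on_circle fls_X_inv t = cis (-t)"
    by (subst fourier_eq_sum[of "{-1}"]) auto
qed

lemma laurent_polynomial_one:
  "laurent_polynomial 1" "on_circle 1 t = 1"
  using laurent_polynomial_const[of 1] unfolding fls_const_1 of_real_1 .

lemma laurent_polynomial_minus:
  assumes "laurent_polynomial a"
  shows "laurent_polynomial (- a)" "on_circle (- a) t = - on_circle a t"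
proof -
  have "fls_nth (- a) = (\<lambda>k. -1 * fls_nth a k)" by auto
  then show "laurent_polynomial (- a)" "on_circle (- a) t = - on_circle a t"
    using finitely_supported_mult[OF assms, of "-1"] fourier_mult[OF assms, of "-1" t] by simp_all
qed

lemma laurent_polynomial_power:
  assumes "laurent_polynomial a"
  shows "laurent_polynomial (a ^ n)" "on_circle (a ^ n) t = on_circle a t ^ n"
proof -
  have "laurent_polynomial (a ^ n) \<and> on_circle (a ^ n) t = on_circle a t ^ n"
  proof (induction n)
    case 0
    show ?case unfolding power_0 using laurent_polynomial_one by blast
  next
    case (Suc n)
    then show ?case unfolding power_Suc using laurent_polynomial_times[OF assms] by metis
  qed
  then show "laurent_polynomial (a ^ n)" "on_circle (a ^ n) t = on_circle a t ^ n" by auto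
qed

lemma laurent_polynomial_sum:
  assumes "\<And>i. i \<in> I \<Longrightarrow> laurent_polynomial (a i)"
  shows "laurent_polynomial (sum a I)" "on_circle (sum a I) t = (\<Sum>i\<in>I. on_circle (a i) t)"
proof -
  have "laurent_polynomial (sum a I) \<and> on_circle (sum a I) t = (\<Sum>i\<in>I. on_circle (a i) t)"
    using assms
  proof (induction I rule: infinite_finite_induct)
    case (insert x F)
    then have "laurent_polynomial (a x)" "laurent_polynomial (sum a F)" by auto
    from laurent_polynomial_add[OF this] insert show ?case
      unfolding sum.insert[OF insert(1,2)] by (metis insertCI)
  qed (use laurent_polynomial_const[of 0] in \<open>simp_all add: fls_const_0\<close>)
  then show "laurent_polynomial (sum a I)" "on_circle (sum a I) t = (\<Sum>i\<in>I. on_circle (a i) t)" by auto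
qed

lemmas laurent_polynomial_intros =
  laurent_polynomial_times(1) laurent_polynomial_add(1) laurent_polynomial_const(1)
  laurent_polynomial_X(1) laurent_polynomial_X_inv(1) laurent_polynomial_one(1)
  laurent_polynomial_minus(1) laurent_polynomial_power(1) laurent_polynomial_sum(1)

lemmas on_circle_simps =
  laurent_polynomial_times(2) laurent_polynomial_add(2) laurent_polynomial_const(2)
  laurent_polynomial_X(2) laurent_polynomial_X_inv(2) laurent_polynomial_one(2)
  laurent_polynomial_minus(2) laurent_polynomial_power(2) laurent_polynomial_sum(2)

section \<open>The subdivision operator and differences\<close>

lemma subdivision_step_eq_sum:
  assumes "finite L" "\<And>l. l \<notin> L \<Longrightarrow> f l = 0"
  shows "subdivision_step a f = (\<lambda>k. \<Sum>l\<in>L. fls_nth a (k - 2 * l) * f l)"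
  unfolding subdivision_step_def using assms
  by (intro ext Sum_any.expand_superset) auto

lemma subdivision_step_Laurent:
  assumes "laurent_polynomial a" "finitely_supported f"
  shows "finitely_supported (subdivision_step a f)"
    and "fourier (subdivision_step a f) t = on_circle a t * fourier f (2 * t)"
proof -
  have fin: "finite {l. f l \<noteq> 0}" using assms by (simp add: finitely_supported_def)
  have eq: "subdivision_step a f = (\<lambda>k. \<Sum>l | f l \<noteq> 0. fls_nth a (k - 2 * l) * f l)"
    by (rule subdivision_step_eq_sum[OF fin]) auto
  show "finitely_supported (subdivision_step a f)"
    "fourier (subdivision_step a f) t = on_circle a t * fourier f (2 * t)"
    unfolding eq using fourier_convolution[OF assms(1) fin, of 2 f]
    by (simp_all add: fourier_def)
qed

lemma subdivision_data_Suc: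
  "subdivision_data a f0 (Suc n) = subdivision_step a (subdivision_data a f0 n)"
  by (simp add: subdivision_data_def)

text \<open>The symbol applied last acts at frequency \<open>t\<close>, and every earlier one at
  twice the frequency of its successor. The induction therefore generalises \<open>t\<close> and
  splits off the factor \<open>j = 0\<close>.\<close>

lemma subdivision_data_Laurent:
  assumes "laurent_polynomial a" "finitely_supported f0"
  shows "finitely_supported (subdivision_data a f0 n)"
    and "fourier (subdivision_data a f0 n) t
      = (\<Prod>j<n. on_circle a (2 ^ j * t)) * fourier f0 (2 ^ n * t)"
proof -
  have fs: "finitely_supported (subdivision_data a f0 n)" for n
    by (induction n)
       (simp_all add: subdivision_data_Suc subdivision_step_Laurent assms subdivision_data_def[of _ _ 0])
  then show "finitely_supported (subdivision_data a f0 n)" .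
  show "fourier (subdivision_data a f0 n) t
      = (\<Prod>j<n. on_circle a (2 ^ j * t)) * fourier f0 (2 ^ n * t)"
  proof (induction n arbitrary: t)
    case 0
    then show ?case by (simp add: subdivision_data_def)
  next
    case (Suc n)
    then show ?case
      unfolding subdivision_data_Suc subdivision_step_Laurent(2)[OF assms(1) fs] prod.lessThan_Suc_shift
      by (simp add: mult_ac)
  qed
qed

text \<open>Backward, because the multiplier is then \<open>1 - z\<close>, and
  \<open>(1 - z) * (1 + z) = 1 - z ^ 2\<close> moves the difference through a subdivision step
  without a phase.\<close>

definition bdiff :: "(int \<Rightarrow> real) \<Rightarrow> int \<Rightarrow> real" where
  "bdiff f k = f k - f (k - 1)"

lemma finitely_supported_bdiff:
  assumes "finitely_supported f"
  shows "finitely_supported (bdiff f)" "fourier (bdiff f) t = (1 - cis t) * fourier f t"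
  using finitely_supported_diff[OF assms finitely_supported_shift[OF assms, of "-1"]]
    fourier_diff[OF assms finitely_supported_shift[OF assms, of "-1"], of t]
    fourier_shift[OF assms, of "-1"]
  unfolding bdiff_def[abs_def] by (simp_all add: algebra_simps)

lemma finitely_supported_bdiff_iterate:
  "finitely_supported f \<Longrightarrow> finitely_supported ((bdiff ^^ r) f)"
  by (induction r) (auto simp: finitely_supported_bdiff)

lemma finitely_supported_bounded:
  assumes "finitely_supported f"
  obtains C where "C \<ge> 0" "\<And>k. \<bar>f k\<bar> \<le> C"
proof (rule that)
  have fin: "finite {k. f k \<noteq> 0}" using assms by (simp add: finitely_supported_def)
  show "0 \<le> (\<Sum>k | f k \<noteq> 0. \<bar>f k\<bar>)" by (intro sum_nonneg) auto
  show "\<bar>f k\<bar> \<le> (\<Sum>k | f k \<noteq> 0. \<bar>f k\<bar>)" for k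
  proof (cases "f k = 0")
    case True
    then show ?thesis by (simp add: sum_nonneg)
  next
    case False
    then show ?thesis using member_le_sum[of k "{k. f k \<noteq> 0}" "\<lambda>k. \<bar>f k\<bar>"] fin by auto
  qed
qed

lemma fls_nth_one_plus_X_times:
  "fls_nth ((1 + fls_X) * c) k = fls_nth c k + fls_nth (c :: real fls) (k - 1)"
  by (simp add: ring_distribs fls_X_times_conv_shift)

text \<open>In generating functions this is \<open>(1 - z) * (1 + z) = 1 - z ^ 2\<close>: the factor
  \<open>1 + z\<close> is used up, and \<open>1 - z ^ 2\<close> acts as the difference of the coarse
  data.\<close>

lemma bdiff_subdivision_step:
  assumes "finitely_supported f"
  shows "bdiff (subdivision_step ((1 + fls_X) * c) f) = subdivision_step c (bdiff f)"
proof
  fix k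
  let ?S = "{l. f l \<noteq> 0}"
  have fin: "finite ?S" using assms by (simp add: finitely_supported_def)
  \<comment> \<open>The support together with its translate by one carries both \<open>f\<close> and
    \<open>bdiff f\<close>, so all sums can run over one index set.\<close>
  let ?L = "?S \<union> (+) 1 ` ?S"
  have L: "finite ?L" using fin by simp
  have f0: "f l = 0" "f (l - 1) = 0" if l: "l \<notin> ?L" for l
  proof -
    show "f l = 0" using l by simp
    have "1 + (l - 1) \<notin> (+) 1 ` ?S" using l by simp
    then have "l - 1 \<notin> ?S" by (meson image_eqI)
    then show "f (l - 1) = 0" by simp
  qed
  have s1: "subdivision_step a f = (\<lambda>k. \<Sum>l\<in>?L. fls_nth a (k - 2 * l) * f l)" for a
    by (rule subdivision_step_eq_sum[OF L f0(1)])
  have s2: "subdivision_step c (bdiff f) k = (\<Sum>l\<in>?L. fls_nth c (k - 2 * l) * bdiff f l)"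
  proof -
    have "bdiff f l = 0" if "l \<notin> ?L" for l
      unfolding bdiff_def f0[OF that] by simp
    from subdivision_step_eq_sum[OF L this] show ?thesis by simp
  qed
  have "(\<Sum>l\<in>?L. fls_nth c (k - 2 * l) * f (l - 1)) = (\<Sum>l\<in>(+) 1 ` ?S. fls_nth c (k - 2 * l) * f (l - 1))"
  proof (rule sum.mono_neutral_right[OF L])
    have "f (l - 1) = 0" if l: "l \<notin> (+) 1 ` ?S" for l
    proof -
      have "1 + (l - 1) \<notin> (+) 1 ` ?S" using l by simp
      then have "l - 1 \<notin> ?S" by (meson image_eqI)
      then show "f (l - 1) = 0" by simp
    qed
    then show "\<forall>l\<in>?L - (+) 1 ` ?S. fls_nth c (k - 2 * l) * f (l - 1) = 0" by simp
  qed blast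
  also have "\<dots> = (\<Sum>l\<in>?S. fls_nth c (k - 2 - 2 * l) * f l)"
    by (subst sum.reindex) (auto simp: algebra_simps)
  also have "\<dots> = (\<Sum>l\<in>?L. fls_nth c (k - 2 - 2 * l) * f l)"
    by (rule sum.mono_neutral_left[OF L]) auto
  finally have shift: "(\<Sum>l\<in>?L. fls_nth c (k - 2 * l) * f (l - 1))
      = (\<Sum>l\<in>?L. fls_nth c (k - 2 - 2 * l) * f l)" .
  have "k - 1 - 2 * l = k - 2 * l - 1" "k - 2 * l - 1 - 1 = k - 2 - 2 * l" for l by simp_all
  then show "bdiff (subdivision_step ((1 + fls_X) * c) f) k = subdivision_step c (bdiff f) k"
    unfolding bdiff_def[of "subdivision_step _ _"] s1 s2 fls_nth_one_plus_X_times
    by (simp only: bdiff_def right_diff_distrib distrib_right sum.distrib sum_subtractf shift)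
qed

lemma abs_diff_le_bdiff:
  assumes "\<And>k. \<bar>bdiff f k\<bar> \<le> D"
  shows "\<bar>f i - f j\<bar> \<le> \<bar>of_int (i - j)\<bar> * D"
proof -
  have *: "\<bar>f (j + int n) - f j\<bar> \<le> n * D" for j n
  proof (induction n)
    case (Suc n)
    have "f (j + int (Suc n)) - f (j + int n) = bdiff f (j + int (Suc n))"
      by (simp add: bdiff_def algebra_simps)
    then show ?case using Suc assms[of "j + int (Suc n)"] by (simp add: algebra_simps)
  qed simp
  show ?thesis
  proof (cases "j \<le> i")
    case True
    then show ?thesis using *[of j "nat (i - j)"] by simp
  next
    case False
    then show ?thesis using *[of i "nat (j - i)"] by (simp add: abs_minus_commute)
  qed
qed

text \<open>For each \<open>i\<close> exactly one of the two integers \<open>k - i\<close>, \<open>k - i - 1\<close> is even.\<close>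

lemma subdivision_step_one_plus_X:
  assumes c: "laurent_polynomial c" and f: "finitely_supported f"
  shows "subdivision_step ((1 + fls_X) * c) f k
    = (\<Sum>i | fls_nth c i \<noteq> 0. fls_nth c i * f ((k - i) div 2))"
proof -
  let ?S = "{l. f l \<noteq> 0}" let ?I = "{i. fls_nth c i \<noteq> 0}"
  have fin: "finite ?S" "finite ?I" using assms by (simp_all add: finitely_supported_def)
  have inner: "(\<Sum>i\<in>?I. if (k - i) div 2 = l then fls_nth c i else 0)
      = fls_nth c (k - 2 * l) + fls_nth c (k - 2 * l - 1)" for l
  proof -
    have "(\<Sum>i\<in>?I. if (k - i) div 2 = l then fls_nth c i else 0)
      = (\<Sum>i\<in>{k - 2 * l, k - 2 * l - 1}. fls_nth c i)"
    proof (rule sum.mono_neutral_cong[OF _ fin(2)])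
      show "(if (k - i) div 2 = l then fls_nth c i else 0) = 0"
        if "i \<in> ?I - {k - 2 * l, k - 2 * l - 1}" for i
      proof -
        have "i = k - 2 * l \<or> i = k - 2 * l - 1" if "(k - i) div 2 = l" using that by presburger
        with that show ?thesis by auto
      qed
      show "(if (k - i) div 2 = l then fls_nth c i else 0) = fls_nth c i"
        if "i \<in> ?I \<inter> {k - 2 * l, k - 2 * l - 1}" for i
      proof -
        have "(k - i) div 2 = l" using that by auto
        then show ?thesis by simp
      qed
    qed auto
    then show ?thesis by simp
  qed
  have "(\<Sum>i\<in>?I. fls_nth c i * f ((k - i) div 2))
      = (\<Sum>i\<in>?I. \<Sum>l\<in>?S. if (k - i) div 2 = l then fls_nth c i * f l else 0)"
    using fin by (intro sum.cong) auto
  also have "\<dots> = (\<Sum>l\<in>?S. (\<Sum>i\<in>?I. if (k - i) div 2 = l then fls_nth c i else 0) * f l)"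
    by (subst sum.swap) (auto simp: sum_distrib_right intro!: sum.cong)
  also have "\<dots> = subdivision_step ((1 + fls_X) * c) f k"
    unfolding inner using subdivision_step_eq_sum[OF fin(1), of f "(1 + fls_X) * c"]
    by (simp only: fls_nth_one_plus_X_times) simp
  finally show ?thesis by simp
qed

text \<open>The sum over \<open>i\<close> reads \<open>f\<close> only within distance |i| + 1 of the
  parent index \<open>k div 2\<close>, and the coefficients of \<open>c\<close> add up to its value
  at \<open>z = 1\<close>. The constant depends on \<open>c\<close> alone, hence is the same on all
  levels.\<close>

lemma subdivision_step_near_parent:
  assumes c: "laurent_polynomial c"
  obtains K where "K \<ge> 0" "\<And>f k D. finitely_supported f \<Longrightarrow> (\<And>k. \<bar>bdiff f k\<bar> \<le> D) \<Longrightarrow>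
    \<bar>subdivision_step ((1 + fls_X) * c) f k - Re (on_circle c 0) * f (k div 2)\<bar> \<le> K * D"
proof
  let ?I = "{i. fls_nth c i \<noteq> 0}"
  let ?K = "\<Sum>i\<in>?I. \<bar>fls_nth c i\<bar> * (\<bar>of_int i\<bar> + 1)"
  show "0 \<le> ?K" by (intro sum_nonneg) auto
  fix f k D
  assume f: "finitely_supported f" and D: "\<And>k. \<bar>bdiff f k\<bar> \<le> D"
  have "0 \<le> D" using D[of 0] by linarith
  have c0: "Re (on_circle c 0) = (\<Sum>i\<in>?I. fls_nth c i)"
    by (simp add: fourier_def)
  have "\<bar>subdivision_step ((1 + fls_X) * c) f k - Re (on_circle c 0) * f (k div 2)\<bar>
      = \<bar>\<Sum>i\<in>?I. fls_nth c i * (f ((k - i) div 2) - f (k div 2))\<bar>"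
    unfolding subdivision_step_one_plus_X[OF c f] c0
    by (simp add: sum_distrib_right right_diff_distrib sum_subtractf)
  also have "\<dots> \<le> (\<Sum>i\<in>?I. \<bar>fls_nth c i\<bar> * (\<bar>of_int i\<bar> + 1) * D)"
  proof (rule order.trans[OF sum_abs], rule sum_mono)
    fix i
    have "\<bar>f ((k - i) div 2) - f (k div 2)\<bar> \<le> \<bar>of_int ((k - i) div 2 - k div 2)\<bar> * D"
      by (rule abs_diff_le_bdiff[OF D])
    also have "\<dots> \<le> (\<bar>of_int i\<bar> + 1) * D"
    proof (rule mult_right_mono[OF _ \<open>0 \<le> D\<close>])
      have "\<bar>(k - i) div 2 - k div 2\<bar> \<le> \<bar>i\<bar> + 1" by presburger
      then show "\<bar>of_int ((k - i) div 2 - k div 2)\<bar> \<le> \<bar>real_of_int i\<bar> + 1" by linarith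
    qed
    finally show "\<bar>fls_nth c i * (f ((k - i) div 2) - f (k div 2))\<bar>
        \<le> \<bar>fls_nth c i\<bar> * (\<bar>of_int i\<bar> + 1) * D"
      by (simp add: abs_mult mult_left_mono mult.assoc)
  qed
  finally show "\<bar>subdivision_step ((1 + fls_X) * c) f k - Re (on_circle c 0) * f (k div 2)\<bar> \<le> ?K * D"
    by (simp add: sum_distrib_right)
qed

text \<open>A single difference passes through all \<open>n\<close> levels (inner induction) and
  costs one factor \<open>1 + z\<close> of the symbol; the outer induction repeats this
  \<open>r\<close> times.\<close>

lemma bdiff_subdivision_data:
  assumes "laurent_polynomial B" "finitely_supported f0" "r \<le> N"
  shows "(bdiff ^^ r) (subdivision_data ((1 + fls_X) ^ N * B) f0 n)
    = subdivision_data ((1 + fls_X) ^ (N - r) * B) ((bdiff ^^ r) f0) n"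
  using \<open>r \<le> N\<close>
proof (induction r)
  case (Suc r)
  let ?a = "\<lambda>i. (1 + fls_X) ^ i * B"
  have split: "?a (N - r) = (1 + fls_X) * ?a (N - Suc r)"
    using Suc.prems by (simp add: Suc_diff_Suc mult.assoc flip: power_Suc)
  have lp: "laurent_polynomial (?a i)" for i
    by (intro laurent_polynomial_intros assms)
  have "bdiff (subdivision_data (?a (N - r)) g n) = subdivision_data (?a (N - Suc r)) (bdiff g) n"
    if g: "finitely_supported g" for g
  proof (induction n)
    case 0
    then show ?case by (simp add: subdivision_data_def)
  next
    case (Suc n)
    have "bdiff (subdivision_data (?a (N - r)) g (Suc n))
        = subdivision_step (?a (N - Suc r)) (bdiff (subdivision_data (?a (N - r)) g n))"
      unfolding subdivision_data_Suc using subdivision_data_Laurent(1)[OF lp g]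
      by (subst (1) split) (rule bdiff_subdivision_step)
    then show ?case by (simp only: Suc subdivision_data_Suc)
  qed
  from this[OF finitely_supported_bdiff_iterate[OF assms(2)], of r] Suc show ?case by simp
qed simp

section \<open>Limits of dyadic step functions\<close>

text \<open>A linear recursion with geometric forcing follows the slower of the two rates. For equal
  rates a factor \<open>n\<close> would appear, hence \<open>\<rho> \<noteq> \<tau>\<close>.\<close>

lemma geometric_recursion_bound:
  fixes e :: "nat \<Rightarrow> real"
  assumes step: "\<And>n. e (Suc n) \<le> \<rho> * e n + C * \<tau> ^ n" and "\<rho> \<noteq> \<tau>" "\<rho> > 0" "\<tau> > 0" "C \<ge> 0" "e 0 \<ge> 0"
  obtains K where "K \<ge> 0" "\<And>n. e n \<le> K * max \<rho> \<tau> ^ n"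
proof (cases "\<rho> < \<tau>")
  case True
  \<comment> \<open>Chosen so that \<open>C \<le> K * (\<tau> - \<rho>)\<close>: the forcing fits
    into the gap between the two rates.\<close>
  define K where "K = e 0 + C / (\<tau> - \<rho>)"
  have K: "C \<le> K * (\<tau> - \<rho>)" 
  proof -
    have "K * (\<tau> - \<rho>) = e 0 * (\<tau> - \<rho>) + C" using True by (simp add: K_def distrib_right)
    then show ?thesis using True assms by simp
  qed
  have "e n \<le> K * \<tau> ^ n" for n
  proof (induction n)
    case 0
    then show ?case using True assms by (simp add: K_def)
  next
    case (Suc n)
    have "e (Suc n) \<le> \<rho> * (K * \<tau> ^ n) + C * \<tau> ^ n"
      using step[of n] mult_left_mono[OF Suc, of \<rho>] \<open>\<rho> > 0\<close> by linarith
    also have "\<dots> \<le> \<rho> * (K * \<tau> ^ n) + (K * (\<tau> - \<rho>)) * \<tau> ^ n"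
      using K \<open>\<tau> > 0\<close> by (intro add_left_mono mult_right_mono) auto
    also have "\<dots> = K * \<tau> ^ Suc n" by (simp add: algebra_simps)
    finally show ?case .
  qed
  then show thesis using that[of K] True assms by (simp add: max_def K_def)
next
  case False
  then have lt: "\<tau> < \<rho>" using assms by simp
  \<comment> \<open>\<open>- L * \<tau> ^ n\<close> is a particular solution of the recursion;
    carrying it along strengthens the claim so that the induction closes.\<close>
  define L where "L = C / (\<rho> - \<tau>)"
  have L: "L \<ge> 0" "\<rho> * L - C = L * \<tau>" using lt assms by (simp_all add: L_def field_simps)
  have "e n \<le> (e 0 + L) * \<rho> ^ n - L * \<tau> ^ n" for n
  proof (induction n)
    case (Suc n)
    have "e (Suc n) \<le> \<rho> * ((e 0 + L) * \<rho> ^ n - L * \<tau> ^ n) + C * \<tau> ^ n"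
      using step[of n] mult_left_mono[OF Suc, of \<rho>] \<open>\<rho> > 0\<close> by linarith
    also have "\<dots> = (e 0 + L) * \<rho> ^ Suc n - (\<rho> * L - C) * \<tau> ^ n" by (simp add: algebra_simps)
    finally show ?case by (simp add: L)
  qed simp
  moreover have "L * \<tau> ^ n \<ge> 0" for n using L \<open>\<tau> > 0\<close> by simp
  ultimately have "e n \<le> (e 0 + L) * \<rho> ^ n" for n by (smt (verit))
  then show thesis using that[of "e 0 + L"] lt L assms by (simp add: max_def)
qed

text \<open>Halving the index of the cell of \<open>x\<close> gives its cell on the next coarser
  level, so parent estimates for indices become estimates between consecutive levels at a fixed
  \<open>x\<close>.\<close>

lemma floor_double_div_2: "\<lfloor>2 ^ Suc n * x\<rfloor> div 2 = \<lfloor>2 ^ n * (x :: real)\<rfloor>"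
  using floor_divide_real_eq_div[of 2 "2 ^ Suc n * x"] by simp

text \<open>Along the nested cells containing \<open>x\<close> the increments are dominated by a
  geometric series, whose tail from \<open>n\<close> on is the bound.\<close>

lemma dyadic_limit_exists:
  fixes d :: "nat \<Rightarrow> int \<Rightarrow> real"
  assumes step: "\<And>n k. \<bar>d (Suc n) k - d n (k div 2)\<bar> \<le> C * \<tau> ^ n" and \<tau>: "0 < \<tau>" "\<tau> < 1"
  obtains F :: "real \<Rightarrow> real" where "\<And>n x. \<bar>F x - d n \<lfloor>2 ^ n * x\<rfloor>\<bar> \<le> C / (1 - \<tau>) * \<tau> ^ n"
proof -
  define F where "F x = lim (\<lambda>n. d n \<lfloor>2 ^ n * x\<rfloor>)" for x :: real
  have "\<bar>F x - d n \<lfloor>2 ^ n * x\<rfloor>\<bar> \<le> C / (1 - \<tau>) * \<tau> ^ n" for n x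
  proof -
  define s where "s n = d n \<lfloor>2 ^ n * x\<rfloor>" for n
  have diff: "\<bar>s (Suc n) - s n\<bar> \<le> C * \<tau> ^ n" for n
    using step[of n "\<lfloor>2 ^ Suc n * x\<rfloor>"] unfolding floor_double_div_2 s_def by simp
  have geo: "summable (\<lambda>n. C * \<tau> ^ n)" using \<tau> by (intro summable_mult summable_geometric) auto
  have abs: "summable (\<lambda>n. \<bar>s (Suc n) - s n\<bar>)"
    by (rule summable_comparison_test'[OF geo]) (use diff in auto)
  then have sm: "summable (\<lambda>n. s (Suc n) - s n)" by (rule summable_rabs_cancel)
  have tel: "(\<Sum>i<n. s (Suc i) - s i) = s n - s 0" for n by (rule sum_lessThan_telescope)
  have "(\<lambda>n. s n - s 0) \<longlonglongrightarrow> suminf (\<lambda>n. s (Suc n) - s n)"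
    using summable_LIMSEQ[OF sm] by (simp add: tel)
  then have "(\<lambda>n. s n - s 0 + s 0) \<longlonglongrightarrow> suminf (\<lambda>n. s (Suc n) - s n) + s 0"
    by (rule tendsto_add) simp
  then have "s \<longlonglongrightarrow> suminf (\<lambda>n. s (Suc n) - s n) + s 0" by simp
  then have lim: "lim s = suminf (\<lambda>n. s (Suc n) - s n) + s 0" by (rule limI)
  have "lim s - s n = suminf (\<lambda>i. s (Suc (i + n)) - s (i + n))"
    using suminf_minus_initial_segment[OF sm, of n] by (simp add: lim tel)
  also have "\<bar>\<dots>\<bar> \<le> suminf (\<lambda>i. \<bar>s (Suc (i + n)) - s (i + n)\<bar>)"
    by (rule summable_rabs) (rule summable_ignore_initial_segment[OF abs])
  also have "\<dots> \<le> suminf (\<lambda>i. C * \<tau> ^ (i + n))"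
    by (intro suminf_le diff summable_ignore_initial_segment[OF abs] summable_ignore_initial_segment[OF geo])
  also have "\<dots> = C * \<tau> ^ n * suminf (\<lambda>i. \<tau> ^ i)"
    using \<tau> by (subst suminf_mult[symmetric]) (auto simp: power_add mult_ac)
  also have "\<dots> = C / (1 - \<tau>) * \<tau> ^ n"
    using \<tau> by (simp add: suminf_geometric field_simps)
  finally show ?thesis by (simp add: s_def[abs_def] F_def)
  qed
  then show thesis by (rule that)
qed

lemma dyadic_scale_exists:
  fixes h :: real
  assumes "0 < h" "h \<le> 1"
  obtains n :: nat where "2 ^ n * h \<le> 1" "1 < 2 ^ Suc n * h"
proof -
  let ?n = "nat \<lfloor>log 2 (1 / h)\<rfloor>"
  have "0 \<le> log 2 (1 / h)" using assms by simp
  then have n: "real ?n \<le> log 2 (1 / h)" "log 2 (1 / h) < real (Suc ?n)" by linarith+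
  have "2 ^ ?n \<le> 1 / h"
    using n(1) assms by (subst (asm) le_log_iff) (simp_all only: powr_realpow, auto)
  moreover have "1 / h < 2 ^ Suc ?n"
    using n(2) assms by (subst (asm) log_less_iff) (simp_all only: powr_realpow, auto)
  ultimately show thesis using assms by (intro that[of ?n]) (auto simp: field_simps)
qed

text \<open>On the level where \<open>2 ^ - n\<close> lies between |x - y| and 2 |x - y|, the cells
  of \<open>x\<close> and \<open>y\<close> are at most two steps apart. Two approximation errors and
  two differences make the factor 4, and \<open>2 powr \<alpha>\<close> pays for the factor 2 in the
  choice of the level.\<close>

lemma dyadic_limit_hoelder:
  fixes d :: "nat \<Rightarrow> int \<Rightarrow> real"
  assumes F: "\<And>n x. \<bar>F x - d n \<lfloor>2 ^ n * x\<rfloor>\<bar> \<le> K * (2 powr - \<alpha>) ^ n"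
    and d: "\<And>n k. \<bar>bdiff (d n) k\<bar> \<le> K * (2 powr - \<alpha>) ^ n"
    and "\<alpha> > 0" and xy: "\<bar>x - y\<bar> \<le> 1"
  shows "\<bar>F x - F y\<bar> \<le> 4 * K * 2 powr \<alpha> * \<bar>x - y\<bar> powr \<alpha>"
proof (cases "x = y")
  case False
  have "K \<ge> 0" using F[of x 0] by simp
  from dyadic_scale_exists[of "\<bar>x - y\<bar>"] False xy
  obtain n :: nat where n: "2 ^ n * \<bar>x - y\<bar> \<le> 1" "1 < 2 ^ Suc n * \<bar>x - y\<bar>" by auto
  have "\<bar>2 ^ n * x - 2 ^ n * y\<bar> \<le> 1" using n(1) by (simp add: abs_mult flip: right_diff_distrib)
  then have fl: "\<bar>of_int (\<lfloor>2 ^ n * x\<rfloor> - \<lfloor>2 ^ n * y\<rfloor>)\<bar> \<le> (2 :: real)" by linarith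
  let ?T = "K * (2 powr - \<alpha>) ^ n"
  have T: "?T \<ge> 0" using \<open>K \<ge> 0\<close> by simp
  have "\<bar>d n \<lfloor>2 ^ n * x\<rfloor> - d n \<lfloor>2 ^ n * y\<rfloor>\<bar> \<le> 2 * ?T"
    using abs_diff_le_bdiff[OF d, of n "\<lfloor>2 ^ n * x\<rfloor>" "\<lfloor>2 ^ n * y\<rfloor>"] mult_right_mono[OF fl T] by linarith
  then have "\<bar>F x - F y\<bar> \<le> 4 * ?T" using F[of x n] F[of y n] by linarith
  also have "(2 powr - \<alpha>) ^ n \<le> 2 powr \<alpha> * \<bar>x - y\<bar> powr \<alpha>"
  proof -
    have "(2 powr - \<alpha>) ^ n = (1 / 2 ^ n) powr \<alpha>"
      by (simp add: powr_minus powr_divide powr_realpow[symmetric] powr_powr mult.commute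
          field_simps flip: powr_realpow)
    also have "\<dots> \<le> (2 * \<bar>x - y\<bar>) powr \<alpha>"
      using n(2) \<open>\<alpha> > 0\<close> by (intro powr_mono2) (auto simp: field_simps)
    finally show ?thesis by (simp add: powr_mult)
  qed
  then have "4 * ?T \<le> 4 * (K * (2 powr \<alpha> * \<bar>x - y\<bar> powr \<alpha>))"
    using \<open>K \<ge> 0\<close> by (intro mult_left_mono) auto
  finally show ?thesis by (simp add: mult_ac)
qed simp

lemma abs_diff_le_bdiff_local:
  assumes "a \<le> b" "\<And>k. a < k \<Longrightarrow> k \<le> b \<Longrightarrow> \<bar>bdiff f k - c\<bar> \<le> D"
  shows "\<bar>f b - f a - of_int (b - a) * c\<bar> \<le> of_int (b - a) * D"
  using assms
proof (induction b rule: int_ge_induct)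
  case (step i)
  have "\<bar>bdiff f (i + 1) - c\<bar> \<le> D" using step by auto
  moreover have "\<bar>f i - f a - of_int (i - a) * c\<bar> \<le> of_int (i - a) * D" using step by auto
  ultimately show ?case by (simp add: bdiff_def algebra_simps)
qed simp

lemma dyadic_floor_tendsto: "(\<lambda>n. of_int \<lfloor>2 ^ n * x\<rfloor> / 2 ^ n) \<longlonglongrightarrow> (x :: real)"
proof -
  have "(\<lambda>n. of_int \<lfloor>2 ^ n * x\<rfloor> / 2 ^ n - x) \<longlonglongrightarrow> 0"
  proof (rule Lim_null_comparison)
    show "\<forall>\<^sub>F n in sequentially. norm (of_int \<lfloor>2 ^ n * x\<rfloor> / 2 ^ n - x) \<le> (1 / 2) ^ n"
    proof (rule always_eventually, rule allI)
      fix n :: nat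
      have "of_int \<lfloor>2 ^ n * x\<rfloor> / 2 ^ n - x = (of_int \<lfloor>2 ^ n * x\<rfloor> - 2 ^ n * x) / 2 ^ n"
        by (simp add: diff_divide_distrib)
      also have "\<bar>\<dots>\<bar> \<le> 1 / 2 ^ n"
        using floor_correct[of "2 ^ n * x"] unfolding abs_divide
        by (intro divide_mono) (auto simp: abs_le_iff algebra_simps)
      finally show "norm (of_int \<lfloor>2 ^ n * x\<rfloor> / 2 ^ n - x) \<le> (1 / 2) ^ n"
        by (simp add: power_one_over)
    qed
  qed (rule LIMSEQ_power_zero, simp)
  then show ?thesis by (simp add: LIM_zero_iff)
qed

lemma dyadic_limit_unique:
  assumes "\<And>n. \<bar>L - s n\<bar> \<le> K * \<tau> ^ n" "0 \<le> \<tau>" "\<tau> < (1 :: real)"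
  shows "s \<longlonglongrightarrow> L"
proof -
  have "(\<lambda>n. s n - L) \<longlonglongrightarrow> 0"
  proof (rule Lim_null_comparison)
    show "\<forall>\<^sub>F n in sequentially. norm (s n - L) \<le> K * \<tau> ^ n"
      using assms(1) by (intro always_eventually) (auto simp: abs_minus_commute)
    show "(\<lambda>n. K * \<tau> ^ n) \<longlonglongrightarrow> 0"
      using assms by (intro tendsto_mult_right_zero LIMSEQ_power_zero) auto
  qed
  then show ?thesis by (simp add: LIM_zero_iff)
qed

text \<open>An increment of \<open>d n\<close> between the cells of \<open>u\<close> and
  \<open>v\<close> is a sum of values of \<open>e n\<close> divided by \<open>2 ^ n\<close>. These
  values are close to \<open>G\<close>, hence to \<open>G x\<close> by continuity, and the limit in
  \<open>n\<close> yields a mean value inequality for \<open>F\<close>.\<close>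

lemma dyadic_limit_has_derivative:
  fixes d e :: "nat \<Rightarrow> int \<Rightarrow> real"
  assumes F: "\<And>n x. \<bar>F x - d n \<lfloor>2 ^ n * x\<rfloor>\<bar> \<le> K * \<tau> ^ n"
    and G: "\<And>n x. \<bar>G x - e n \<lfloor>2 ^ n * x\<rfloor>\<bar> \<le> K' * \<tau>' ^ n"
    and \<tau>: "0 \<le> \<tau>" "\<tau> < 1" "0 \<le> \<tau>'" "\<tau>' < 1"
    and e: "\<And>n k. 2 ^ n * bdiff (d n) k = e n k"
    and cont: "isCont G x"
  shows "(F has_real_derivative G x) (at x)"
proof -
  have main: "\<bar>F v - F u - G x * (v - u)\<bar> \<le> \<epsilon> * (v - u)"
    if uv: "u < v" and near: "\<And>z. u \<le> z \<Longrightarrow> z \<le> v \<Longrightarrow> \<bar>G z - G x\<bar> \<le> \<epsilon>" for u v \<epsilon>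
  proof -
    let ?a = "\<lambda>n. \<lfloor>2 ^ n * u\<rfloor>" and ?b = "\<lambda>n. \<lfloor>2 ^ n * v\<rfloor>"
    let ?w = "\<lambda>n. of_int (?b n) / 2 ^ n - of_int (?a n) / (2 ^ n :: real)"
    have "\<bar>d n (?b n) - d n (?a n) - G x * ?w n\<bar> \<le> (\<epsilon> + K' * \<tau>' ^ n) * ?w n" for n
    proof -
      have ab: "?a n \<le> ?b n" using uv by (intro floor_mono) simp
      have "\<bar>bdiff (d n) k - G x / 2 ^ n\<bar> \<le> (\<epsilon> + K' * \<tau>' ^ n) / 2 ^ n" if k: "?a n < k" "k \<le> ?b n" for k
      proof -
        \<comment> \<open>Since the differences are backward, the indices involved lie above the
          floor for \<open>u\<close> and up to the floor for \<open>v\<close>, so their dyadic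
          points stay in the interval. At such a point the floor is \<open>k\<close> itself, and
          \<open>G\<close> is compared with \<open>e n k\<close>.\<close>
        have "u \<le> of_int k / 2 ^ n" "of_int k / 2 ^ n \<le> v"
          using k by (simp_all add: field_simps floor_less_iff le_floor_iff)
        from near[OF this] have "\<bar>G (of_int k / 2 ^ n) - G x\<bar> \<le> \<epsilon>" .
        moreover have "\<bar>G (of_int k / 2 ^ n) - e n k\<bar> \<le> K' * \<tau>' ^ n"
          using G[of "of_int k / 2 ^ n" n] by simp
        ultimately have "\<bar>e n k - G x\<bar> \<le> \<epsilon> + K' * \<tau>' ^ n" by linarith
        then have "\<bar>(e n k - G x) / 2 ^ n\<bar> \<le> (\<epsilon> + K' * \<tau>' ^ n) / 2 ^ n"
          by (simp add: divide_right_mono)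
        then show ?thesis by (simp add: e[symmetric] diff_divide_distrib)
      qed
      from abs_diff_le_bdiff_local[OF ab this] show ?thesis
        by (simp add: diff_divide_distrib[symmetric] mult.commute)
    qed
    moreover have "(\<lambda>n. \<bar>d n (?b n) - d n (?a n) - G x * ?w n\<bar>) \<longlonglongrightarrow> \<bar>F v - F u - G x * (v - u)\<bar>"
      by (intro tendsto_intros dyadic_floor_tendsto dyadic_limit_unique[OF F \<tau>(1,2)])
    moreover have "(\<lambda>n. (\<epsilon> + K' * \<tau>' ^ n) * ?w n) \<longlonglongrightarrow> (\<epsilon> + K' * 0) * (v - u)"
      using \<tau> by (intro tendsto_intros dyadic_floor_tendsto LIMSEQ_power_zero) auto
    ultimately show ?thesis by (intro LIMSEQ_le) auto
  qed
  show ?thesis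
    unfolding has_field_derivative_def has_derivative_at_alt
  proof (intro conjI allI impI bounded_linear_mult_right)
    fix \<epsilon> :: real assume "0 < \<epsilon>"
    with cont obtain \<delta> where \<delta>: "\<delta> > 0" "\<And>z. \<bar>z - x\<bar> < \<delta> \<Longrightarrow> \<bar>G z - G x\<bar> < \<epsilon>"
      unfolding continuous_at_eps_delta dist_real_def by blast
    have "norm (F y - F x - G x * (y - x)) \<le> \<epsilon> * norm (y - x)" if "norm (y - x) < \<delta>" for y
    proof -
      consider "y = x" | "x < y" | "y < x" by linarith
      then show ?thesis
      proof cases
        case 2
        then show ?thesis using main[of x y \<epsilon>] \<delta>(2) that by (simp add: less_imp_le)
      next
        case 3
        then have "\<bar>F x - F y - G x * (x - y)\<bar> \<le> \<epsilon> * (x - y)"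
          using main[of y x \<epsilon>] \<delta>(2) that by (simp add: less_imp_le)
        with 3 show ?thesis by (simp add: algebra_simps abs_le_iff)
      qed simp
    qed
    then show "\<exists>d>0. \<forall>y. norm (y - x) < d \<longrightarrow> norm (F y - F x - G x * (y - x)) \<le> \<epsilon> * norm (y - x)"
      using \<delta>(1) by blast
  qed
qed

section \<open>Smoothness of limit functions from decay of differences\<close>

text \<open>The difference quotient of order \<open>r\<close> for the grid spacing
  \<open>2 ^ - n\<close>: the discrete counterpart of the derivative of order
  \<open>r\<close>.\<close>

definition scaled_diff :: "real fls \<Rightarrow> (int \<Rightarrow> real) \<Rightarrow> nat \<Rightarrow> nat \<Rightarrow> int \<Rightarrow> real" where
  "scaled_diff a f0 r n k = 2 ^ (r * n) * (bdiff ^^ r) (subdivision_data a f0 n) k"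

lemma bdiff_scaled_diff:
  "bdiff (scaled_diff a f0 r n) k = 2 ^ (r * n) * (bdiff ^^ Suc r) (subdivision_data a f0 n) k"
  "2 ^ n * bdiff (scaled_diff a f0 r n) k = scaled_diff a f0 (Suc r) n k"
proof -
  show *: "bdiff (scaled_diff a f0 r n) k = 2 ^ (r * n) * (bdiff ^^ Suc r) (subdivision_data a f0 n) k"
    by (simp add: bdiff_def scaled_diff_def right_diff_distrib)
  show "2 ^ n * bdiff (scaled_diff a f0 r n) k = scaled_diff a f0 (Suc r) n k"
    unfolding * scaled_diff_def[of _ _ "Suc r"] mult_Suc power_add by (simp only: mult.assoc)
qed

lemma linear_interpolant_near_floor:
  assumes "\<And>k. \<bar>bdiff f k\<bar> \<le> D"
  shows "\<bar>linear_interpolant f t - f \<lfloor>t\<rfloor>\<bar> \<le> D"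
proof -
  have "linear_interpolant f t - f \<lfloor>t\<rfloor> = frac t * bdiff f (\<lfloor>t\<rfloor> + 1)"
    by (simp add: linear_interpolant_def bdiff_def algebra_simps)
  also have "\<bar>\<dots>\<bar> \<le> 1 * D"
    unfolding abs_mult by (intro mult_mono assms) (auto simp: abs_le_iff less_imp_le[OF frac_lt_1] intro: order.trans[of _ 0])
  finally show ?thesis by simp
qed

lemma funpow_deriv_eq:
  assumes "\<And>r x. r < q \<Longrightarrow> (F r has_real_derivative F (Suc r) x) (at x)" "i \<le> q"
  shows "(deriv ^^ i) (F 0) = F i"
  using \<open>i \<le> q\<close>
proof (induction i)
  case (Suc i)
  have "deriv (F i) = F (Suc i)"
    using assms(1)[of i] Suc by (intro ext DERIV_imp_deriv) auto
  with Suc show ?case by simp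
qed simp

text \<open>The value of \<open>B\<close> at \<open>z = 1\<close> gives the symbol the value 2
  there; with the factor \<open>1 + z\<close> this means that constants are reproduced. Keeping
  \<open>s\<close> off the integers prevents the rates \<open>2 ^ - r\<close> and
  \<open>2 powr - s\<close> from coinciding.\<close>

locale smooth_scheme =
  fixes M :: nat and B :: "real fls" and f0 :: "int \<Rightarrow> real" and s :: real and C :: real
  assumes B: "laurent_polynomial B" "on_circle B 0 = (1 / 2) ^ M"
    and f0: "finitely_supported f0"
    and s: "0 < s" "s \<notin> \<int>" "s < M + 1"
    and decay: "\<bar>(bdiff ^^ Suc M) (subdivision_data ((1 + fls_X) ^ Suc M * B) f0 n) k\<bar>
      \<le> C * (2 powr - s) ^ n"
begin

abbreviation "a \<equiv> (1 + fls_X) ^ Suc M * B"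

text \<open>The rate at which scaled differences of order \<open>r\<close> converge. The cap 1
  reflects that they are controlled through the differences of order \<open>r + 1\<close>, for which
  the estimates give no better rate than \<open>2 ^ - (r + 1)\<close>.\<close>

abbreviation "\<alpha> r \<equiv> min 1 (s - real r)"

text \<open>After \<open>r\<close> differences the symbol keeps \<open>M + 1 - r\<close> factors
  \<open>1 + z\<close>. One of them drives the parent estimate, and the rest has the value
  \<open>2 ^ (M - r) / 2 ^ M = 2 ^ - r\<close> at \<open>z = 1\<close>.\<close>

lemma near_parent:
  assumes "r \<le> M"
  obtains K where "K \<ge> 0" "\<And>n k D. (\<And>k. \<bar>(bdiff ^^ Suc r) (subdivision_data a f0 n) k\<bar> \<le> D) \<Longrightarrow>
    \<bar>(bdiff ^^ r) (subdivision_data a f0 (Suc n)) k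
      - (1 / 2) ^ r * (bdiff ^^ r) (subdivision_data a f0 n) (k div 2)\<bar> \<le> K * D"
proof -
  let ?c = "(1 + fls_X) ^ (M - r) * B"
  have lp: "laurent_polynomial ((1 + fls_X) ^ i * B)" for i
    by (intro laurent_polynomial_intros B)
  have "on_circle ?c 0 = 2 ^ (M - r) * (1 / 2) ^ M"
    by (simp add: on_circle_simps laurent_polynomial_intros B)
  also have "\<dots> = of_real ((1 / 2) ^ r)"
    using assms by (simp add: power_diff power_one_over field_simps)
  finally have c0: "Re (on_circle ?c 0) = (1 / 2) ^ r" by simp
  have split: "(1 + fls_X) ^ (Suc M - r) * B = (1 + fls_X) * ?c"
    using assms by (simp add: Suc_diff_le mult.assoc)
  have data: "(bdiff ^^ r) (subdivision_data a f0 n)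
      = subdivision_data ((1 + fls_X) ^ (Suc M - r) * B) ((bdiff ^^ r) f0) n" for n
    using assms by (intro bdiff_subdivision_data B f0) simp
  have rec: "(bdiff ^^ r) (subdivision_data a f0 (Suc n))
      = subdivision_step ((1 + fls_X) * ?c) ((bdiff ^^ r) (subdivision_data a f0 n))" for n
    unfolding data unfolding subdivision_data_Suc by (simp only: split)
  have fs: "finitely_supported ((bdiff ^^ r) (subdivision_data a f0 n))" for n
    by (intro finitely_supported_bdiff_iterate subdivision_data_Laurent lp f0)
  obtain K where "K \<ge> 0" and K: "\<And>f k D. finitely_supported f \<Longrightarrow> (\<And>k. \<bar>bdiff f k\<bar> \<le> D) \<Longrightarrow>
      \<bar>subdivision_step ((1 + fls_X) * ?c) f k - Re (on_circle ?c 0) * f (k div 2)\<bar> \<le> K * D"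
    using subdivision_step_near_parent[OF lp, of "M - r"] by metis
  show thesis
  proof (rule that[OF \<open>K \<ge> 0\<close>])
    fix n k D
    assume "\<And>k. \<bar>(bdiff ^^ Suc r) (subdivision_data a f0 n) k\<bar> \<le> D"
    then have "\<And>k. \<bar>bdiff ((bdiff ^^ r) (subdivision_data a f0 n)) k\<bar> \<le> D" by simp
    from K[OF fs this] show "\<bar>(bdiff ^^ r) (subdivision_data a f0 (Suc n)) k
      - (1 / 2) ^ r * (bdiff ^^ r) (subdivision_data a f0 n) (k div 2)\<bar> \<le> K * D"
      unfolding rec c0 .
  qed
qed

text \<open>Downward induction on the order: the parent contributes the rate \<open>2 ^ - r\<close>,
  the differences of order \<open>r + 1\<close> the rate already established for them, and the
  slower one wins.\<close>

lemma difference_decay: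
  assumes "r \<le> Suc M"
  obtains K where "K \<ge> 0" "\<And>n k. \<bar>(bdiff ^^ r) (subdivision_data a f0 n) k\<bar> \<le> K * (2 powr - min (real r) s) ^ n"
proof -
  have "\<exists>K\<ge>0. \<forall>n k. \<bar>(bdiff ^^ r) (subdivision_data a f0 n) k\<bar> \<le> K * (2 powr - min (real r) s) ^ n"
    using assms
  proof (induction rule: inc_induct)
    case base
    have "C \<ge> 0" using decay[of 0 0] by simp
    moreover have "min (real (Suc M)) s = s" using s by simp
    ultimately show ?case using decay by metis
  next
    case (step r)
    define \<tau> where "\<tau> = 2 powr - min (real (Suc r)) s"
    define \<rho> :: real where "\<rho> = (1 / 2) ^ r"
    have \<rho>_powr: "\<rho> = 2 powr - real r" by (simp add: \<rho>_def powr_minus powr_realpow power_one_over inverse_eq_divide)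
    from step obtain K where K: "K \<ge> 0" "\<And>n k. \<bar>(bdiff ^^ Suc r) (subdivision_data a f0 n) k\<bar> \<le> K * \<tau> ^ n"
      unfolding \<tau>_def by blast
    obtain K' where K': "K' \<ge> 0" "\<And>n k D. (\<And>k. \<bar>(bdiff ^^ Suc r) (subdivision_data a f0 n) k\<bar> \<le> D) \<Longrightarrow>
      \<bar>(bdiff ^^ r) (subdivision_data a f0 (Suc n)) k
        - (1 / 2) ^ r * (bdiff ^^ r) (subdivision_data a f0 n) (k div 2)\<bar> \<le> K' * D"
      using near_parent[of r] step by (metis less_Suc_eq_le)
    obtain b where b: "b \<ge> 0" "\<And>k. \<bar>(bdiff ^^ r) f0 k\<bar> \<le> b"
      using finitely_supported_bounded[OF finitely_supported_bdiff_iterate[OF f0]] by metis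
    \<comment> \<open>The recursion taken with equality, started from a bound at level 0: a majorant
      of level \<open>n\<close> uniform in \<open>k\<close>.\<close>
    define e where "e = rec_nat b (\<lambda>n x. \<rho> * x + K' * K * \<tau> ^ n)"
    have e: "\<bar>(bdiff ^^ r) (subdivision_data a f0 n) k\<bar> \<le> e n" for n k
    proof (induction n arbitrary: k)
      case 0
      then show ?case using b by (simp add: e_def subdivision_data_def)
    next
      case (Suc n)
      let ?g = "\<lambda>n. (bdiff ^^ r) (subdivision_data a f0 n)"
      have "\<bar>?g (Suc n) k - \<rho> * ?g n (k div 2)\<bar> \<le> K' * (K * \<tau> ^ n)"
        unfolding \<rho>_def by (rule K'(2)[OF K(2)])
      moreover have "\<bar>\<rho> * ?g n (k div 2)\<bar> \<le> \<rho> * e n"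
        using mult_left_mono[OF Suc, of \<rho>] by (simp add: \<rho>_def abs_mult)
      moreover have "e (Suc n) = \<rho> * e n + K' * (K * \<tau> ^ n)" by (simp add: e_def)
      ultimately show ?case by linarith
    qed
    have "s \<noteq> real r" using s by auto
    then have "\<rho> \<noteq> \<tau>" using s by (auto simp: \<rho>_powr \<tau>_def min_def powr_inj)
    have "0 < \<rho>" "0 < \<tau>" by (simp_all add: \<rho>_def \<tau>_def)
    moreover have "e (Suc n) \<le> \<rho> * e n + K' * K * \<tau> ^ n" for n by (simp add: e_def)
    moreover have "0 \<le> K' * K" "0 \<le> e 0" using b K K' by (simp_all add: e_def)
    ultimately obtain L where L: "L \<ge> 0" "\<And>n. e n \<le> L * max \<rho> \<tau> ^ n"
      using \<open>\<rho> \<noteq> \<tau>\<close> by (metis geometric_recursion_bound)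
    \<comment> \<open>For \<open>r < s\<close> the parent rate is the larger one; for
      \<open>r > s\<close> it is \<open>2 powr - s\<close>, the rate of order
      \<open>r + 1\<close>.\<close>
    have "max \<rho> \<tau> = 2 powr - min (real r) s" using s by (auto simp: \<rho>_powr \<tau>_def min_def max_def)
    with L e show ?case by (metis order.trans)
  qed
  with that show thesis by blast
qed

lemma scaled_diff_estimates:
  assumes "real r < s"
  obtains K where "\<And>n k. \<bar>bdiff (scaled_diff a f0 r n) k\<bar> \<le> K * (2 powr - \<alpha> r) ^ n"
    "\<And>n k. \<bar>scaled_diff a f0 r (Suc n) k - scaled_diff a f0 r n (k div 2)\<bar> \<le> K * (2 powr - \<alpha> r) ^ n"
proof -
  have r: "r \<le> M" using assms s by linarith
  obtain K where K: "K \<ge> 0" "\<And>n k. \<bar>(bdiff ^^ Suc r) (subdivision_data a f0 n) k\<bar>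
      \<le> K * (2 powr - min (real (Suc r)) s) ^ n"
    using difference_decay[of "Suc r"] r by blast
  obtain K' where K': "K' \<ge> 0" "\<And>n k D. (\<And>k. \<bar>(bdiff ^^ Suc r) (subdivision_data a f0 n) k\<bar> \<le> D) \<Longrightarrow>
      \<bar>(bdiff ^^ r) (subdivision_data a f0 (Suc n)) k
        - (1 / 2) ^ r * (bdiff ^^ r) (subdivision_data a f0 n) (k div 2)\<bar> \<le> K' * D"
    using near_parent[OF r] by metis
  have pw: "2 ^ (r * n) * (2 powr - min (real (Suc r)) s) ^ n = (2 powr - \<alpha> r) ^ n" for n
  proof -
    have "2 ^ r * 2 powr - min (real (Suc r)) s = 2 powr (real r - min (real (Suc r)) s)"
      by (simp add: powr_diff powr_minus powr_realpow inverse_eq_divide)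
    also have "real r - min (real (Suc r)) s = - \<alpha> r" by (auto simp: min_def)
    finally show ?thesis by (simp add: power_mult power_mult_distrib[symmetric])
  qed
  let ?K = "K + 2 ^ r * K' * K"
  show thesis
  proof (rule that[of ?K])
    fix n k
    have "\<bar>bdiff (scaled_diff a f0 r n) k\<bar> \<le> 2 ^ (r * n) * (K * (2 powr - min (real (Suc r)) s) ^ n)"
      unfolding bdiff_scaled_diff(1) using K(2)[where n=n and k=k] by (simp add: abs_mult del: funpow.simps)
    also have "\<dots> = K * (2 powr - \<alpha> r) ^ n" by (simp only: pw[symmetric] mult_ac)
    also have "\<dots> \<le> ?K * (2 powr - \<alpha> r) ^ n"
      using K K' by (intro mult_right_mono) auto
    finally show "\<bar>bdiff (scaled_diff a f0 r n) k\<bar> \<le> ?K * (2 powr - \<alpha> r) ^ n" .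
    let ?g = "\<lambda>n. (bdiff ^^ r) (subdivision_data a f0 n)"
    have "scaled_diff a f0 r (Suc n) k - scaled_diff a f0 r n (k div 2)
        = 2 ^ (r * Suc n) * (?g (Suc n) k - (1 / 2) ^ r * ?g n (k div 2))"
      by (simp add: scaled_diff_def power_add power_one_over field_simps)
    also have "\<bar>\<dots>\<bar> \<le> 2 ^ (r * Suc n) * (K' * (K * (2 powr - min (real (Suc r)) s) ^ n))"
      using K'(2)[OF K(2), of n k] by (simp add: abs_mult del: mult_Suc_right)
    also have "\<dots> = 2 ^ r * K' * K * (2 powr - \<alpha> r) ^ n"
      unfolding pw[symmetric] by (simp add: power_add mult_ac)
    also have "\<dots> \<le> ?K * (2 powr - \<alpha> r) ^ n"
      using K K' by (intro mult_right_mono) auto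
    finally show "\<bar>scaled_diff a f0 r (Suc n) k - scaled_diff a f0 r n (k div 2)\<bar> \<le> ?K * (2 powr - \<alpha> r) ^ n" .
  qed
qed

text \<open>The bound on \<open>F\<close> itself is read off at level 0, where the differences of
  the data are bounded. It is global and will settle distant pairs of points in the Hoelder
  condition. One constant is made to serve all three estimates.\<close>

lemma limit_derivative_exists:
  assumes "real r < s"
  obtains F :: "real \<Rightarrow> real" and K
  where "\<And>n x. \<bar>F x - scaled_diff a f0 r n \<lfloor>2 ^ n * x\<rfloor>\<bar> \<le> K * (2 powr - \<alpha> r) ^ n"
    "\<And>n k. \<bar>bdiff (scaled_diff a f0 r n) k\<bar> \<le> K * (2 powr - \<alpha> r) ^ n"
    "\<And>x. \<bar>F x\<bar> \<le> K"
proof -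
  have \<alpha>: "\<alpha> r > 0" using assms by simp
  obtain K1 where K1: "\<And>n k. \<bar>bdiff (scaled_diff a f0 r n) k\<bar> \<le> K1 * (2 powr - \<alpha> r) ^ n"
    "\<And>n k. \<bar>scaled_diff a f0 r (Suc n) k - scaled_diff a f0 r n (k div 2)\<bar> \<le> K1 * (2 powr - \<alpha> r) ^ n"
    using scaled_diff_estimates[OF assms] by metis
  let ?\<tau> = "2 powr - \<alpha> r"
  have \<tau>: "0 < ?\<tau>" "?\<tau> < 1" using \<alpha> by (auto simp del: min_less_iff_conj simp: powr_less_one)
  obtain F :: "real \<Rightarrow> real" where F: "\<And>n x. \<bar>F x - scaled_diff a f0 r n \<lfloor>2 ^ n * x\<rfloor>\<bar> \<le> K1 / (1 - ?\<tau>) * ?\<tau> ^ n"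
    using dyadic_limit_exists[where d = "scaled_diff a f0 r", OF K1(2) \<tau>] by metis
  obtain b where b: "b \<ge> 0" "\<And>k. \<bar>(bdiff ^^ r) f0 k\<bar> \<le> b"
    using finitely_supported_bounded[OF finitely_supported_bdiff_iterate[OF f0]] by metis
  have "K1 \<ge> 0" using K1(1)[of 0 0] by simp
  let ?K = "K1 + K1 / (1 - ?\<tau>) + b"
  have pos: "K1 / (1 - ?\<tau>) \<ge> 0" using \<open>K1 \<ge> 0\<close> \<tau> by simp
  show thesis
  proof (rule that[of F ?K])
    show "\<bar>F x - scaled_diff a f0 r n \<lfloor>2 ^ n * x\<rfloor>\<bar> \<le> ?K * ?\<tau> ^ n" for n x
      by (rule order.trans[OF F mult_right_mono]) (use \<open>K1 \<ge> 0\<close> b in auto)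
    show "\<bar>bdiff (scaled_diff a f0 r n) k\<bar> \<le> ?K * ?\<tau> ^ n" for n k
      by (rule order.trans[OF K1(1) mult_right_mono]) (use pos b in auto)
    show "\<bar>F x\<bar> \<le> ?K" for x
      using F[of x 0] b(2)[of "\<lfloor>x\<rfloor>"] \<open>K1 \<ge> 0\<close> by (simp add: scaled_diff_def subdivision_data_def)
  qed
qed

lemma polygon_tendsto:
  assumes "\<And>n x. \<bar>F x - scaled_diff a f0 0 n \<lfloor>2 ^ n * x\<rfloor>\<bar> \<le> K * (2 powr - \<alpha> 0) ^ n"
    "\<And>n k. \<bar>bdiff (scaled_diff a f0 0 n) k\<bar> \<le> K * (2 powr - \<alpha> 0) ^ n"
  shows "(\<lambda>n. subdivision_polygon a f0 n x) \<longlonglongrightarrow> F x"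
proof (rule dyadic_limit_unique)
  show "\<bar>F x - subdivision_polygon a f0 n x\<bar> \<le> 2 * K * (2 powr - \<alpha> 0) ^ n" for n
  proof -
    have "scaled_diff a f0 0 n = subdivision_data a f0 n" by (simp add: scaled_diff_def fun_eq_iff)
    with assms(1)[of x n] linear_interpolant_near_floor[OF assms(2), of n "2 ^ n * x"]
    show ?thesis by (simp add: subdivision_polygon_def)
  qed
  show "0 \<le> 2 powr - \<alpha> 0" "2 powr - \<alpha> 0 < 1" using s by (auto simp: powr_less_one)
qed

text \<open>The functions of all orders are chosen simultaneously, because the derivative relation
  links \<open>F r\<close> with \<open>F (Suc r)\<close>.\<close>

lemma limit_derivatives:
  obtains F :: "nat \<Rightarrow> real \<Rightarrow> real" and K :: "nat \<Rightarrow> real"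
  where "\<And>r n x. real r < s \<Longrightarrow> \<bar>F r x - scaled_diff a f0 r n \<lfloor>2 ^ n * x\<rfloor>\<bar> \<le> K r * (2 powr - \<alpha> r) ^ n"
    "\<And>r n k. real r < s \<Longrightarrow> \<bar>bdiff (scaled_diff a f0 r n) k\<bar> \<le> K r * (2 powr - \<alpha> r) ^ n"
    "\<And>r x. real r < s \<Longrightarrow> \<bar>F r x\<bar> \<le> K r"
    "\<And>r x y. real r < s \<Longrightarrow> \<bar>x - y\<bar> \<le> 1 \<Longrightarrow> \<bar>F r x - F r y\<bar> \<le> 4 * K r * 2 powr \<alpha> r * \<bar>x - y\<bar> powr \<alpha> r"
    "\<And>r. real r < s \<Longrightarrow> continuous_on UNIV (F r)"
    "\<And>r x. real (Suc r) < s \<Longrightarrow> (F r has_real_derivative F (Suc r) x) (at x)"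
    "\<And>x. (\<lambda>n. subdivision_polygon a f0 n x) \<longlonglongrightarrow> F 0 x"
    "subdivision_limit a f0 = F 0"
proof -
  have "\<forall>r. \<exists>F K. real r < s \<longrightarrow>
    (\<forall>n x. \<bar>F x - scaled_diff a f0 r n \<lfloor>2 ^ n * x\<rfloor>\<bar> \<le> K * (2 powr - \<alpha> r) ^ n) \<and>
    (\<forall>n k. \<bar>bdiff (scaled_diff a f0 r n) k\<bar> \<le> K * (2 powr - \<alpha> r) ^ n) \<and>
    (\<forall>x :: real. \<bar>F x\<bar> \<le> K)"
    using limit_derivative_exists by metis
  then obtain F K where FK: "\<And>r. real r < s \<Longrightarrow>
    (\<forall>n x. \<bar>F r x - scaled_diff a f0 r n \<lfloor>2 ^ n * x\<rfloor>\<bar> \<le> K r * (2 powr - \<alpha> r) ^ n) \<and>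
    (\<forall>n k. \<bar>bdiff (scaled_diff a f0 r n) k\<bar> \<le> K r * (2 powr - \<alpha> r) ^ n) \<and>
    (\<forall>x :: real. \<bar>F r x\<bar> \<le> K r)"
    by metis
  have hoelder: "\<bar>F r x - F r y\<bar> \<le> 4 * K r * 2 powr \<alpha> r * \<bar>x - y\<bar> powr \<alpha> r"
    if "real r < s" "\<bar>x - y\<bar> \<le> 1" for r x y
    by (rule dyadic_limit_hoelder[of _ "scaled_diff a f0 r"]) (use FK[OF that(1)] that in auto)
  have cont: "isCont (F r) x" if r: "real r < s" for r x
  proof -
    have "((\<lambda>y. F r y - F r x) \<longlongrightarrow> 0) (at x)"
    proof (rule Lim_null_comparison)
      have "\<forall>\<^sub>F y in at x. \<bar>y - x\<bar> \<le> 1"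
        unfolding eventually_at by (rule exI[of _ 1]) (auto simp: dist_real_def)
      then show "\<forall>\<^sub>F y in at x. norm (F r y - F r x) \<le> 4 * K r * 2 powr \<alpha> r * \<bar>y - x\<bar> powr \<alpha> r"
        by eventually_elim (use hoelder[OF r] in auto)
      have "((\<lambda>y. \<bar>y - x\<bar>) \<longlongrightarrow> \<bar>x - x\<bar>) (at x)" by (intro tendsto_intros)
      then have "((\<lambda>y. \<bar>y - x\<bar> powr \<alpha> r) \<longlongrightarrow> 0) (at x)"
        using tendsto_zero_powrI[of "\<lambda>y. \<bar>y - x\<bar>" "at x" "\<lambda>_. \<alpha> r" "\<alpha> r"] r by simp
      then show "((\<lambda>y. 4 * K r * 2 powr \<alpha> r * \<bar>y - x\<bar> powr \<alpha> r) \<longlongrightarrow> 0) (at x)"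
        by (rule tendsto_mult_right_zero)
    qed
    then show ?thesis by (simp add: isCont_def LIM_zero_iff)
  qed
  have \<tau>: "0 \<le> 2 powr - \<alpha> r" "2 powr - \<alpha> r < 1" if "real r < s" for r
    using that by (auto simp: powr_less_one)
  have der: "(F r has_real_derivative F (Suc r) x) (at x)" if r: "real (Suc r) < s" for r x
  proof -
    have r': "real r < s" using r by simp
    show ?thesis
      by (rule dyadic_limit_has_derivative[OF FK[OF r', THEN conjunct1, rule_format]
            FK[OF r, THEN conjunct1, rule_format] \<tau>[OF r'] \<tau>[OF r] bdiff_scaled_diff(2) cont[OF r]])
  qed
  have s0: "real 0 < s" using s by simp
  have poly: "(\<lambda>n. subdivision_polygon a f0 n x) \<longlonglongrightarrow> F 0 x" for x
    by (rule polygon_tendsto[OF FK[OF s0, THEN conjunct1, rule_format]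
          FK[OF s0, THEN conjunct2, THEN conjunct1, rule_format]])
  have lim: "subdivision_limit a f0 = F 0"
    unfolding subdivision_limit_def using poly by (intro ext limI)
  show thesis
    by (rule that[of F K]) (use FK in blast, use FK in blast, use FK in blast, rule hoelder, assumption, assumption,
        simp add: continuous_at_imp_continuous_on cont, rule der, assumption, rule poly, rule lim)
qed

lemma polygon_convergent: "convergent (\<lambda>n. subdivision_polygon a f0 n x)"
proof (rule limit_derivatives)
  fix F :: "nat \<Rightarrow> real \<Rightarrow> real" and K :: "nat \<Rightarrow> real"
  assume "\<And>x. (\<lambda>n. subdivision_polygon a f0 n x) \<longlonglongrightarrow> F 0 x"
  then show ?thesis by (rule convergentI)
qed

text \<open>Equal floors make \<open>q\<close> both the last order of differentiation below
  \<open>s\<close> and the one that the class of order \<open>\<beta>\<close> asks for; its exponent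
  \<open>s - q\<close> then exceeds \<open>frac \<beta>\<close>.\<close>

lemma hoelder_class_limit:
  assumes \<beta>: "0 \<le> \<beta>" "\<beta> < s" "\<lfloor>s\<rfloor> = \<lfloor>\<beta>\<rfloor>"
  shows "hoelder_class \<beta> (subdivision_limit a f0)"
proof -
  obtain F :: "nat \<Rightarrow> real \<Rightarrow> real" and K :: "nat \<Rightarrow> real"
  where "\<And>r n x. real r < s \<Longrightarrow> \<bar>F r x - scaled_diff a f0 r n \<lfloor>2 ^ n * x\<rfloor>\<bar> \<le> K r * (2 powr - \<alpha> r) ^ n"
    and "\<And>r n k. real r < s \<Longrightarrow> \<bar>bdiff (scaled_diff a f0 r n) k\<bar> \<le> K r * (2 powr - \<alpha> r) ^ n"
    and bd: "\<And>r x. real r < s \<Longrightarrow> \<bar>F r x\<bar> \<le> K r"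
    and hd: "\<And>r x y. real r < s \<Longrightarrow> \<bar>x - y\<bar> \<le> 1 \<Longrightarrow> \<bar>F r x - F r y\<bar> \<le> 4 * K r * 2 powr \<alpha> r * \<bar>x - y\<bar> powr \<alpha> r"
    and cont: "\<And>r. real r < s \<Longrightarrow> continuous_on UNIV (F r)"
    and der: "\<And>r x. real (Suc r) < s \<Longrightarrow> (F r has_real_derivative F (Suc r) x) (at x)"
    and "\<And>x. (\<lambda>n. subdivision_polygon a f0 n x) \<longlonglongrightarrow> F 0 x"
    and lim: "subdivision_limit a f0 = F 0"
    by (rule limit_derivatives) (rule that)
  define q where "q = nat \<lfloor>\<beta>\<rfloor>"
  have q: "real q \<le> \<beta>" "real q < s" "s < real q + 1" "frac \<beta> = \<beta> - real q"
    using \<beta> unfolding q_def frac_def by linarith+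
  have iter: "(deriv ^^ i) (F 0) = F i" if "i \<le> q" for i
    by (rule funpow_deriv_eq[of q F, OF der that]) (use q in linarith)
  have "F i differentiable_on UNIV" if "i < q" for i
  proof -
    have "real (Suc i) < s" using that q by linarith
    from der[OF this] show ?thesis
      by (auto simp: differentiable_on_def real_differentiable_def intro: DERIV_subset)
  qed
  then have C: "C_class q (F 0)"
    unfolding C_class_def using iter cont[OF q(2)] by simp
  have "hoelder_continuous (frac \<beta>) (F q)"
    unfolding hoelder_continuous_def
  proof (intro exI allI)
    fix x y :: real
    have \<alpha>: "\<alpha> q = s - q" using q by simp
    have K: "K q \<ge> 0" using bd[OF q(2), of 0] by linarith
    \<comment> \<open>\<open>?C\<close> serves pairs at distance at most 1, where the exponent
      \<open>s - q\<close> may be lowered to \<open>frac \<beta>\<close>; \<open>2 * K q\<close>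
      serves all other pairs by boundedness.\<close>
    let ?C = "4 * K q * 2 powr \<alpha> q"
    have "?C + 2 * K q \<ge> ?C" "?C + 2 * K q \<ge> 2 * K q" using K by simp_all
    show "\<bar>F q x - F q y\<bar> \<le> (?C + 2 * K q) * \<bar>x - y\<bar> powr frac \<beta>"
    proof (cases "\<bar>x - y\<bar> \<le> 1")
      case True
      have "\<bar>x - y\<bar> powr \<alpha> q \<le> \<bar>x - y\<bar> powr frac \<beta>"
        unfolding \<alpha> using \<beta> q True by (intro powr_mono') auto
      then have "?C * \<bar>x - y\<bar> powr \<alpha> q \<le> (?C + 2 * K q) * \<bar>x - y\<bar> powr frac \<beta>"
        using K by (intro mult_mono) auto
      with hd[OF q(2) True] show ?thesis by linarith
    next
      case False
      have "1 \<le> \<bar>x - y\<bar> powr frac \<beta>"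
        using False by (intro ge_one_powr_ge_zero) auto
      have "\<bar>F q x - F q y\<bar> \<le> 2 * K q"
        using bd[OF q(2), of x] bd[OF q(2), of y] by linarith
      also have "\<dots> \<le> (?C + 2 * K q) * 1" using K by simp
      also have "\<dots> \<le> (?C + 2 * K q) * \<bar>x - y\<bar> powr frac \<beta>"
        using K \<open>1 \<le> \<bar>x - y\<bar> powr frac \<beta>\<close> by (intro mult_left_mono) auto
      finally show ?thesis .
    qed
  qed
  with C show ?thesis
    unfolding hoelder_class_def lim q_def[symmetric] using iter[of q] by simp
qed

end

section \<open>Growth of dyadic products on the circle\<close>

definition dyadic_product :: "(real \<Rightarrow> real) \<Rightarrow> nat \<Rightarrow> real \<Rightarrow> real" where
  "dyadic_product b n t = (\<Prod>j<n. b (2 ^ j * t))"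

text \<open>For the weights below this is the limsup of the n-th roots of the means. As an infimum
  of admissible rates it turns any bound \<open>C * r ^ n\<close> into a bound by \<open>r\<close>,
  and multiplicative constants disappear.\<close>

definition growth_rate :: "(real \<Rightarrow> real) \<Rightarrow> real" where
  "growth_rate b = Inf {r. 0 < r \<and> (\<exists>C. \<forall>n. circle_mean (dyadic_product b n) \<le> C * r ^ n)}"

section \<open>Means over the circle under comparison, translation and dilation\<close>

lemma circle_mean_mono:
  assumes "continuous_on UNIV f" "continuous_on UNIV g" "\<And>t. f t \<le> g t"
  shows "circle_mean f \<le> circle_mean g"
  unfolding circle_mean_def
  by (intro divide_right_mono integral_le integrable_continuous_real)
     (use assms in \<open>auto intro: continuous_on_subset\<close>)

lemma circle_mean_mult: "circle_mean (\<lambda>t. c * f t) = c * circle_mean f"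
  by (simp add: circle_mean_def)

lemma circle_mean_add:
  assumes "continuous_on UNIV f" "continuous_on UNIV g"
  shows "circle_mean (\<lambda>t. f t + g t) = circle_mean f + circle_mean g"
  unfolding circle_mean_def add_divide_distrib[symmetric]
  by (subst integral_add) (use assms in \<open>auto intro!: integrable_continuous_real intro: continuous_on_subset\<close>)

lemma circle_mean_const: "circle_mean (\<lambda>t. c) = c"
  by (simp add: circle_mean_def)

lemma continuous_compose_real:
  "continuous_on UNIV f \<Longrightarrow> continuous_on UNIV g \<Longrightarrow> continuous_on UNIV (\<lambda>t. f (g t :: real) :: real)"
  by (rule continuous_on_compose2[of UNIV f]) auto

lemma circle_mean_shift:
  assumes cont: "continuous_on UNIV W" and per: "\<And>t. W (t + 2 * pi) = W t" and c: "0 \<le> c" "c \<le> 2 * pi"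
  shows "circle_mean (\<lambda>t. W (t + c)) = circle_mean W"
proof -
  have int: "W integrable_on {u..v}" for u v
    using cont by (intro integrable_continuous_real) (auto intro: continuous_on_subset)
  have "integral {-pi..pi} (\<lambda>t. W (t + c)) = integral {-pi+c..pi+c} W"
    using integral_shift_real_ivl[of "-pi+c" c "pi+c" W] by simp
  also have "\<dots> = integral {-pi+c..pi} W + integral {pi..pi+c} W"
    using c by (intro Henstock_Kurzweil_Integration.integral_combine[symmetric] int) auto
  also have "integral {pi..pi+c} W = integral {-pi..-pi+c} (\<lambda>t. W (t + 2 * pi))"
    using integral_shift_real_ivl[of pi "2 * pi" "pi+c" W] by (simp add: algebra_simps)
  also have "\<dots> = integral {-pi..-pi+c} W" by (simp add: per)
  also have "integral {-pi+c..pi} W + integral {-pi..-pi+c} W = integral {-pi..pi} W"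
    using c Henstock_Kurzweil_Integration.integral_combine[of "-pi" "-pi+c" pi W] int by simp
  finally show ?thesis by (simp add: circle_mean_def)
qed

text \<open>The substitution of \<open>2 ^ k * t\<close> stretches the short interval around 0 to
  the whole of \<open>{-pi..pi}\<close>, and the factor \<open>2 ^ k\<close> makes up for the change
  of length. The rest of the circle contributes a nonnegative amount.\<close>

lemma circle_mean_concentrate:
  assumes W: "continuous_on UNIV W" "\<And>t. W t \<ge> 0" and s: "continuous_on UNIV s" "\<And>t. s t \<ge> 0"
    and \<epsilon>: "\<And>t. \<bar>t\<bar> \<le> pi / 2 ^ k \<Longrightarrow> s t \<ge> \<epsilon>"
  shows "circle_mean (\<lambda>t. 2 ^ k * s t * W (2 ^ k * t)) \<ge> \<epsilon> * circle_mean W"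
proof -
  let ?I = "{-pi / 2 ^ k..pi / 2 ^ k}"
  have "(W has_integral integral {-pi..pi} W) (cbox (-pi) pi)"
    unfolding interval_cbox[symmetric]
    by (intro integrable_integral integrable_continuous_real continuous_on_subset[OF W(1)]) auto
  from has_integral_affinity'[OF this, of "2 ^ k" 0]
  have "((\<lambda>t. W (2 ^ k * t)) has_integral (integral {-pi..pi} W / 2 ^ k)) ?I"
    by (simp add: divide_inverse mult.commute)
  from has_integral_mult_right[OF this, of "2 ^ k * \<epsilon>"]
  have hi: "((\<lambda>t. 2 ^ k * \<epsilon> * W (2 ^ k * t)) has_integral (\<epsilon> * integral {-pi..pi} W)) ?I"
    by (simp add: mult_ac)
  have cont: "continuous_on UNIV (\<lambda>t. 2 ^ k * s t * W (2 ^ k * t))"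
    by (intro continuous_intros s continuous_compose_real[OF W(1)])
  have int: "(\<lambda>t. 2 ^ k * s t * W (2 ^ k * t)) integrable_on {u..v}" for u v
    by (intro integrable_continuous_real continuous_on_subset[OF cont]) auto
  have "\<epsilon> * integral {-pi..pi} W \<le> integral ?I (\<lambda>t. 2 ^ k * s t * W (2 ^ k * t))"
  proof (rule has_integral_le[OF hi integrable_integral[OF int]])
    fix t assume "t \<in> ?I"
    then have "\<bar>t\<bar> \<le> pi / 2 ^ k" by auto
    from \<epsilon>[OF this] show "2 ^ k * \<epsilon> * W (2 ^ k * t) \<le> 2 ^ k * s t * W (2 ^ k * t)"
      using W(2) by (intro mult_right_mono mult_left_mono) auto
  qed
  also have "\<dots> \<le> integral {-pi..pi} (\<lambda>t. 2 ^ k * s t * W (2 ^ k * t))"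
  proof (rule integral_subset_le[OF _ int int])
    have "pi / 2 ^ k \<le> pi" by (simp add: divide_le_eq)
    then show "?I \<subseteq> {-pi..pi}" by auto
  qed (use W(2) s(2) in auto)
  finally show ?thesis
    by (simp add: circle_mean_def divide_right_mono)
qed

text \<open>The lower bound 1 converts the Lipschitz estimate into an estimate for quotients of
  values, and it keeps all means and growth rates at least 1.\<close>

locale symbol_weight =
  fixes b :: "real \<Rightarrow> real" and L D :: real
  assumes ge_1: "1 \<le> b t" and le_D: "b t \<le> D"
    and periodic: "b (t + 2 * pi) = b t"
    and lipschitz: "\<bar>b x - b y\<bar> \<le> L * \<bar>x - y\<bar>"
begin

lemma L_nonneg: "0 \<le> L"
  using lipschitz[of 1 0] by simp

lemma continuous: "continuous_on UNIV b"
  by (rule lipschitz_on_continuous_on[of L])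
     (auto intro!: lipschitz_onI lipschitz L_nonneg simp: dist_real_def)

lemma continuous_product: "continuous_on UNIV (dyadic_product b n)"
  unfolding dyadic_product_def[abs_def]
  by (intro continuous_intros continuous_compose_real[OF continuous])

lemma product_ge_1: "1 \<le> dyadic_product b n t"
  unfolding dyadic_product_def by (rule prod_ge_1) (rule ge_1)

lemma product_le: "dyadic_product b n t \<le> D ^ n"
  unfolding dyadic_product_def
  using prod_mono[of "{..<n}" "\<lambda>j. b (2 ^ j * t)" "\<lambda>_. D"] le_D order.trans[OF zero_le_one ge_1] by simp

lemma periodic_nat: "b (t + 2 * pi * real k) = b t"
proof (induction k)
  case (Suc k)
  then show ?case using periodic[of "t + 2 * pi * real k"] by (simp add: algebra_simps)
qed simp

lemma product_periodic: "dyadic_product b n (t + 2 * pi) = dyadic_product b n t"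
  unfolding dyadic_product_def
proof (rule prod.cong)
  show "b (2 ^ j * (t + 2 * pi)) = b (2 ^ j * t)" for j
    using periodic_nat[of "2 ^ j * t" "2 ^ j"] by (simp add: algebra_simps)
qed simp

lemma mean_ge_1: "1 \<le> circle_mean (dyadic_product b n)"
  using circle_mean_mono[of "\<lambda>_. 1" "dyadic_product b n"] continuous_product product_ge_1
  by (simp add: circle_mean_const)

lemma growth_bound_ge_1:
  assumes "0 < r" "\<And>n. circle_mean (dyadic_product b n) \<le> C * r ^ n"
  shows "1 \<le> r"
proof (rule ccontr)
  assume "\<not> 1 \<le> r"
  then have "(\<lambda>n. C * r ^ n) \<longlonglongrightarrow> C * 0"
    using assms by (intro tendsto_intros LIMSEQ_power_zero) auto
  moreover have "\<forall>n. 1 \<le> C * r ^ n" using assms mean_ge_1 order.trans by blast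
  ultimately have "(1 :: real) \<le> C * 0" by (intro LIMSEQ_le_const) auto
  then show False by simp
qed

lemma growth_set: "D \<in> {r. 0 < r \<and> (\<exists>C. \<forall>n. circle_mean (dyadic_product b n) \<le> C * r ^ n)}"
proof -
  have "circle_mean (dyadic_product b n) \<le> 1 * D ^ n" for n
    using circle_mean_mono[of "dyadic_product b n" "\<lambda>_. D ^ n"] continuous_product product_le
    by (simp add: circle_mean_const)
  moreover have "0 < D" using ge_1[of 0] le_D[of 0] by linarith
  ultimately show ?thesis by blast
qed

lemma growth_rate_ge_1: "1 \<le> growth_rate b"
  unfolding growth_rate_def using growth_set growth_bound_ge_1 by (intro cInf_greatest) auto

lemma growth_rate_le:
  assumes "0 < r" "\<And>n. circle_mean (dyadic_product b n) \<le> C * r ^ n"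
  shows "growth_rate b \<le> r"
  unfolding growth_rate_def
  by (rule cInf_lower) (use assms growth_bound_ge_1 in \<open>auto intro!: bdd_belowI[of _ 1]\<close>)

lemma growth_rate_le_D: "growth_rate b \<le> D"
  using growth_set growth_rate_le by blast

lemma growth_rate_less:
  assumes "growth_rate b < r"
  obtains C where "C \<ge> 0" "\<And>n. circle_mean (dyadic_product b n) \<le> C * r ^ n"
proof -
  obtain r' C where r': "r' < r" "0 < r'" "\<And>n. circle_mean (dyadic_product b n) \<le> C * r' ^ n"
    using cInf_lessD[OF _ assms[unfolded growth_rate_def]] growth_set by blast
  have C: "C \<ge> 0" using r'(3)[of 0] mean_ge_1[of 0] by simp
  show thesis
  proof (rule that[OF C])
    fix n
    have "C * r' ^ n \<le> C * r ^ n" using r' C by (intro mult_left_mono power_mono) auto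
    then show "circle_mean (dyadic_product b n) \<le> C * r ^ n" using r'(3)[of n] by linarith
  qed
qed

text \<open>A translation by \<open>pi / 2 ^ n\<close> moves the arguments of the factors by \<open>2 ^ j * pi / 2 ^ n\<close>,
  and these add up to less than \<open>pi\<close>.\<close>

lemma bounded_distortion:
  "dyadic_product b n t \<le> exp (L * pi) * dyadic_product b n (t + pi / 2 ^ n)"
proof -
  have step: "b x \<le> exp (L * \<bar>x - y\<bar>) * b y" for x y
  proof -
    have "b x \<le> b y + L * \<bar>x - y\<bar> * 1" using lipschitz[of x y] by simp
    also have "\<dots> \<le> b y + L * \<bar>x - y\<bar> * b y"
      using ge_1 L_nonneg by (intro add_left_mono mult_left_mono) auto
    also have "\<dots> = (1 + L * \<bar>x - y\<bar>) * b y" by (simp add: algebra_simps)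
    also have "\<dots> \<le> exp (L * \<bar>x - y\<bar>) * b y"
      using ge_1[of y] by (intro mult_right_mono exp_ge_add_one_self) auto
    finally show ?thesis .
  qed
  have "dyadic_product b n t
      \<le> (\<Prod>j<n. exp (L * (2 ^ j * (pi / 2 ^ n))) * b (2 ^ j * (t + pi / 2 ^ n)))"
    unfolding dyadic_product_def
  proof (rule prod_mono, rule conjI)
    fix j
    have "\<bar>2 ^ j * t - 2 ^ j * (t + pi / 2 ^ n)\<bar> = 2 ^ j * (pi / 2 ^ n)"
      by (simp add: distrib_left)
    then show "b (2 ^ j * t) \<le> exp (L * (2 ^ j * (pi / 2 ^ n))) * b (2 ^ j * (t + pi / 2 ^ n))"
      using step[of "2 ^ j * t" "2 ^ j * (t + pi / 2 ^ n)"] by simp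
    show "0 \<le> b (2 ^ j * t)" using ge_1 order.trans zero_le_one by blast
  qed
  also have "\<dots> = exp (L * (pi / 2 ^ n) * (\<Sum>j<n. 2 ^ j)) * dyadic_product b n (t + pi / 2 ^ n)"
    unfolding dyadic_product_def prod.distrib by (simp add: exp_sum[symmetric] sum_distrib_left sum_divide_distrib mult_ac)
  also have "\<dots> \<le> exp (L * pi) * dyadic_product b n (t + pi / 2 ^ n)"
  proof (rule mult_right_mono)
    have "(\<Sum>j<n. 2 ^ j) \<le> (2 ^ n :: real)" by (induction n) auto
    then have "L * (pi / 2 ^ n) * (\<Sum>j<n. 2 ^ j) \<le> L * (pi / 2 ^ n) * 2 ^ n"
      using L_nonneg by (intro mult_left_mono) auto
    then show "exp (L * (pi / 2 ^ n) * (\<Sum>j<n. 2 ^ j)) \<le> exp (L * pi)" by simp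
    show "0 \<le> dyadic_product b n (t + pi / 2 ^ n)" using product_ge_1 order.trans zero_le_one by blast
  qed
  finally show ?thesis .
qed

text \<open>The weight can be small at \<open>t\<close>, but the translation by
  \<open>pi / 2 ^ n\<close> turns its sine into a cosine. One of the two squares is at least 1/4, so
  the weight is at least 1 at \<open>t\<close> or at the translate; bounded distortion compares the
  products there, and translations preserve the mean.\<close>

lemma mean_weighted_ge:
  "circle_mean (dyadic_product b n)
    \<le> (1 + exp (L * pi)) * circle_mean (\<lambda>t. (4 * (sin (2 ^ n * t / 2))\<^sup>2) ^ p * dyadic_product b n t)"
proof -
  define W where "W t = (4 * (sin (2 ^ n * t / 2))\<^sup>2) ^ p * dyadic_product b n t" for t
  have contW: "continuous_on UNIV W"
    unfolding W_def[abs_def] by (intro continuous_intros continuous_product) auto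
  have perW: "W (t + 2 * pi) = W t" for t
  proof -
    have "2 ^ n * (t + 2 * pi) / 2 = 2 ^ n * t / 2 + pi * real (2 ^ n)" by (simp add: algebra_simps)
    then have "(sin (2 ^ n * (t + 2 * pi) / 2))\<^sup>2 = (sin (2 ^ n * t / 2))\<^sup>2"
      using sin_npi[of "2 ^ n"] cos_npi[of "2 ^ n"]
      by (simp only: sin_add) (simp add: power_mult_distrib mult.commute power_mult[symmetric])
    then show ?thesis by (simp add: W_def product_periodic)
  qed
  let ?E = "exp (L * pi)"
  have E: "?E \<ge> 1" using L_nonneg by simp
  have pt: "dyadic_product b n t \<le> W t + ?E * W (t + pi / 2 ^ n)" for t
  proof -
    let ?x = "2 ^ n * t / 2"
    have b0: "dyadic_product b n t \<ge> 0" using product_ge_1[of n t] by linarith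
    have W0: "W u \<ge> 0" for u
      using product_ge_1[of n u] by (auto simp: W_def)
    have arg: "2 ^ n * (t + pi / 2 ^ n) / 2 = ?x + pi / 2" by (simp add: field_simps)
    have W2: "?E * W (t + pi / 2 ^ n) = (4 * (cos ?x)\<^sup>2) ^ p * (?E * dyadic_product b n (t + pi / 2 ^ n))"
      unfolding W_def arg by (simp add: sin_add)
    have "dyadic_product b n t * 1 \<le> W t + ?E * W (t + pi / 2 ^ n)"
    proof (cases "(sin ?x)\<^sup>2 \<ge> 1 / 4")
      case True
      then have "(4 * (sin ?x)\<^sup>2) ^ p \<ge> 1" by (intro one_le_power) auto
      then have "1 * dyadic_product b n t \<le> W t" unfolding W_def using b0 by (intro mult_right_mono)
      then show ?thesis using W0[of "t + pi / 2 ^ n"] E by (simp add: add_increasing2)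
    next
      case False
      then have "(cos ?x)\<^sup>2 \<ge> 1 / 4" using sin_cos_squared_add[of ?x] by linarith
      then have "(4 * (cos ?x)\<^sup>2) ^ p \<ge> 1" by (intro one_le_power) auto
      then have "1 * dyadic_product b n t \<le> ?E * W (t + pi / 2 ^ n)"
        unfolding W2 using b0 by (intro mult_mono bounded_distortion) auto
      then show ?thesis using W0[of t] by simp
    qed
    then show ?thesis by simp
  qed
  have shift: "circle_mean (\<lambda>t. W (t + pi / 2 ^ n)) = circle_mean W"
  proof (rule circle_mean_shift[OF contW perW])
    have "pi / 2 ^ n \<le> pi" by (simp add: divide_le_eq)
    then show "pi / 2 ^ n \<le> 2 * pi" using pi_gt_zero by linarith
  qed simp
  have contW': "continuous_on UNIV (\<lambda>t. W (t + pi / 2 ^ n))"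
    by (intro continuous_compose_real[OF contW] continuous_intros)
  have "circle_mean (dyadic_product b n) \<le> circle_mean (\<lambda>t. W t + ?E * W (t + pi / 2 ^ n))"
    by (intro circle_mean_mono continuous_product continuous_intros contW contW' pt)
  also have "\<dots> = (1 + ?E) * circle_mean W"
    by (subst circle_mean_add) (auto intro!: continuous_intros contW contW' simp: circle_mean_mult shift algebra_simps)
  finally show ?thesis unfolding W_def .
qed

end

text \<open>Each of the \<open>n\<close> factors of the product contributes one \<open>K\<close>.
  The detour through rates \<open>r\<close> above \<open>growth_rate b'\<close> is taken because the
  infimum may fail to be attained.\<close>

lemma growth_rate_mono:
  assumes "symbol_weight b L D" "symbol_weight b' L' D'" "\<And>t. b t \<le> K * b' t" "K > 0"
  shows "growth_rate b \<le> K * growth_rate b'"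
proof -
  interpret b: symbol_weight b L D by fact
  interpret b': symbol_weight b' L' D' by fact
  have "growth_rate b \<le> K * r" if r: "growth_rate b' < r" for r
  proof -
    obtain C where C: "C \<ge> 0" "\<And>n. circle_mean (dyadic_product b' n) \<le> C * r ^ n"
      using b'.growth_rate_less[OF r] by blast
    have "circle_mean (dyadic_product b n) \<le> C * (K * r) ^ n" for n
    proof -
      have "dyadic_product b n t \<le> K ^ n * dyadic_product b' n t" for t
      proof -
        have "dyadic_product b n t \<le> (\<Prod>j<n. K * b' (2 ^ j * t))"
          unfolding dyadic_product_def using assms(3) b.ge_1 order.trans[OF zero_le_one]
          by (intro prod_mono) blast
        then show ?thesis by (simp add: dyadic_product_def prod.distrib)
      qed
      then have "circle_mean (dyadic_product b n) \<le> K ^ n * circle_mean (dyadic_product b' n)"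
        unfolding circle_mean_mult[symmetric]
        by (intro circle_mean_mono b.continuous_product continuous_intros b'.continuous_product)
      also have "\<dots> \<le> K ^ n * (C * r ^ n)" using C \<open>K > 0\<close> by (intro mult_left_mono) auto
      finally show ?thesis by (simp add: power_mult_distrib mult_ac)
    qed
    moreover have "0 < K * r" using r b'.growth_rate_ge_1 \<open>K > 0\<close> by simp
    ultimately show ?thesis by (intro b.growth_rate_le)
  qed
  then have "growth_rate b / K \<le> r" if r: "growth_rate b' < r" for r
    using \<open>K > 0\<close> r by (metis divide_le_eq mult.commute)
  then have "growth_rate b / K \<le> growth_rate b'" by (rule dense_ge)
  then show ?thesis using \<open>K > 0\<close> by (simp add: field_simps)
qed

section \<open>Products of cosines\<close>

lemma prod_cos_le_1: "(\<Prod>j<k. (cos (2 ^ j * t / 2))\<^sup>2) \<le> (1 :: real)"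
  by (rule prod_le_1) (auto simp: abs_square_le_1)

text \<open>Replacing the factor with index \<open>j\<close> by 1 loses at most the square of the
  sine, hence at most \<open>4 ^ j * t\<^sup>2 / 4\<close>; these losses add up to
  \<open>(4 ^ k - 1) * t\<^sup>2 / 12\<close>.\<close>

lemma prod_cos_ge: "(\<Prod>j<k. (cos (2 ^ j * t / 2))\<^sup>2) \<ge> 1 - (4 ^ k - 1) * t\<^sup>2 / (12 :: real)"
proof (induction k)
  case (Suc k)
  let ?P = "\<Prod>j<k. (cos (2 ^ j * t / 2))\<^sup>2"
  have "(sin (2 ^ k * t / 2))\<^sup>2 \<le> (2 ^ k * t / 2)\<^sup>2"
    using abs_sin_x_le_abs_x[of "2 ^ k * t / 2"] by (rule abs_le_square_iff[THEN iffD1])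
  also have "\<dots> = 4 ^ k * t\<^sup>2 / 4"
    by (simp add: power_mult_distrib power_divide power_mult[symmetric] mult.commute[of k])
       (simp add: power_mult)
  finally have y: "(sin (2 ^ k * t / 2))\<^sup>2 \<le> 4 ^ k * t\<^sup>2 / 4" .
  have "?P * (sin (2 ^ k * t / 2))\<^sup>2 \<le> 1 * (sin (2 ^ k * t / 2))\<^sup>2"
    by (intro mult_right_mono prod_cos_le_1) auto
  then have "?P - (sin (2 ^ k * t / 2))\<^sup>2 \<le> ?P * (cos (2 ^ k * t / 2))\<^sup>2"
    unfolding cos_squared_eq by (simp add: right_diff_distrib)
  moreover have "(4 ^ Suc k - 1) * t\<^sup>2 / 12 = (4 ^ k - 1) * t\<^sup>2 / 12 + 4 ^ k * t\<^sup>2 / 4"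
    by (simp add: field_simps)
  moreover have "(\<Prod>j<Suc k. (cos (2 ^ j * t / 2))\<^sup>2) = ?P * (cos (2 ^ k * t / 2))\<^sup>2" by simp
  ultimately show ?case using y Suc by linarith
qed simp

text \<open>On this interval the loss in \<open>prod_cos_ge\<close> is at most
  \<open>pi\<^sup>2 / 12\<close>, which is below 5/6 since \<open>22 / 7\<close> bounds
  \<open>pi\<close> and its square is below 10.\<close>

lemma prod_cos_lower:
  assumes "\<bar>t\<bar> \<le> pi / 2 ^ k"
  shows "(\<Prod>j<k. (cos (2 ^ j * t / 2))\<^sup>2) \<ge> 1 / 6"
proof -
  have "t\<^sup>2 \<le> (pi / 2 ^ k)\<^sup>2"
    using assms by (intro abs_le_square_iff[THEN iffD1]) simp
  also have "\<dots> = pi\<^sup>2 / 4 ^ k"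
    by (simp add: power_divide power_mult[symmetric] mult.commute[of k]) (simp add: power_mult)
  finally have "4 ^ k * t\<^sup>2 \<le> pi\<^sup>2" by (simp add: field_simps)
  moreover have "pi\<^sup>2 \<le> (22 / 7)\<^sup>2" using pi_approx by (intro power_mono) auto
  moreover have "(4 ^ k - 1) * t\<^sup>2 \<le> 4 ^ k * t\<^sup>2" by (intro mult_right_mono) auto
  ultimately show ?thesis using prod_cos_ge[of k t] by (simp add: power2_eq_square)
qed

text \<open>Viete's product, squared: the double-angle formula iterated \<open>n\<close> times. It
  will merge the cosines of the symbol with the sines of a difference into one sine at frequency
  \<open>2 ^ n\<close>.\<close>

lemma sin_prod_cos: "4 ^ n * (sin (t / 2))\<^sup>2 * (\<Prod>j<n. (cos (2 ^ j * t / 2))\<^sup>2) = (sin (2 ^ n * t / 2 :: real))\<^sup>2"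
proof (induction n)
  case (Suc n)
  have "4 ^ Suc n * (sin (t / 2))\<^sup>2 * (\<Prod>j<Suc n. (cos (2 ^ j * t / 2))\<^sup>2)
      = 4 * (sin (2 ^ n * t / 2))\<^sup>2 * (cos (2 ^ n * t / 2))\<^sup>2"
    unfolding Suc[symmetric] by simp
  also have "\<dots> = (sin (2 * (2 ^ n * t / 2)))\<^sup>2"
    unfolding sin_double by (simp only: power_mult_distrib) simp
  finally show ?case by simp
qed simp

section \<open>Iterated forward differences\<close>

text \<open>The argument type is left open so that sequences with step \<open>2 ^ k\<close> and real
  functions with step \<open>2 ^ - n\<close> share one notion and can be related in the
  limit.\<close>

definition fdiff :: "'a :: ab_group_add \<Rightarrow> ('a \<Rightarrow> real) \<Rightarrow> 'a \<Rightarrow> real" where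
  "fdiff h f x = f (x + h) - f x"

lemma fdiff_Suc: "(fdiff h ^^ Suc r) f x = (fdiff h ^^ r) f (x + h) - (fdiff h ^^ r) f x"
  by (simp add: fdiff_def)

lemma fdiff_bound:
  fixes f :: "real \<Rightarrow> real"
  assumes "\<And>y. x \<le> y \<Longrightarrow> y \<le> x + r * h \<Longrightarrow> \<bar>f y\<bar> \<le> M" "h \<ge> 0"
  shows "\<bar>(fdiff h ^^ r) f x\<bar> \<le> 2 ^ r * M"
  using assms(1)
proof (induction r arbitrary: x)
  case (Suc r)
  have "x \<le> x + real r * h" "x + h \<le> x + h + real r * h" using \<open>h \<ge> 0\<close> by simp_all
  have 1: "\<bar>(fdiff h ^^ r) f (x + h)\<bar> \<le> 2 ^ r * M"
  proof (rule Suc.IH)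
    show "\<bar>f y\<bar> \<le> M" if "x + h \<le> y" "y \<le> x + h + r * h" for y
      by (rule Suc.prems) (use that \<open>h \<ge> 0\<close> in \<open>auto simp: algebra_simps\<close>)
  qed
  have 2: "\<bar>(fdiff h ^^ r) f x\<bar> \<le> 2 ^ r * M"
  proof (rule Suc.IH)
    show "\<bar>f y\<bar> \<le> M" if "x \<le> y" "y \<le> x + r * h" for y
      by (rule Suc.prems) (use that \<open>h \<ge> 0\<close> in \<open>auto simp: algebra_simps\<close>)
  qed
  have "(fdiff h ^^ Suc r) f x = (fdiff h ^^ r) f (x + h) - (fdiff h ^^ r) f x"
    by (simp add: fdiff_def)
  with 1 2 show ?case by simp
qed simp

lemma fdiff_has_derivative:
  assumes "\<And>x. (f has_real_derivative f' x) (at x)"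
  shows "((fdiff h ^^ r) f has_real_derivative (fdiff h ^^ r) f' x) (at x)"
proof (induction r arbitrary: x)
  case (Suc r)
  have "((\<lambda>x. (fdiff h ^^ r) f (x + h)) has_real_derivative (fdiff h ^^ r) f' (x + h)) (at x)"
    using Suc[of "x + h"] by (simp add: DERIV_shift)
  from DERIV_diff[OF this Suc[of x]] show ?case by (simp add: fdiff_def[abs_def])
qed (simp add: assms)

text \<open>By the mean value theorem one difference is traded for one derivative and a factor
  \<open>h\<close>; the remaining \<open>r\<close> differences are carried along unchanged.\<close>

lemma fdiff_derivative_bound:
  fixes G :: "nat \<Rightarrow> real \<Rightarrow> real"
  assumes der: "\<And>i x. i < p \<Longrightarrow> (G i has_real_derivative G (Suc i) x) (at x)" and "h > 0"
    and bound: "\<And>y. x \<le> y \<Longrightarrow> y \<le> x + p * h \<Longrightarrow> \<bar>(fdiff h ^^ r) (G p) y\<bar> \<le> M"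
  shows "\<bar>(fdiff h ^^ (p + r)) (G 0) x\<bar> \<le> h ^ p * M"
  using der bound
proof (induction p arbitrary: G x)
  case (Suc p)
  let ?D = "\<lambda>i. (fdiff h ^^ (p + r)) (G i)"
  have "(G 0 has_real_derivative G 1 y) (at y)" for y using Suc.prems(1)[of 0] by simp
  from fdiff_has_derivative[OF this]
  have "(?D 0 has_real_derivative ?D 1 y) (at y)" for y .
  then obtain z where z: "z > x" "z < x + h" "?D 0 (x + h) - ?D 0 x = (x + h - x) * ?D 1 z"
    using MVT2[of x "x + h" "?D 0" "?D 1"] \<open>h > 0\<close> by auto
  have "\<bar>(fdiff h ^^ (p + r)) ((\<lambda>i. G (Suc i)) 0) z\<bar> \<le> h ^ p * M"
  proof (rule Suc.IH)
    show "(G (Suc i) has_real_derivative G (Suc (Suc i)) y) (at y)" if "i < p" for i y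
      using Suc.prems(1)[of "Suc i"] that by simp
    show "\<bar>(fdiff h ^^ r) (G (Suc p)) y\<bar> \<le> M" if "z \<le> y" "y \<le> z + p * h" for y
      by (rule Suc.prems(2)) (use that z in \<open>auto simp: algebra_simps\<close>)
  qed
  then have "h * \<bar>?D 1 z\<bar> \<le> h * (h ^ p * M)" using \<open>h > 0\<close> by simp
  moreover have "(fdiff h ^^ (Suc p + r)) (G 0) x = h * ?D 1 z"
    using z(3) by (simp add: fdiff_def)
  ultimately show ?case using \<open>h > 0\<close> by (simp add: abs_mult mult.assoc)
qed simp

lemma fdiff_shift_diff:
  "(fdiff h ^^ r) (\<lambda>x. f (x - c) - f x) x = (fdiff h ^^ r) f (x - c) - (fdiff h ^^ r) f x"
  for f :: "'a :: ab_group_add \<Rightarrow> real"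
proof (induction r arbitrary: x)
  case (Suc r)
  have "x + h - c = x - c + h" by simp
  then show ?case by (simp only: fdiff_Suc Suc)
qed simp

lemma fourier_fdiff:
  assumes "finitely_supported f"
  shows "finitely_supported ((fdiff c ^^ r) f)"
    "fourier ((fdiff c ^^ r) f) t = (cis (- of_int c * t) - 1) ^ r * fourier f t"
proof -
  have fs: "finitely_supported ((fdiff c ^^ r) f)" for r
  proof (induction r)
    case (Suc r)
    then show ?case
      using finitely_supported_diff[OF finitely_supported_shift[OF Suc, of c] Suc]
      by (simp add: fdiff_def[abs_def])
  qed (use assms in simp)
  then show "finitely_supported ((fdiff c ^^ r) f)" .
  show "fourier ((fdiff c ^^ r) f) t = (cis (- of_int c * t) - 1) ^ r * fourier f t"
  proof (induction r)
    case (Suc r)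
    let ?g = "(fdiff c ^^ r) f"
    have "fourier ((fdiff c ^^ Suc r) f) t = fourier (\<lambda>k. ?g (k + c)) t - fourier ?g t"
      using fourier_diff[OF finitely_supported_shift[OF fs[of r], of c] fs[of r], of t]
      by (simp add: fdiff_def[abs_def])
    also have "\<dots> = (cis (- of_int c * t) - 1) * fourier ?g t"
      by (simp add: fourier_shift fs algebra_simps)
    finally show ?case by (simp add: Suc mult_ac)
  qed simp
qed

text \<open>On level \<open>n + k\<close> the index step \<open>2 ^ k\<close> is the distance
  \<open>2 ^ - n\<close>, whatever \<open>k\<close> is; so the step stays fixed while the grid is
  refined.\<close>

lemma fdiff_dyadic_tendsto:
  fixes y :: "nat \<Rightarrow> int \<Rightarrow> real" and Y :: "real \<Rightarrow> real"
  assumes "\<And>j. (\<lambda>k. y k (2 ^ k * j)) \<longlonglongrightarrow> Y (of_int j / 2 ^ n)"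
  shows "(\<lambda>k. (fdiff (2 ^ k) ^^ r) (y k) (2 ^ k * j)) \<longlonglongrightarrow> (fdiff (1 / 2 ^ n) ^^ r) Y (of_int j / 2 ^ n)"
proof (induction r arbitrary: j)
  case (Suc r)
  have "2 ^ k * j + 2 ^ k = 2 ^ k * (j + 1)" for k :: nat by (simp add: algebra_simps)
  moreover have "of_int j / 2 ^ n + 1 / 2 ^ n = of_int (j + 1) / (2 ^ n :: real)"
    by (simp add: add_divide_distrib)
  ultimately show ?case
    using tendsto_diff[OF Suc[of "j + 1"] Suc[of j]] by (simp add: fdiff_def)
qed (use assms in simp)

text \<open>For \<open>N < q\<close> all differences are traded for derivatives and the exponent
  saturates at \<open>N\<close>. Otherwise \<open>q - 1\<close> of them are, one more meets the
  Hoelder condition, and each of the remaining \<open>N - q\<close> costs a factor 2. The base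
  points are confined to a bounded set because continuous derivatives need not be bounded on the
  line.\<close>

lemma hoelder_fdiff_bound:
  fixes F :: "real \<Rightarrow> real"
  assumes \<beta>: "2 \<le> \<beta>" and F: "hoelder_class \<beta> F"
  obtains C where "\<And>h x. 0 < h \<Longrightarrow> h \<le> 1 \<Longrightarrow> \<bar>x\<bar> \<le> R \<Longrightarrow>
    \<bar>(fdiff h ^^ N) (deriv F) x\<bar> \<le> C * h powr min (\<beta> - 1) (real N)"
proof -
  define q where "q = nat \<lfloor>\<beta>\<rfloor>"
  define G where "G i = (deriv ^^ Suc i) F" for i
  have q: "2 \<le> q" "\<beta> = real q + frac \<beta>" "0 \<le> frac \<beta>" "frac \<beta> < 1"
    using \<beta> unfolding q_def frac_def by linarith+
  from F have diffb: "\<And>i. i < q \<Longrightarrow> (deriv ^^ i) F differentiable_on UNIV"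
    and contq: "continuous_on UNIV ((deriv ^^ q) F)"
    and hq: "frac \<beta> \<noteq> 0 \<Longrightarrow> hoelder_continuous (frac \<beta>) ((deriv ^^ q) F)"
    by (auto simp: hoelder_class_def C_class_def q_def[symmetric])
  have der: "(G i has_real_derivative G (Suc i) x) (at x)" if "Suc i < q" for i x
  proof -
    have "G i differentiable (at x)"
      using diffb[OF that] by (simp add: G_def differentiable_on_def)
    then show ?thesis
      unfolding G_def by (simp add: DERIV_deriv_iff_real_differentiable)
  qed
  have contG: "continuous_on UNIV (G i)" if "Suc i \<le> q" for i
  proof (cases "Suc i = q")
    case True
    then show ?thesis using contq by (simp add: G_def)
  next
    case False
    then have "Suc i < q" using that by simp
    from differentiable_imp_continuous_on[OF diffb[OF this]] show ?thesis by (simp add: G_def)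
  qed
  have bdd: "\<exists>M\<ge>0. \<forall>y\<in>{-A..A}. \<bar>G i y\<bar> \<le> M" if "Suc i \<le> q" for i A
  proof -
    have "compact (G i ` {-A..A})"
      by (intro compact_continuous_image continuous_on_subset[OF contG[OF that]]) auto
    from compact_imp_bounded[OF this] obtain M where M: "\<And>z. z \<in> G i ` {-A..A} \<Longrightarrow> norm z \<le> M"
      unfolding bounded_iff by metis
    have "\<bar>G i y\<bar> \<le> max M 0" if "y \<in> {-A..A}" for y
      using M[OF imageI[OF that]] by simp
    then show ?thesis by (intro exI[of _ "max M 0"]) auto
  qed
  \<comment> \<open>Room for all points visited by at most \<open>N\<close> steps of length at most
    1 from a base point within distance \<open>R\<close> of 0.\<close>
  define A where "A = R + N"
  have range: "-A \<le> y" "y \<le> A" if "\<bar>x\<bar> \<le> R" "x \<le> y" "y \<le> x + real i * h" "i \<le> N" "0 < h" "h \<le> 1"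
    for x y h :: real and i
  proof -
    have "real i * h \<le> real N * 1" using that by (intro mult_mono) auto
    then show "-A \<le> y" "y \<le> A" using that by (auto simp: A_def)
  qed
  have G0: "G 0 = deriv F" by (simp add: G_def)
  show thesis
  proof (cases "N < q")
    case True
    obtain M where M: "\<forall>y\<in>{-A..A}. \<bar>G N y\<bar> \<le> M" using bdd[of N A] True by auto
    show thesis
    proof (rule that[of M])
      fix h x :: real assume h: "0 < h" "h \<le> 1" and x: "\<bar>x\<bar> \<le> R"
      have "\<bar>(fdiff h ^^ (N + 0)) (G 0) x\<bar> \<le> h ^ N * M"
      proof (rule fdiff_derivative_bound[of N G])
        show "\<bar>(fdiff h ^^ 0) (G N) y\<bar> \<le> M" if "x \<le> y" "y \<le> x + real N * h" for y
          using M range[OF x that _ h] by simp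
      qed (use True h der in auto)
      moreover have "min (\<beta> - 1) (real N) = real N" using True q by linarith
      ultimately show "\<bar>(fdiff h ^^ N) (deriv F) x\<bar> \<le> M * h powr min (\<beta> - 1) (real N)"
        using h by (simp add: G0 powr_realpow mult.commute)
    qed
  next
    case False
    define p where "p = q - 1"
    define r where "r = N - q"
    have pr: "N = p + Suc r" "Suc p = q" using False q by (auto simp: p_def r_def)
    have "\<exists>C. \<forall>h y. 0 < h \<longrightarrow> h \<le> 1 \<longrightarrow> -A \<le> y \<longrightarrow> y + h \<le> A \<longrightarrow> \<bar>fdiff h (G p) y\<bar> \<le> C * h powr frac \<beta>"
    proof (cases "frac \<beta> = 0")
      \<comment> \<open>For an integer order the class contains no Hoelder condition; local
        boundedness is the estimate with exponent 0.\<close>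
      case True
      obtain M where M: "\<forall>y\<in>{-A..A}. \<bar>G p y\<bar> \<le> M" using bdd[of p A] pr by auto
      have "\<bar>fdiff h (G p) y\<bar> \<le> (2 * M) * h powr frac \<beta>" if "0 < h" "-A \<le> y" "y + h \<le> A" for h y
        using that M[rule_format, of y] M[rule_format, of "y + h"] unfolding True fdiff_def by simp
      then have "\<forall>h y. 0 < h \<longrightarrow> h \<le> 1 \<longrightarrow> -A \<le> y \<longrightarrow> y + h \<le> A \<longrightarrow>
          \<bar>fdiff h (G p) y\<bar> \<le> (2 * M) * h powr frac \<beta>" by auto
      then show ?thesis by (rule exI)
    next
      case False
      from hq[OF this] obtain C where C: "\<And>x y. \<bar>G p x - G p y\<bar> \<le> C * \<bar>x - y\<bar> powr frac \<beta>"
        unfolding hoelder_continuous_def G_def pr(2) by blast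
      have "\<bar>fdiff h (G p) y\<bar> \<le> C * h powr frac \<beta>" if "0 < h" for h y
        using C[of "y + h" y] that by (simp add: fdiff_def)
      then have "\<forall>h y. 0 < h \<longrightarrow> h \<le> 1 \<longrightarrow> -A \<le> y \<longrightarrow> y + h \<le> A \<longrightarrow>
          \<bar>fdiff h (G p) y\<bar> \<le> C * h powr frac \<beta>" by auto
      then show ?thesis by (rule exI)
    qed
    then obtain C where C: "\<And>h y. 0 < h \<Longrightarrow> h \<le> 1 \<Longrightarrow> -A \<le> y \<Longrightarrow> y + h \<le> A
        \<Longrightarrow> \<bar>fdiff h (G p) y\<bar> \<le> C * h powr frac \<beta>" by metis
    show thesis
    proof (rule that[of "2 ^ r * C"])
      fix h x :: real assume h: "0 < h" "h \<le> 1" and x: "\<bar>x\<bar> \<le> R"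
      have "\<bar>(fdiff h ^^ (p + Suc r)) (G 0) x\<bar> \<le> h ^ p * (2 ^ r * (C * h powr frac \<beta>))"
      proof (rule fdiff_derivative_bound[of p G])
        fix y assume y: "x \<le> y" "y \<le> x + real p * h"
        have "\<bar>(fdiff h ^^ r) (fdiff h (G p)) y\<bar> \<le> 2 ^ r * (C * h powr frac \<beta>)"
        proof (rule fdiff_bound)
          fix u assume u: "y \<le> u" "u \<le> y + real r * h"
          have "x \<le> u + h" "x \<le> u" using u y h by simp_all
          have "u + h \<le> x + real N * h" using u y pr by (simp add: algebra_simps)
          from range[OF x \<open>x \<le> u + h\<close> this _ h] have "u + h \<le> A" by simp
          moreover have "- A \<le> u"
            using \<open>x \<le> u\<close> x by (simp add: A_def)
          ultimately show "\<bar>fdiff h (G p) u\<bar> \<le> C * h powr frac \<beta>" by (intro C h)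
        qed (use h in simp)
        then show "\<bar>(fdiff h ^^ Suc r) (G p) y\<bar> \<le> 2 ^ r * (C * h powr frac \<beta>)"
          by (simp add: funpow_swap1)
      qed (use pr h der in auto)
      moreover have "min (\<beta> - 1) (real N) = real p + frac \<beta>" using pr q by linarith
      ultimately show "\<bar>(fdiff h ^^ N) (deriv F) x\<bar> \<le> 2 ^ r * C * h powr min (\<beta> - 1) (real N)"
        using h pr by (simp add: G0 powr_add powr_realpow mult_ac)
    qed
  qed
qed

section \<open>Regularity in terms of the growth rate\<close>

lemma one_plus_cis: "1 + cis t = 2 * of_real (cos (t / 2)) * cis (t / 2)"
  using cos_double_cos[of "t / 2"] sin_double[of "t / 2"]
  by (simp add: complex_eq_iff power2_eq_square)

lemma cis_minus_one_times: "(cis t - 1) * (cis (- t) - 1) = of_real (4 * (sin (t / 2))\<^sup>2)"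
proof -
  have "(cis t - 1) * (cis (- t) - 1) = 2 - (cis t + cis (- t))"
    by (simp add: algebra_simps cis_mult)
  also have "\<dots> = of_real (2 - 2 * cos t)" by (simp add: complex_eq_iff)
  also have "2 - 2 * cos t = 4 * (sin (t / 2))\<^sup>2" using cos_double_sin[of "t / 2"] by simp
  finally show ?thesis .
qed

text \<open>The bound on the growth rate gives \<open>\<gamma> \<ge> 2\<close>, so the limit
  functions have a first derivative to work with. The phase of \<open>B\<close> is the one that
  centres \<open>2 * m\<close> of the factors \<open>1 + z\<close> and leaves \<open>z ^ - 1\<close>
  for the last.\<close>

locale dual_scheme = symbol_weight b L D for b L D +
  fixes m :: nat and B :: "real fls"
  assumes m: "m \<ge> 1" and b_0: "b 0 = 1" and growth: "growth_rate b \<le> 4 ^ (m - 1)"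
    and B: "laurent_polynomial B"
      "on_circle B t = of_real (b t * (1 / 4) ^ m) * cis (- (real m + 1) * t)"
begin

definition \<gamma> :: real where "\<gamma> = 2 * real m - log 2 (growth_rate b)"

abbreviation "symbol \<equiv> (1 + fls_X) ^ Suc (2 * m) * B"

lemma gamma_bounds: "2 \<le> \<gamma>" "\<gamma> \<le> 2 * real m"
proof -
  have "log 2 (growth_rate b) \<le> log 2 (4 ^ (m - 1))"
    using growth growth_rate_ge_1 by (intro log_mono) auto
  also have "\<dots> = 2 * real (m - 1)" 
    using log_nat_power[of 4 2 "m - 1"] log2_of_power_eq[of 4 2] by simp
  finally show "2 \<le> \<gamma>" using m by (simp add: \<gamma>_def of_nat_diff)
  show "\<gamma> \<le> 2 * real m" using growth_rate_ge_1 by (simp add: \<gamma>_def)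
qed

lemma smooth_scheme:
  assumes s: "0 < s" "s \<notin> \<int>" "s < \<gamma>" and f0: "finitely_supported f0"
  obtains C where "smooth_scheme (2 * m) B f0 s C"
proof -
  let ?e = "(bdiff ^^ Suc (2 * m)) f0"
  let ?S = "\<Sum>k | ?e k \<noteq> 0. \<bar>?e k\<bar>"
  have fe: "finitely_supported ?e" by (rule finitely_supported_bdiff_iterate[OF f0])
  have S: "0 \<le> ?S" by (intro sum_nonneg) auto
  \<comment> \<open>The factor \<open>4 ^ - m\<close> per level lowers the rate
    \<open>2 powr (2 * m - s)\<close> to \<open>2 powr - s\<close>, so this is what
    \<open>s < \<gamma>\<close> has to provide.\<close>
  have "growth_rate b < 2 powr (2 * real m - s)"
    using s(3) growth_rate_ge_1 by (simp add: \<gamma>_def log_less_iff[symmetric])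
  then obtain C where C: "C \<ge> 0"
    "\<And>n. circle_mean (dyadic_product b n) \<le> C * (2 powr (2 * real m - s)) ^ n"
    using growth_rate_less by metis
  have "\<bar>(bdiff ^^ Suc (2 * m)) (subdivision_data symbol f0 n) k\<bar> \<le> ?S * C * (2 powr - s) ^ n" for n k
  proof -
    have data: "(bdiff ^^ Suc (2 * m)) (subdivision_data symbol f0 n) = subdivision_data B ?e n"
      using bdiff_subdivision_data[OF B(1) f0 order.refl, of "Suc (2 * m)" n] by simp
    have "norm (fourier (subdivision_data B ?e n) t)
        \<le> (?S * (1 / 4) ^ (m * n)) * dyadic_product b n t" for t
    proof -
      have nB: "norm (on_circle B u) = b u * (1 / 4) ^ m" for u
        unfolding B(2) norm_mult norm_cis norm_of_real using ge_1[of u] by simp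
      have "norm (fourier (subdivision_data B ?e n) t)
          = (\<Prod>j<n. b (2 ^ j * t) * (1 / 4) ^ m) * norm (fourier ?e (2 ^ n * t))"
        unfolding subdivision_data_Laurent(2)[OF B(1) fe] norm_mult prod_norm[symmetric] nB ..
      also have "(\<Prod>j<n. b (2 ^ j * t) * (1 / 4) ^ m) = dyadic_product b n t * (1 / 4) ^ (m * n)"
        by (simp add: prod.distrib dyadic_product_def power_mult)
      also have "\<dots> * norm (fourier ?e (2 ^ n * t)) \<le> \<dots> * ?S"
        using product_ge_1[of n t] by (intro mult_left_mono norm_fourier_le) auto
      finally show ?thesis by (simp only: mult_ac)
    qed
    from abs_le_circle_mean[OF subdivision_data_Laurent(1)[OF B(1) fe] this]
    have "\<bar>subdivision_data B ?e n k\<bar> \<le> circle_mean (\<lambda>t. (?S * (1 / 4) ^ (m * n)) * dyadic_product b n t)"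
      by (simp add: continuous_intros continuous_product)
    also have "\<dots> \<le> (?S * (1 / 4) ^ (m * n)) * (C * (2 powr (2 * real m - s)) ^ n)"
      unfolding circle_mean_mult using S by (intro mult_left_mono C) auto
    also have "\<dots> = ?S * C * ((1 / 4) ^ m * 2 powr (2 * real m - s)) ^ n"
      by (simp add: power_mult_distrib power_mult)
    also have "(1 / 4) ^ m * 2 powr (2 * real m - s) = 2 powr - s"
    proof -
      have "2 powr (2 * real m) = (4 :: real) ^ m"
        by (simp add: powr_powr[symmetric] powr_realpow)
      then show ?thesis by (simp add: powr_diff powr_minus power_one_over inverse_eq_divide)
    qed
    finally show ?thesis unfolding data .
  qed
  moreover have "s < real (2 * m) + 1" using s gamma_bounds by simp
  moreover have "on_circle B 0 = (1 / 2) ^ (2 * m)"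
    by (simp add: B(2) b_0 power_mult power2_eq_square)
  ultimately have "smooth_scheme (2 * m) B f0 s (?S * C)"
    using B f0 s by unfold_locales auto
  then show thesis by (rule that)
qed

lemma limit_convergent:
  assumes "finitely_supported f0"
  shows "convergent (\<lambda>n. subdivision_polygon symbol f0 n x)"
proof -
  have "(3 / 2 :: real) \<notin> \<int>" using frac_eq_0_iff[of "3 / 2 :: real"] by (simp add: frac_def)
  then obtain C where "smooth_scheme (2 * m) B f0 (3 / 2) C"
    using smooth_scheme[of "3 / 2" f0] gamma_bounds assms by auto
  then show ?thesis by (rule smooth_scheme.polygon_convergent)
qed

lemma limit_hoelder:
  assumes "finitely_supported f0" "0 \<le> \<beta>" "\<beta> < \<gamma>"
  shows "hoelder_class \<beta> (subdivision_limit symbol f0)"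
proof -
  \<comment> \<open>Strictly between \<open>\<beta>\<close> and both \<open>\<gamma>\<close> and the
    next integer: this gives \<open>s\<close> the floor of \<open>\<beta>\<close> and keeps it off
    the integers.\<close>
  define s where "s = (\<beta> + min \<gamma> (of_int \<lfloor>\<beta>\<rfloor> + 1)) / 2"
  have "\<beta> < of_int \<lfloor>\<beta>\<rfloor> + 1" by linarith
  then have "\<beta> < min \<gamma> (of_int \<lfloor>\<beta>\<rfloor> + 1)" using assms by (simp only: min_less_iff_conj)
  moreover have "min \<gamma> (of_int \<lfloor>\<beta>\<rfloor> + 1) \<le> \<gamma>" "min \<gamma> (of_int \<lfloor>\<beta>\<rfloor> + 1) \<le> of_int \<lfloor>\<beta>\<rfloor> + 1"
    by (rule min.cobounded1, rule min.cobounded2)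
  ultimately have s: "\<beta> < s" "s < \<gamma>" "s < of_int \<lfloor>\<beta>\<rfloor> + 1"
    by (simp_all add: s_def del: min_less_iff_conj)
  from s have fl: "\<lfloor>s\<rfloor> = \<lfloor>\<beta>\<rfloor>" by linarith
  have "s \<notin> \<int>"
  proof
    assume "s \<in> \<int>"
    then have "s = of_int \<lfloor>s\<rfloor>" by (simp add: of_int_floor)
    then show False using fl s(1) by linarith
  qed
  then obtain C where "smooth_scheme (2 * m) B f0 s C"
    using smooth_scheme[of s f0] s assms by auto
  then show ?thesis
    by (rule smooth_scheme.hoelder_class_limit) (use assms s fl in auto)
qed

subsection \<open>The lower bound\<close>

abbreviation impulse :: "int \<Rightarrow> real" where
  "impulse k \<equiv> if k = 0 then 1 else 0"

text \<open>The symbol on the circle without its odd factor \<open>(1 + z) / z\<close>; unlike the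
  symbol it is real and nonnegative.\<close>

definition mask :: "real \<Rightarrow> real" where
  "mask t = ((cos (t / 2))\<^sup>2) ^ m * b t"

definition first_diff :: "nat \<Rightarrow> int \<Rightarrow> real" where
  "first_diff K i = scaled_diff symbol impulse 1 K (i + 1)"

text \<open>
  The shift by one makes \<open>first_diff\<close> a forward difference, whose Fourier series carries no phase
  besides \<open>cis (- (2 ^ K) * t) - 1\<close>; the conjugate factor contributed by \<open>test_data\<close> then makes
  the Fourier series nonnegative. In the limit the shift disappears.
\<close>

definition test_data :: "nat \<Rightarrow> int \<Rightarrow> real" where
  "test_data K i = first_diff K (i - 2 ^ K) - first_diff K i"

lemma impulse: "finitely_supported impulse" "fourier impulse t = 1"
proof -
  show "finitely_supported impulse" by (rule finitely_supportedI[of "{0}"]) auto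
  show "fourier impulse t = 1" by (subst fourier_eq_sum[of "{0}"]) auto
qed

lemma symbol_Laurent: "laurent_polynomial symbol"
  by (intro laurent_polynomial_intros B(1))

text \<open>Each of \<open>m\<close> pairs of factors \<open>1 + z\<close> takes one
  \<open>z ^ - 1\<close> from the phase of \<open>B\<close>, and \<open>(1 + z) ^ 2 / z\<close> is
  \<open>4 * (cos (t / 2))\<^sup>2\<close>. One \<open>1 + z\<close> and one \<open>z ^ - 1\<close>
  are left over.\<close>

lemma on_circle_symbol: "on_circle symbol t = (1 + cis t) * cis (- t) * of_real (mask t)"
proof -
  have "(1 + cis t)\<^sup>2 * cis (- t) = (2 * of_real (cos (t / 2)))\<^sup>2 * ((cis (t / 2))\<^sup>2 * cis (- t))"
    unfolding one_plus_cis by (simp only: power_mult_distrib mult_ac)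
  also have "(cis (t / 2))\<^sup>2 * cis (- t) = 1"
    by (simp add: power2_eq_square cis_mult)
  finally have sq: "(1 + cis t)\<^sup>2 * cis (- t) = of_real (4 * (cos (t / 2))\<^sup>2)"
    by (simp add: power_mult_distrib)
  have "on_circle symbol t = (1 + cis t) * ((1 + cis t)\<^sup>2) ^ m * (of_real (b t * (1 / 4) ^ m) * cis (- (real m + 1) * t))"
    by (simp add: on_circle_simps laurent_polynomial_intros B power_mult)
  also have "cis (- (real m + 1) * t) = cis (- t) * cis (- t) ^ m"
    by (simp only: Complex.DeMoivre cis_mult) (rule arg_cong[of _ _ cis], simp add: algebra_simps)
  also have "(1 + cis t) * ((1 + cis t)\<^sup>2) ^ m * (of_real (b t * (1 / 4) ^ m) * (cis (- t) * cis (- t) ^ m))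
      = (1 + cis t) * cis (- t) * (of_real (b t * (1 / 4) ^ m) * ((1 + cis t)\<^sup>2 * cis (- t)) ^ m)"
    by (simp only: power_mult_distrib mult_ac)
  also have "of_real (b t * (1 / 4) ^ m) * ((1 + cis t)\<^sup>2 * cis (- t)) ^ m = complex_of_real (mask t)"
    unfolding sq of_real_power[symmetric] of_real_mult[symmetric]
    by (simp add: mask_def power_mult_distrib power_one_over mult_ac)
  finally show ?thesis .
qed

lemma fourier_first_diff: "finitely_supported (first_diff K)"
  "fourier (first_diff K) t = 2 ^ K * of_real (dyadic_product mask K t) * (cis (- (2 ^ K) * t) - 1)"
proof -
  let ?f = "subdivision_data symbol impulse K"
  have fs: "finitely_supported ?f" by (rule subdivision_data_Laurent[OF symbol_Laurent impulse(1)])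
  have ueq: "first_diff K = (\<lambda>i. (\<lambda>i. 2 ^ K * bdiff ?f i) (i + 1))"
    by (simp add: first_diff_def scaled_diff_def fun_eq_iff)
  have fsb: "finitely_supported (\<lambda>i. 2 ^ K * bdiff ?f i)"
    by (intro finitely_supported_mult finitely_supported_bdiff fs)
  show "finitely_supported (first_diff K)" unfolding ueq by (rule finitely_supported_shift[OF fsb])
  \<comment> \<open>The odd factors telescope with the difference: \<open>1 - z\<close> times the
    product of \<open>1 + z ^ (2 ^ j)\<close> is \<open>1 - z ^ (2 ^ K)\<close>, while the phases
    add up to \<open>2 ^ K - 1\<close>. The shift by one in \<open>first_diff\<close> supplies the
    missing unit.\<close>
  have tele: "(1 - cis t) * (\<Prod>j<K. on_circle symbol (2 ^ j * t))
      = (1 - cis (2 ^ K * t)) * cis (- (2 ^ K - 1) * t) * of_real (dyadic_product mask K t)" for K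
  proof (induction K)
    case (Suc K)
    let ?z = "2 ^ K * t"
    have "(1 - cis t) * (\<Prod>j<Suc K. on_circle symbol (2 ^ j * t))
        = ((1 - cis ?z) * (1 + cis ?z)) * (cis (- (2 ^ K - 1) * t) * cis (- ?z))
          * (of_real (dyadic_product mask K t) * of_real (mask ?z))"
      unfolding prod.lessThan_Suc mult.assoc[symmetric] Suc
      unfolding on_circle_symbol by (simp only: mult_ac)
    also have "(1 - cis ?z) * (1 + cis ?z) = 1 - cis (2 ^ Suc K * t)"
      by (simp add: algebra_simps cis_mult)
    also have "cis (- (2 ^ K - 1) * t) * cis (- ?z) = cis (- (2 ^ Suc K - 1) * t)"
      by (simp add: cis_mult algebra_simps)
    also have "complex_of_real (dyadic_product mask K t) * of_real (mask ?z) = of_real (dyadic_product mask (Suc K) t)"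
      by (simp add: dyadic_product_def)
    finally show ?case .
  qed (simp add: dyadic_product_def)
  have "fourier (first_diff K) t = cis (- t) * (2 ^ K * ((1 - cis t) * (\<Prod>j<K. on_circle symbol (2 ^ j * t))))"
    unfolding ueq
    by (subst fourier_shift[OF fsb])
       (simp add: fourier_mult[OF finitely_supported_bdiff(1)[OF fs]] finitely_supported_bdiff(2)[OF fs]
          subdivision_data_Laurent(2)[OF symbol_Laurent impulse(1)] impulse(2) del: power_Suc)
  also have "\<dots> = 2 ^ K * of_real (dyadic_product mask K t)
      * ((1 - cis (2 ^ K * t)) * (cis (- (2 ^ K - 1) * t) * cis (- t)))"
    unfolding tele by (simp only: mult_ac)
  also have "(1 - cis (2 ^ K * t)) * (cis (- (2 ^ K - 1) * t) * cis (- t)) = cis (- (2 ^ K) * t) - 1"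
    by (simp add: cis_mult algebra_simps)
  finally show "fourier (first_diff K) t = 2 ^ K * of_real (dyadic_product mask K t) * (cis (- (2 ^ K) * t) - 1)" .
qed

lemma fourier_test_data: "finitely_supported (test_data K)"
  "fourier (test_data K) t = of_real (2 ^ K * dyadic_product mask K t * (4 * (sin (2 ^ K * t / 2))\<^sup>2))"
proof -
  have yeq: "test_data K = (\<lambda>i. first_diff K (i + - (2 ^ K)) - first_diff K i)" by (simp add: test_data_def fun_eq_iff)
  note fs = fourier_first_diff(1)[of K] finitely_supported_shift[OF fourier_first_diff(1), of K "- (2 ^ K)"]
  show "finitely_supported (test_data K)" unfolding yeq by (intro finitely_supported_diff fs)
  have "fourier (test_data K) t = (cis (2 ^ K * t) - 1) * fourier (first_diff K) t"
    unfolding yeq by (subst fourier_diff[OF fs(2,1)], subst fourier_shift[OF fs(1)]) (simp add: algebra_simps)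
  also have "\<dots> = 2 ^ K * of_real (dyadic_product mask K t) * ((cis (2 ^ K * t) - 1) * (cis (- (2 ^ K * t)) - 1))"
    by (simp add: fourier_first_diff(2))
  also have "\<dots> = of_real (2 ^ K * dyadic_product mask K t * (4 * (sin (2 ^ K * t / 2))\<^sup>2))"
    unfolding cis_minus_one_times by simp
  finally show "fourier (test_data K) t = of_real (2 ^ K * dyadic_product mask K t * (4 * (sin (2 ^ K * t / 2))\<^sup>2))" .
qed

text \<open>Of the \<open>m + 1\<close> sine factors, \<open>m\<close> come from the difference of
  order \<open>2 * m\<close> and one from \<open>test_data\<close>.\<close>

definition test_weight :: "nat \<Rightarrow> real \<Rightarrow> real" where
  "test_weight n t = (4 * (sin (2 ^ n * t / 2))\<^sup>2) ^ Suc m * dyadic_product b n t"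

lemma product_mask: "dyadic_product mask n t = (\<Prod>j<n. (cos (2 ^ j * t / 2))\<^sup>2) ^ m * dyadic_product b n t"
  by (simp add: dyadic_product_def mask_def prod.distrib prod_power_distrib)

lemma product_mask_add: "dyadic_product mask (n + k) t = dyadic_product mask k t * dyadic_product mask n (2 ^ k * t)"
proof (induction n)
  case (Suc n)
  have "2 ^ (n + k) * t = 2 ^ n * (2 ^ k * t)" by (simp add: power_add)
  then show ?case
    using Suc unfolding dyadic_product_def add_Suc prod.lessThan_Suc by (simp only: mult.assoc)
qed (simp add: dyadic_product_def)

text \<open>The base point \<open>- m\<close> steps centres the forward difference of order
  \<open>2 * m\<close>, so its multiplier is the sign \<open>(- 1) ^ m\<close> times a nonnegative
  function. Its sines absorb, by \<open>sin_prod_cos\<close>, the cosines of the \<open>n\<close>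
  mask factors at frequencies from \<open>2 ^ k * t\<close> on, which leaves the factor
  \<open>4 ^ - (n * m)\<close> and the sines of \<open>test_weight\<close>.\<close>

lemma fdiff_test_data_eq:
  "(fdiff (2 ^ k) ^^ (2 * m)) (test_data (n + k)) (2 ^ k * - int m)
    = (- 1) ^ m * (2 ^ n * (1 / 4) ^ (n * m)) * circle_mean (\<lambda>t. 2 ^ k * dyadic_product mask k t * test_weight n (2 ^ k * t))"
proof -
  let ?d = "(fdiff (2 ^ k) ^^ (2 * m)) (test_data (n + k))" and ?i = "2 ^ k * - int m"
  have int: "Re (fourier ?d t * cis (- of_int ?i * t))
      = (- 1) ^ m * (2 ^ n * (1 / 4) ^ (n * m)) * (2 ^ k * dyadic_product mask k t * test_weight n (2 ^ k * t))" for t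
  proof -
    let ?p = "2 ^ k * t"
    have Kp: "2 ^ (n + k) * t = 2 ^ n * ?p" by (simp add: power_add)
    have "cis (- of_int ?i * t) = cis ?p ^ m"
      by (simp only: Complex.DeMoivre) (rule arg_cong[of _ _ cis], simp)
    then have "(cis (- (2 ^ k) * t) - 1) ^ (2 * m) * cis (- of_int ?i * t)
        = ((cis (- (2 ^ k) * t) - 1)\<^sup>2) ^ m * cis ?p ^ m"
      by (simp only: power_mult)
    also have "\<dots> = (cis ?p * (cis (- ?p) - 1)\<^sup>2) ^ m"
      by (simp add: power_mult_distrib mult.commute)
    also have "cis ?p * (cis (- ?p) - 1)\<^sup>2 = - ((cis ?p - 1) * (cis (- ?p) - 1))"
      by (simp add: power2_eq_square algebra_simps cis_mult)
    also have "\<dots> ^ m = of_real ((- 1) ^ m * (4 * (sin (?p / 2))\<^sup>2) ^ m)"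
      unfolding cis_minus_one_times by (simp add: power_minus[of "_ * _"])
    finally have a: "(cis (- (2 ^ k) * t) - 1) ^ (2 * m) * cis (- of_int ?i * t)
      = of_real ((- 1) ^ m * (4 * (sin (?p / 2))\<^sup>2) ^ m)" .
    have "fourier ?d t * cis (- of_int ?i * t)
        = ((cis (- (2 ^ k) * t) - 1) ^ (2 * m) * cis (- of_int ?i * t)) * fourier (test_data (n + k)) t"
      by (simp add: fourier_fdiff(2)[OF fourier_test_data(1)] mult_ac)
    also have "\<dots> = of_real (((- 1) ^ m * (4 * (sin (?p / 2))\<^sup>2) ^ m)
      * (2 ^ (n + k) * dyadic_product mask (n + k) t * (4 * (sin (2 ^ (n + k) * t / 2))\<^sup>2)))"
      unfolding a fourier_test_data(2) of_real_mult[symmetric] ..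
    finally have "Re (fourier ?d t * cis (- of_int ?i * t))
      = ((- 1) ^ m * (4 * (sin (?p / 2))\<^sup>2) ^ m)
      * (2 ^ (n + k) * dyadic_product mask (n + k) t * (4 * (sin (2 ^ (n + k) * t / 2))\<^sup>2))"
      by (simp only: Re_complex_of_real)
    also have "\<dots> = (- 1) ^ m * 2 ^ (n + k) * dyadic_product mask k t * (4 * (sin (2 ^ n * ?p / 2))\<^sup>2)
      * ((4 * (sin (?p / 2))\<^sup>2) ^ m * dyadic_product mask n ?p)"
      unfolding Kp product_mask_add by (simp only: mult_ac)
    also have "(4 * (sin (?p / 2))\<^sup>2) ^ m * dyadic_product mask n ?p
      = (1 / 4) ^ (n * m) * (4 * (sin (2 ^ n * ?p / 2))\<^sup>2) ^ m * dyadic_product b n ?p"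
      unfolding product_mask sin_prod_cos[symmetric]
      by (simp add: power_mult_distrib power_mult power_one_over)
    also have "(- 1) ^ m * 2 ^ (n + k) * dyadic_product mask k t * (4 * (sin (2 ^ n * ?p / 2))\<^sup>2)
      * ((1 / 4) ^ (n * m) * (4 * (sin (2 ^ n * ?p / 2))\<^sup>2) ^ m * dyadic_product b n ?p)
      = (- 1) ^ m * (2 ^ n * (1 / 4) ^ (n * m)) * (2 ^ k * dyadic_product mask k t * test_weight n ?p)"
      unfolding test_weight_def power_Suc power_add by (simp only: mult_ac)
    finally show ?thesis .
  qed
  have "?d ?i = circle_mean (\<lambda>t. Re (fourier ?d t * cis (- of_int ?i * t)))"
    by (rule fourier_coefficient[OF fourier_fdiff(1)[OF fourier_test_data(1)]])
  also have "\<dots> = (- 1) ^ m * (2 ^ n * (1 / 4) ^ (n * m))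
      * circle_mean (\<lambda>t. 2 ^ k * dyadic_product mask k t * test_weight n (2 ^ k * t))"
    unfolding int by (rule circle_mean_mult)
  finally show ?thesis .
qed

lemma continuous_mask: "continuous_on UNIV (dyadic_product mask k)"
  unfolding dyadic_product_def[abs_def] mask_def
  by (intro continuous_intros continuous_compose_real[OF continuous]) auto

lemma test_weight_cont: "continuous_on UNIV (test_weight n)" and test_weight_nonneg: "test_weight n t \<ge> 0"
proof -
  show "continuous_on UNIV (test_weight n)"
    unfolding test_weight_def[abs_def] by (intro continuous_intros continuous_product) auto
  show "test_weight n t \<ge> 0" using product_ge_1[of n t] by (auto simp: test_weight_def)
qed

lemma mask_product_lower:
  assumes "\<bar>t\<bar> \<le> pi / 2 ^ k"
  shows "(1 / 6) ^ m \<le> dyadic_product mask k t"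
proof -
  have "(1 / 6) ^ m * 1 \<le> (\<Prod>j<k. (cos (2 ^ j * t / 2))\<^sup>2) ^ m * dyadic_product b k t"
    by (intro mult_mono power_mono prod_cos_lower[OF assms] product_ge_1) (auto intro!: zero_le_power prod_nonneg zero_le_power2)
  then show ?thesis by (simp add: product_mask)
qed

text \<open>The constant is independent of \<open>n\<close> and \<open>k\<close>, so the bound
  survives the limit in \<open>k\<close> and can be compared across all \<open>n\<close>. It
  combines \<open>6 ^ - m\<close>, from the cosines near 0, with \<open>1 + exp (L * pi)\<close>,
  the price of dropping the sine weight.\<close>

lemma fdiff_test_data_lower:
  obtains c where "c > 0" "\<And>n k. c * (2 ^ n * (1 / 4) ^ (n * m)) * circle_mean (dyadic_product b n)
    \<le> \<bar>(fdiff (2 ^ k) ^^ (2 * m)) (test_data (n + k)) (2 ^ k * - int m)\<bar>"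
proof -
  define c where "c = (1 / 6) ^ m / (1 + exp (L * pi))"
  have c: "c > 0" by (auto simp: c_def intro!: divide_pos_pos add_pos_pos)
  show thesis
  proof (rule that[OF c])
    fix n k
    let ?M = "circle_mean (\<lambda>t. 2 ^ k * dyadic_product mask k t * test_weight n (2 ^ k * t))"
    have "c * circle_mean (dyadic_product b n) \<le> c * ((1 + exp (L * pi)) * circle_mean (test_weight n))"
      using mean_weighted_ge[of n "Suc m"] c unfolding test_weight_def[abs_def] by (intro mult_left_mono) auto
    also have "\<dots> = (1 / 6) ^ m * circle_mean (test_weight n)"
      using add_pos_pos[OF zero_less_one exp_gt_zero[of "L * pi"]] by (simp add: c_def)
    also have "\<dots> \<le> ?M"
    proof (rule circle_mean_concentrate[OF test_weight_cont test_weight_nonneg continuous_mask])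
      show "0 \<le> dyadic_product mask k t" for t
        using product_ge_1[of k t] by (auto simp: product_mask intro!: mult_nonneg_nonneg zero_le_power prod_nonneg zero_le_power2)
    qed (rule mask_product_lower)
    finally have "(2 ^ n * (1 / 4) ^ (n * m)) * (c * circle_mean (dyadic_product b n))
      \<le> (2 ^ n * (1 / 4) ^ (n * m)) * ?M" by (intro mult_left_mono) auto
    also have "\<dots> \<le> \<bar>(2 ^ n * (1 / 4) ^ (n * m)) * ?M\<bar>" by (rule abs_ge_self)
    also have "\<dots> = \<bar>(fdiff (2 ^ k) ^^ (2 * m)) (test_data (n + k)) (2 ^ k * - int m)\<bar>"
      unfolding fdiff_test_data_eq by (simp add: abs_mult power_abs)
    finally show "c * (2 ^ n * (1 / 4) ^ (n * m)) * circle_mean (dyadic_product b n)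
      \<le> \<bar>(fdiff (2 ^ k) ^^ (2 * m)) (test_data (n + k)) (2 ^ k * - int m)\<bar>" by (simp only: mult_ac)
  qed
qed

lemma limit_derivative:
  obtains F1 where "deriv (subdivision_limit symbol impulse) = F1"
    "\<And>n j. (\<lambda>k. first_diff (n + k) (2 ^ k * j)) \<longlonglongrightarrow> F1 (of_int j / 2 ^ n)"
proof -
  \<comment> \<open>A noninteger exponent above 1, to reach the first derivative, and below 2, to
    stay below \<open>\<gamma>\<close>.\<close>
  have "(3 / 2 :: real) \<notin> \<int>" using frac_eq_0_iff[of "3 / 2 :: real"] by (simp add: frac_def)
  then obtain C where "smooth_scheme (2 * m) B impulse (3 / 2) C"
    using smooth_scheme[of "3 / 2" impulse] gamma_bounds impulse(1) by auto
  then interpret sm: smooth_scheme "2 * m" B impulse "3 / 2" C .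
  show thesis
  proof (rule sm.limit_derivatives)
    fix F :: "nat \<Rightarrow> real \<Rightarrow> real" and K :: "nat \<Rightarrow> real"
    assume F: "\<And>r n x. real r < 3 / 2 \<Longrightarrow> \<bar>F r x - scaled_diff symbol impulse r n \<lfloor>2 ^ n * x\<rfloor>\<bar> \<le> K r * (2 powr - min 1 (3 / 2 - real r)) ^ n"
      "\<And>r n k. real r < 3 / 2 \<Longrightarrow> \<bar>bdiff (scaled_diff symbol impulse r n) k\<bar> \<le> K r * (2 powr - min 1 (3 / 2 - real r)) ^ n"
      and der: "\<And>r x. real (Suc r) < 3 / 2 \<Longrightarrow> (F r has_real_derivative F (Suc r) x) (at x)"
      and lim: "subdivision_limit symbol impulse = F 0"
    let ?\<tau> = "2 powr - min 1 (3 / 2 - real 1) :: real"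
    have \<tau>: "0 \<le> ?\<tau>" "?\<tau> < 1" by (auto simp: powr_less_one)
    show thesis
    proof (rule that[of "F 1"])
      show "deriv (subdivision_limit symbol impulse) = F 1"
        unfolding lim using der[of 0] by (intro ext DERIV_imp_deriv) simp
      fix n :: nat and j :: int
      have "\<bar>F 1 (of_int j / 2 ^ n) - first_diff (n + k) (2 ^ k * j)\<bar> \<le> (2 * K 1 * ?\<tau> ^ n) * ?\<tau> ^ k" for k
      proof -
        have fl: "\<lfloor>2 ^ (n + k) * (of_int j / 2 ^ n :: real)\<rfloor> = 2 ^ k * j"
        proof -
          have "2 ^ (n + k) * (of_int j / 2 ^ n :: real) = of_int (2 ^ k * j)" by (simp add: power_add)
          then show ?thesis by (simp only: floor_of_int)
        qed
        have "\<bar>F 1 (of_int j / 2 ^ n) - scaled_diff symbol impulse 1 (n + k) (2 ^ k * j)\<bar> \<le> K 1 * ?\<tau> ^ (n + k)"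
          using F(1)[of 1 "of_int j / 2 ^ n" "n + k"] unfolding fl by simp
        \<comment> \<open>The shift by one index in \<open>first_diff\<close> costs one backward
          difference, which decays at the rate of the approximation error.\<close>
        moreover have "\<bar>bdiff (scaled_diff symbol impulse 1 (n + k)) (2 ^ k * j + 1)\<bar> \<le> K 1 * ?\<tau> ^ (n + k)"
          by (rule F(2)) simp
        ultimately have "\<bar>F 1 (of_int j / 2 ^ n) - first_diff (n + k) (2 ^ k * j)\<bar> \<le> 2 * (K 1 * ?\<tau> ^ (n + k))"
          unfolding first_diff_def bdiff_def by simp
        then show ?thesis by (simp add: power_add mult_ac)
      qed
      then show "(\<lambda>k. first_diff (n + k) (2 ^ k * j)) \<longlonglongrightarrow> F 1 (of_int j / 2 ^ n)"
        by (rule dyadic_limit_unique[OF _ \<tau>])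
    qed
  qed
qed

text \<open>At step \<open>2 ^ - n\<close> the Hoelder bound meets the lower bound for the same
  difference. This bounds the means by a multiple of the n-th power of
  \<open>2 powr (2 * m - 1 - \<mu>)\<close>, hence the growth rate by that number.\<close>

lemma impulse_not_hoelder:
  assumes "\<gamma> < \<beta>"
  shows "\<not> hoelder_class \<beta> (subdivision_limit symbol impulse)"
proof
  let ?\<phi> = "subdivision_limit symbol impulse"
  assume H: "hoelder_class \<beta> ?\<phi>"
  obtain F1 where F1: "deriv ?\<phi> = F1" and
    first_diff: "\<And>n j. (\<lambda>k. first_diff (n + k) (2 ^ k * j)) \<longlonglongrightarrow> F1 (of_int j / 2 ^ n)"
    by (rule limit_derivative) (rule that)
  obtain c where c: "c > 0" "\<And>n k. c * (2 ^ n * (1 / 4) ^ (n * m)) * circle_mean (dyadic_product b n)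
    \<le> \<bar>(fdiff (2 ^ k) ^^ (2 * m)) (test_data (n + k)) (2 ^ k * - int m)\<bar>"
    by (rule fdiff_test_data_lower) (rule that)
  \<comment> \<open>A difference of order \<open>2 * m\<close> detects at most \<open>2 * m\<close>
    orders of smoothness of the derivative, hence the cap.\<close>
  define \<mu> where "\<mu> = min (\<beta> - 1) (real (2 * m))"
  have "2 \<le> \<beta>" using assms gamma_bounds by simp
  \<comment> \<open>The radius \<open>m + 1\<close> covers both base points
    \<open>- m / 2 ^ n\<close> and \<open>- m / 2 ^ n - 1\<close>.\<close>
  from hoelder_fdiff_bound[OF this H, of "real m + 1" "2 * m"]
  obtain C where C: "\<And>h x. 0 < h \<Longrightarrow> h \<le> 1 \<Longrightarrow> \<bar>x\<bar> \<le> real m + 1 \<Longrightarrow>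
    \<bar>(fdiff h ^^ (2 * m)) F1 x\<bar> \<le> C * h powr \<mu>"
    unfolding F1 \<mu>_def by blast
  have "circle_mean (dyadic_product b n) \<le> 2 * C / c * (2 powr (2 * real m - 1 - \<mu>)) ^ n" for n
  proof -
    let ?h = "1 / 2 ^ n :: real" and ?x = "of_int (- int m) / 2 ^ n :: real"
    let ?Y = "\<lambda>x. F1 (x - 1) - F1 x"
    have "(\<lambda>k. test_data (n + k) (2 ^ k * j)) \<longlonglongrightarrow> ?Y (of_int j / 2 ^ n)" for j
    proof -
      have "2 ^ k * j - 2 ^ (n + k) = 2 ^ k * (j - 2 ^ n)" for k :: nat
        by (simp add: power_add algebra_simps)
      moreover have "of_int j / 2 ^ n - 1 = of_int (j - 2 ^ n) / (2 ^ n :: real)"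
        by (simp add: diff_divide_distrib)
      ultimately show ?thesis
        unfolding test_data_def using tendsto_diff[OF first_diff[of n "j - 2 ^ n"] first_diff[of n j]] by simp
    qed
    from fdiff_dyadic_tendsto[where Y = ?Y and y = "\<lambda>k. test_data (n + k)" and n = n and r = "2 * m", OF this]
    have "(\<lambda>k. \<bar>(fdiff (2 ^ k) ^^ (2 * m)) (test_data (n + k)) (2 ^ k * - int m)\<bar>)
        \<longlonglongrightarrow> \<bar>(fdiff ?h ^^ (2 * m)) ?Y ?x\<bar>"
      by (rule tendsto_rabs)
    then have "c * (2 ^ n * (1 / 4) ^ (n * m)) * circle_mean (dyadic_product b n)
        \<le> \<bar>(fdiff ?h ^^ (2 * m)) ?Y ?x\<bar>"
      by (rule LIMSEQ_le_const) (use c in auto)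
    also have "\<dots> \<le> 2 * (C * ?h powr \<mu>)"
    proof -
      have h: "0 < ?h" "?h \<le> 1" by simp_all
      have "\<bar>?x\<bar> \<le> real m" by (simp add: divide_le_eq mult_le_cancel_left1)
      then have "\<bar>?x\<bar> \<le> real m + 1" "\<bar>?x - 1\<bar> \<le> real m + 1" by linarith+
      with C[OF h, of ?x] C[OF h, of "?x - 1"] show ?thesis
        unfolding fdiff_shift_diff by linarith
    qed
    finally have *: "c * (2 ^ n * (1 / 4) ^ (n * m)) * circle_mean (dyadic_product b n) \<le> 2 * (C * ?h powr \<mu>)" .
    have "?h powr \<mu> = (2 ^ n * (1 / 4) ^ (n * m)) * (2 powr (2 * real m - 1 - \<mu>)) ^ n"
    proof -
      have "2 ^ n * (1 / 4) ^ (n * m) = (2 powr (1 - 2 * real m)) ^ n"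
      proof -
        have "2 powr (2 * real m) = (4 :: real) ^ m"
          by (simp add: powr_powr[symmetric] powr_realpow)
        then have "2 powr (1 - 2 * real m) = 2 * (1 / 4 :: real) ^ m"
          by (simp add: powr_diff power_one_over)
        then show ?thesis by (simp add: power_mult_distrib power_mult mult.commute[of n])
      qed
      moreover have "2 powr (1 - 2 * real m) * 2 powr (2 * real m - 1 - \<mu>) = 2 powr - \<mu>"
        by (simp add: powr_add[symmetric])
      moreover have "?h powr \<mu> = (2 powr - \<mu>) ^ n"
        by (simp add: powr_divide powr_minus inverse_eq_divide power_one_over powr_realpow[symmetric] powr_powr mult.commute)
      ultimately show ?thesis by (simp add: power_mult_distrib[symmetric])
    qed
    with * have "(2 ^ n * (1 / 4) ^ (n * m)) * (c * circle_mean (dyadic_product b n))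
       \<le> (2 ^ n * (1 / 4) ^ (n * m)) * (2 * C * (2 powr (2 * real m - 1 - \<mu>)) ^ n)"
      by (simp only: mult_ac)
    then have "c * circle_mean (dyadic_product b n) \<le> 2 * C * (2 powr (2 * real m - 1 - \<mu>)) ^ n"
      by (subst (asm) mult_le_cancel_left_pos) auto
    then show ?thesis using c(1) by (simp add: field_simps)
  qed
  from growth_rate_le[OF _ this] have "growth_rate b \<le> 2 powr (2 * real m - 1 - \<mu>)" by simp
  then have "log 2 (growth_rate b) \<le> 2 * real m - 1 - \<mu>"
    using growth_rate_ge_1 by (subst log_le_iff) auto
  then have "\<mu> + 1 \<le> \<gamma>" by (simp add: \<gamma>_def)
  \<comment> \<open>For \<open>\<mu> = \<beta> - 1\<close> this reads
    \<open>\<beta> \<le> \<gamma>\<close>; for \<open>\<mu> = 2 * m\<close> it reads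
    \<open>2 * m + 1 \<le> \<gamma>\<close>, against \<open>\<gamma> \<le> 2 * m\<close>.\<close>
  then show False using assms gamma_bounds by (auto simp: \<mu>_def min_def split: if_splits)
qed

lemma has_regularity: "has_hoelder_regularity symbol \<gamma>"
  unfolding has_hoelder_regularity_def
  using gamma_bounds limit_convergent limit_hoelder impulse_not_hoelder impulse(1) by auto

end

section \<open>Dual pseudo-splines\<close>

definition coefficient :: "nat \<Rightarrow> nat \<Rightarrow> real" where
  "coefficient m k = (real m - 1 / 2 + real k) gchoose k"

definition pseudo_poly :: "nat \<Rightarrow> nat \<Rightarrow> real \<Rightarrow> real" where
  "pseudo_poly m l x = (\<Sum>k\<le>l. coefficient m k * x ^ k)"

definition pseudo_weight :: "nat \<Rightarrow> nat \<Rightarrow> real \<Rightarrow> real" where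
  "pseudo_weight m l t = pseudo_poly m l ((sin (t / 2))\<^sup>2)"

section \<open>Coefficients, values and quotients of the polynomials\<close>

lemma coefficient_0 [simp]: "coefficient m 0 = 1"
  by (simp add: coefficient_def)

lemma coefficient_Suc:
  "coefficient m (Suc k) = coefficient m k * ((real m + real k + 1 / 2) / (real k + 1))"
  unfolding coefficient_def gbinomial_plus_eq_prod by (simp add: algebra_simps)

lemma coefficient_pos: "coefficient m k > 0"
  by (induction k) (auto simp: coefficient_Suc intro!: mult_pos_pos divide_pos_pos)

lemma coefficient_Suc_left:
  "coefficient (Suc m) k = coefficient m k * ((real m + real k + 1 / 2) / (real m + 1 / 2))"
proof (induction k)
  case 0
  have "real m + 1 / 2 \<noteq> 0" by linarith
  then show ?case by simp
next
  case (Suc k)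
  have "real m + 1 / 2 \<noteq> 0" "real k + 1 \<noteq> 0" by linarith+
  then show ?case unfolding coefficient_Suc Suc by (simp add: divide_simps) (simp add: algebra_simps)
qed

text \<open>Parallel summation of binomials collapses the value at 1 to a single coefficient, so
  quotients of such values are explicit products.\<close>

lemma pseudo_poly_1: "pseudo_poly m l 1 = coefficient (Suc m) l"
  using gbinomial_parallel_sum[of "real m - 1 / 2" l]
  by (simp add: pseudo_poly_def coefficient_def algebra_simps)

lemma pseudo_poly_mono:
  assumes "0 \<le> x" "x \<le> y"
  shows "pseudo_poly m l x \<le> pseudo_poly m l y"
  unfolding pseudo_poly_def using assms coefficient_pos[of m]
  by (intro sum_mono mult_left_mono power_mono) (auto simp: less_imp_le)

lemma pseudo_poly_mono_right:
  assumes "0 \<le> x" "l \<le> l'"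
  shows "pseudo_poly m l x \<le> pseudo_poly m l' x"
  unfolding pseudo_poly_def using assms coefficient_pos[of m]
  by (intro sum_mono2) (auto simp: less_imp_le)

lemma pseudo_poly_ge_1: "0 \<le> x \<Longrightarrow> 1 \<le> pseudo_poly m l x"
  using pseudo_poly_mono_right[of x 0 l m] by (simp add: pseudo_poly_def)

text \<open>If the quotients \<open>a i / c i\<close> do not decrease with \<open>i\<close>, the
  quotient of the two polynomials is largest on \<open>{0..1}\<close> at 1. The cross-multiplied
  form allows coefficients of the denominator to vanish.\<close>

lemma sum_ratio_mono:
  fixes a c :: "nat \<Rightarrow> real"
  assumes ratio: "\<And>i j. i \<le> j \<Longrightarrow> j \<le> n \<Longrightarrow> a i * c j \<le> a j * c i" and x: "0 \<le> x" "x \<le> 1"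
  shows "(\<Sum>i\<le>n. a i * x ^ i) * (\<Sum>j\<le>n. c j) \<le> (\<Sum>i\<le>n. a i) * (\<Sum>j\<le>n. c j * x ^ j)"
proof -
  let ?S = "\<Sum>i\<le>n. \<Sum>j\<le>n. a i * c j * (x ^ j - x ^ i)"
  have S: "(\<Sum>i\<le>n. a i) * (\<Sum>j\<le>n. c j * x ^ j) - (\<Sum>i\<le>n. a i * x ^ i) * (\<Sum>j\<le>n. c j) = ?S"
    unfolding sum_product sum_subtractf[symmetric] by (intro sum.cong refl) (simp add: algebra_simps)
  \<comment> \<open>Symmetrisation as for Chebyshev's sum inequality: the pairs
    \<open>(i, j)\<close> and \<open>(j, i)\<close> together give a product of two factors whose
    signs both switch with the order of \<open>i\<close> and \<open>j\<close>.\<close>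
  have "?S = (\<Sum>i\<le>n. \<Sum>j\<le>n. a j * c i * (x ^ i - x ^ j))"
    by (rule sum.swap)
  then have "?S + ?S = (\<Sum>i\<le>n. \<Sum>j\<le>n. a i * c j * (x ^ j - x ^ i) + a j * c i * (x ^ i - x ^ j))"
    by (simp add: sum.distrib)
  also have "\<dots> = (\<Sum>i\<le>n. \<Sum>j\<le>n. (a j * c i - a i * c j) * (x ^ i - x ^ j))"
    by (intro sum.cong refl) (simp add: algebra_simps)
  also have "\<dots> \<ge> 0"
  proof (intro sum_nonneg)
    fix i j assume ij: "i \<in> {..n}" "j \<in> {..n}"
    show "0 \<le> (a j * c i - a i * c j) * (x ^ i - x ^ j)"
    proof (cases "i \<le> j")
      case True
      then show ?thesis using ratio[of i j] power_decreasing[OF True x] ij by simp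
    next
      case False
      then have "j \<le> i" by simp
      then show ?thesis using ratio[of j i] power_decreasing[OF \<open>j \<le> i\<close> x] ij
        by (intro mult_nonpos_nonpos) auto
    qed
  qed
  finally show ?thesis using S by linarith
qed

text \<open>The missing last coefficient of the smaller polynomial counts as \<open>0\<close>, so that both sums
  have the same length.\<close>

lemma pseudo_poly_ratio:
  assumes ratio: "\<And>i j. i \<le> j \<Longrightarrow> j \<le> l \<Longrightarrow>
      coefficient m' i * coefficient m j \<le> coefficient m' j * coefficient m i"
    and x: "0 \<le> x" "x \<le> 1"
  shows "pseudo_poly m' (Suc l) x \<le> pseudo_poly m' (Suc l) 1 / pseudo_poly m l 1 * pseudo_poly m l x"
proof -
  let ?c = "\<lambda>k. if k \<le> l then coefficient m k else 0"
  have c: "(\<Sum>k\<le>Suc l. ?c k * y ^ k) = pseudo_poly m l y" for y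
    unfolding pseudo_poly_def by simp
  have "(\<Sum>i\<le>Suc l. coefficient m' i * x ^ i) * (\<Sum>j\<le>Suc l. ?c j)
      \<le> (\<Sum>i\<le>Suc l. coefficient m' i) * (\<Sum>j\<le>Suc l. ?c j * x ^ j)"
  proof (rule sum_ratio_mono[OF _ x])
    show "coefficient m' i * ?c j \<le> coefficient m' j * ?c i" if "i \<le> j" "j \<le> Suc l" for i j
      using that ratio[of i j] coefficient_pos[of m' j] coefficient_pos[of m i] by auto
  qed
  then have "pseudo_poly m' (Suc l) x * pseudo_poly m l 1 \<le> pseudo_poly m' (Suc l) 1 * pseudo_poly m l x"
    using c[of 1] c[of x] by (simp add: pseudo_poly_def)
  moreover have "pseudo_poly m l 1 > 0" using pseudo_poly_ge_1[of 1 m l] by simp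
  ultimately show ?thesis by (simp add: field_simps)
qed

text \<open>Both polynomials have the same coefficients up to \<open>l\<close>, so the ratio
  condition is an equality there, and the constant is the quotient of two consecutive coefficients
  for \<open>Suc m\<close>.\<close>

lemma pseudo_poly_Suc_right_le:
  assumes "0 \<le> x" "x \<le> 1"
  shows "pseudo_poly m (Suc l) x \<le> (real m + real (Suc l) + 1 / 2) / real (Suc l) * pseudo_poly m l x"
proof -
  have "pseudo_poly m (Suc l) 1 / pseudo_poly m l 1 = (real m + real (Suc l) + 1 / 2) / real (Suc l)"
    using coefficient_pos[of "Suc m" l]
    unfolding pseudo_poly_1 coefficient_Suc by (simp add: add_ac)
  then show ?thesis using pseudo_poly_ratio[of l m m x] assms by (simp add: mult.commute)
qed

text \<open>The value at 1 moves from \<open>coefficient (Suc m) (m - 1)\<close> to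
  \<open>coefficient (Suc (Suc m)) m\<close>. Raising the lower index gives the factor
  \<open>(2 * m + 1 / 2) / m\<close>, raising the upper one
  \<open>(2 * m + 3 / 2) / (m + 3 / 2)\<close>.\<close>

lemma pseudo_poly_diagonal_quotient:
  assumes "m \<ge> 1"
  shows "pseudo_poly (Suc m) m 1 / pseudo_poly m (m - 1) 1
    = (2 * real m + 1 / 2) * (2 * real m + 3 / 2) / (real m * (real m + 3 / 2))"
proof -
  obtain l where l: "m = Suc l" using assms by (cases m) auto
  have lm: "real (Suc m) + real l + 1 / 2 = 2 * real m + 1 / 2" "real l + 1 = real m"
    "real (Suc m) + real m + 1 / 2 = 2 * real m + 3 / 2" "real (Suc m) + 1 / 2 = real m + 3 / 2"
    using l by simp_all
  have "coefficient (Suc m) m = coefficient (Suc m) l * ((2 * real m + 1 / 2) / real m)"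
    using coefficient_Suc[of "Suc m" l] by (simp only: l[symmetric] lm)
  then have "coefficient (Suc (Suc m)) m
      = coefficient (Suc m) l * ((2 * real m + 1 / 2) / real m) * ((2 * real m + 3 / 2) / (real m + 3 / 2))"
    by (simp only: coefficient_Suc_left[of "Suc m" m] lm)
  moreover have "m - 1 = l" using l by simp
  ultimately show ?thesis
    using coefficient_pos[of "Suc m" l] unfolding pseudo_poly_1 by simp
qed

text \<open>Raising \<open>m\<close> multiplies the coefficient of index \<open>k\<close> by
  \<open>(m + k + 1 / 2) / (m + 1 / 2)\<close>, which increases with \<open>k\<close>; this is the
  ratio condition.\<close>

lemma pseudo_poly_diagonal_le:
  assumes "m \<ge> 1" "0 \<le> x" "x \<le> 1"
  shows "pseudo_poly (Suc m) m x
    \<le> (2 * real m + 1 / 2) * (2 * real m + 3 / 2) / (real m * (real m + 3 / 2)) * pseudo_poly m (m - 1) x"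
proof -
  obtain l where l: "m = Suc l" using assms by (cases m) auto
  have "coefficient (Suc m) i * coefficient m j \<le> coefficient (Suc m) j * coefficient m i"
    if "i \<le> j" for i j
  proof -
    have "(real m + real i + 1 / 2) / (real m + 1 / 2) \<le> (real m + real j + 1 / 2) / (real m + 1 / 2)"
      using that by (intro divide_right_mono) auto
    then have "(coefficient m i * coefficient m j) * ((real m + real i + 1 / 2) / (real m + 1 / 2))
        \<le> (coefficient m i * coefficient m j) * ((real m + real j + 1 / 2) / (real m + 1 / 2))"
      using coefficient_pos[of m i] coefficient_pos[of m j] by (intro mult_left_mono) auto
    then show ?thesis unfolding coefficient_Suc_left by (simp only: mult_ac)
  qed
  then have "pseudo_poly (Suc m) (Suc l) x \<le> pseudo_poly (Suc m) (Suc l) 1 / pseudo_poly m l 1 * pseudo_poly m l x"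
    using assms by (intro pseudo_poly_ratio) auto
  moreover have "Suc l = m" "l = m - 1" using l by simp_all
  ultimately show ?thesis
    by (simp only: pseudo_poly_diagonal_quotient[OF assms(1)])
qed

text \<open>With equal degrees a coefficientwise comparison is enough: the quotient of coefficients
  lies between 1 and its value at \<open>k = l\<close>.\<close>

lemma pseudo_poly_Suc_left_le:
  assumes "0 \<le> x"
  shows "pseudo_poly (Suc m) l x \<le> (real m + real l + 1 / 2) / (real m + 1 / 2) * pseudo_poly m l x"
    and "pseudo_poly m l x \<le> pseudo_poly (Suc m) l x"
proof -
  have "coefficient (Suc m) k \<le> (real m + real l + 1 / 2) / (real m + 1 / 2) * coefficient m k" if "k \<le> l" for k
    unfolding coefficient_Suc_left using that coefficient_pos[of m k]
    by (subst mult.commute) (intro mult_right_mono divide_right_mono, auto)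
  then show "pseudo_poly (Suc m) l x \<le> (real m + real l + 1 / 2) / (real m + 1 / 2) * pseudo_poly m l x"
    unfolding pseudo_poly_def sum_distrib_left using assms
    by (intro sum_mono) (simp only: mult.assoc[symmetric] mult_right_mono zero_le_power atMost_iff)
  have "coefficient m k * 1 \<le> coefficient (Suc m) k" for k
    unfolding coefficient_Suc_left using coefficient_pos[of m k] by (intro mult_left_mono) auto
  then show "pseudo_poly m l x \<le> pseudo_poly (Suc m) l x"
    unfolding pseudo_poly_def using assms by (intro sum_mono mult_right_mono) auto
qed

text \<open>Source of the bound \<open>4 ^ (m - 1)\<close> for the growth rate. The value is 1 at
  \<open>m = 1\<close>, and each diagonal step multiplies it by at most 4, since
  \<open>4 * m * (m + 3 / 2)\<close> exceeds \<open>(2 * m + 1 / 2) * (2 * m + 3 / 2)\<close> by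
  \<open>2 * m - 3 / 4\<close>.\<close>

lemma pseudo_poly_diagonal_1: "m \<ge> 1 \<Longrightarrow> pseudo_poly m (m - 1) 1 \<le> 4 ^ (m - 1)"
proof (induction m rule: dec_induct)
  case base
  then show ?case by (simp add: pseudo_poly_def)
next
  case (step m)
  have "(2 * real m + 1 / 2) * (2 * real m + 3 / 2) \<le> 4 * (real m * (real m + 3 / 2))"
    using step by (simp add: algebra_simps)
  then have "(2 * real m + 1 / 2) * (2 * real m + 3 / 2) / (real m * (real m + 3 / 2)) \<le> 4"
    using step by (subst divide_le_eq) (auto intro!: mult_pos_pos)
  moreover have "0 \<le> pseudo_poly m (m - 1) 1" using pseudo_poly_ge_1[of 1 m "m - 1"] by simp
  ultimately have "(2 * real m + 1 / 2) * (2 * real m + 3 / 2) / (real m * (real m + 3 / 2))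
      * pseudo_poly m (m - 1) 1 \<le> 4 * pseudo_poly m (m - 1) 1"
    by (rule mult_right_mono)
  with pseudo_poly_diagonal_le[of m 1] step
  have "pseudo_poly (Suc m) m 1 \<le> 4 * pseudo_poly m (m - 1) 1" by linarith
  also have "\<dots> \<le> 4 * 4 ^ (m - 1)" using step by simp
  also have "\<dots> = 4 ^ (Suc m - 1)" using step by (simp flip: power_Suc)
  finally show ?case by simp
qed

section \<open>The pseudo-spline weights and symbols as instances of the general scheme\<close>

lemma sin_sq_range: "0 \<le> (sin (t / 2 :: real))\<^sup>2" "(sin (t / 2 :: real))\<^sup>2 \<le> 1"
  by (simp_all add: abs_square_le_1)

lemma symbol_weight_pseudo:
  assumes "m \<ge> 1" "l \<le> m - 1"
  obtains L where "symbol_weight (pseudo_weight m l) L (4 ^ (m - 1))"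
proof -
  \<comment> \<open>The derivative of the polynomial at 1, its largest slope on
    \<open>{0..1}\<close>; the square of \<open>sin (t / 2)\<close> has Lipschitz constant at most
    1.\<close>
  let ?L = "\<Sum>k\<le>l. coefficient m k * real k"
  have "symbol_weight (pseudo_weight m l) ?L (4 ^ (m - 1))"
  proof
    fix t x y :: real
    show "1 \<le> pseudo_weight m l t"
      unfolding pseudo_weight_def by (intro pseudo_poly_ge_1) simp
    have "pseudo_weight m l t \<le> pseudo_poly m l 1"
      unfolding pseudo_weight_def by (intro pseudo_poly_mono sin_sq_range)
    also have "\<dots> \<le> pseudo_poly m (m - 1) 1" using assms by (intro pseudo_poly_mono_right) auto
    also have "\<dots> \<le> 4 ^ (m - 1)" using assms by (intro pseudo_poly_diagonal_1)
    finally show "pseudo_weight m l t \<le> 4 ^ (m - 1)" .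
    have "sin ((t + 2 * pi) / 2) = - sin (t / 2)" by (simp add: add_divide_distrib)
    then show "pseudo_weight m l (t + 2 * pi) = pseudo_weight m l t"
      by (simp add: pseudo_weight_def)
    have "\<bar>(sin (x / 2))\<^sup>2 - (sin (y / 2))\<^sup>2\<bar> \<le> \<bar>x - y\<bar>"
    proof -
      have "(sin (x / 2))\<^sup>2 - (sin (y / 2))\<^sup>2 = (cos y - cos x) / 2"
        using cos_double_sin[of "x / 2"] cos_double_sin[of "y / 2"] by simp
      also have "\<dots> = sin ((y + x) / 2) * sin ((x - y) / 2)" by (simp add: cos_diff_cos)
      also have "\<bar>\<dots>\<bar> \<le> 1 * \<bar>(x - y) / 2\<bar>"
        unfolding abs_mult by (intro mult_mono abs_sin_x_le_abs_x) auto
      also have "\<dots> \<le> \<bar>x - y\<bar>" by simp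
      finally show ?thesis .
    qed
    then have pw: "\<bar>((sin (x / 2))\<^sup>2) ^ k - ((sin (y / 2))\<^sup>2) ^ k\<bar> \<le> real k * \<bar>x - y\<bar>" for k
      using norm_power_diff[of "(sin (x / 2))\<^sup>2" "(sin (y / 2))\<^sup>2" k] sin_sq_range[of x] sin_sq_range[of y]
      by (simp, meson mult_left_mono of_nat_0_le_iff order.trans)
    have "\<bar>pseudo_weight m l x - pseudo_weight m l y\<bar>
        = \<bar>\<Sum>k\<le>l. coefficient m k * (((sin (x / 2))\<^sup>2) ^ k - ((sin (y / 2))\<^sup>2) ^ k)\<bar>"
      by (simp add: pseudo_weight_def pseudo_poly_def sum_subtractf right_diff_distrib)
    also have "\<dots> \<le> (\<Sum>k\<le>l. coefficient m k * (real k * \<bar>x - y\<bar>))"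
      using coefficient_pos[of m] pw
      by (intro order.trans[OF sum_abs] sum_mono) (auto simp: abs_mult less_imp_le intro!: mult_left_mono)
    finally show "\<bar>pseudo_weight m l x - pseudo_weight m l y\<bar> \<le> ?L * \<bar>x - y\<bar>"
      by (simp add: sum_distrib_right mult.assoc)
  qed
  then show thesis by (rule that)
qed

lemma inverse_4X: "inverse (4 * fls_X :: real fls) = fls_const (1 / 4) * fls_X_inv"
proof -
  have "inverse (4 :: real fls) = fls_const (1 / 4)"
    using fls_inverse_const[of "4 :: real"] by (simp add: inverse_eq_divide)
  then show ?thesis by (simp add: fls_inverse_X inverse_mult_distrib)
qed

text \<open>What is left of the symbol without its \<open>2 * m + 1\<close> factors
  \<open>1 + z\<close>. Of the \<open>m + 1\<close> inverse powers of \<open>z\<close>, one comes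
  from \<open>(1 + z) / z\<close> and \<open>m\<close> from the power of
  \<open>sigma_symbol\<close>.\<close>

definition pseudo_factor :: "nat \<Rightarrow> nat \<Rightarrow> real fls" where
  "pseudo_factor m l = fls_X_inv ^ Suc m * fls_const ((1 / 4) ^ m) *
     (\<Sum>k = 0..l. fls_const (coefficient m k) * delta_symbol ^ k)"

lemma delta_symbol_Laurent: "laurent_polynomial delta_symbol"
  "on_circle delta_symbol t = of_real ((sin (t / 2))\<^sup>2)"
proof -
  have eq: "delta_symbol = - ((1 + - fls_X) ^ 2 * (fls_const (1 / 4) * fls_X_inv))"
    unfolding delta_symbol_def divide_inverse inverse_4X by simp
  show "laurent_polynomial delta_symbol"
    unfolding eq by (intro laurent_polynomial_intros)
  have "on_circle delta_symbol t = - ((1 - cis t)\<^sup>2 * (of_real (1 / 4) * cis (- t)))"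
    unfolding eq by (simp only: on_circle_simps laurent_polynomial_intros) simp
  also have "\<dots> = of_real (1 / 4) * ((cis t - 1) * (cis (- t) - 1))"
    by (simp add: power2_eq_square algebra_simps cis_mult)
  finally show "on_circle delta_symbol t = of_real ((sin (t / 2))\<^sup>2)"
    unfolding cis_minus_one_times by simp
qed

lemma pseudo_factor_Laurent: "laurent_polynomial (pseudo_factor m l)"
  "on_circle (pseudo_factor m l) t
    = of_real (pseudo_weight m l t * (1 / 4) ^ m) * cis (- (real m + 1) * t)"
proof -
  show "laurent_polynomial (pseudo_factor m l)"
    unfolding pseudo_factor_def by (intro laurent_polynomial_intros delta_symbol_Laurent)
  have "on_circle (pseudo_factor m l) t = cis (- t) ^ Suc m * of_real ((1 / 4) ^ m) *
      (\<Sum>k = 0..l. of_real (coefficient m k) * of_real ((sin (t / 2))\<^sup>2) ^ k)"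
    unfolding pseudo_factor_def
    by (simp only: on_circle_simps laurent_polynomial_intros delta_symbol_Laurent)
  also have "(\<Sum>k = 0..l. of_real (coefficient m k) * of_real ((sin (t / 2))\<^sup>2) ^ k)
      = complex_of_real (pseudo_weight m l t)"
    by (simp add: pseudo_weight_def pseudo_poly_def atMost_atLeast0)
  also have "cis (- t) ^ Suc m = cis (- (real m + 1) * t)"
    by (simp only: Complex.DeMoivre) (rule arg_cong[of _ _ cis], simp add: algebra_simps)
  finally show "on_circle (pseudo_factor m l) t
    = of_real (pseudo_weight m l t * (1 / 4) ^ m) * cis (- (real m + 1) * t)"
    by (simp add: mult_ac)
qed

lemma dual_pseudo_spline_symbol_eq:
  "dual_pseudo_spline_symbol m l = (1 + fls_X) ^ Suc (2 * m) * pseudo_factor m l"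
proof -
  have "sigma_symbol ^ m = (1 + fls_X) ^ (2 * m) * (fls_const ((1 / 4) ^ m) * fls_X_inv ^ m)"
    unfolding sigma_symbol_def divide_inverse inverse_4X
    by (simp add: power_mult_distrib power_mult fls_const_power)
  then show ?thesis
    unfolding dual_pseudo_spline_symbol_def pseudo_factor_def divide_inverse fls_inverse_X coefficient_def
    by (simp add: mult_ac)
qed

lemma dual_scheme_pseudo:
  assumes "m \<ge> 1" "l \<le> m - 1"
  obtains L where "dual_scheme (pseudo_weight m l) L (4 ^ (m - 1)) m (pseudo_factor m l)"
proof -
  obtain L where "symbol_weight (pseudo_weight m l) L (4 ^ (m - 1))"
    using symbol_weight_pseudo[OF assms] .
  then interpret symbol_weight "pseudo_weight m l" L "4 ^ (m - 1)" .
  have "pseudo_weight m l 0 = 1"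
    by (simp add: pseudo_weight_def pseudo_poly_def power_0_left if_distrib[of "\<lambda>x. _ * x"] cong: if_cong)
  then have "dual_scheme (pseudo_weight m l) L (4 ^ (m - 1)) m (pseudo_factor m l)"
    using assms growth_rate_le_D pseudo_factor_Laurent by unfold_locales auto
  then show thesis by (rule that)
qed

lemma dual_pseudo_spline_regularity:
  assumes "m \<ge> 1" "l \<le> m - 1"
  shows "has_hoelder_regularity (dual_pseudo_spline_symbol m l) (dual_pseudo_spline_regularity m l)"
    and "dual_pseudo_spline_regularity m l = 2 * real m - log 2 (growth_rate (pseudo_weight m l))"
proof -
  obtain L where "dual_scheme (pseudo_weight m l) L (4 ^ (m - 1)) m (pseudo_factor m l)"
    using dual_scheme_pseudo[OF assms] .
  then interpret dual_scheme "pseudo_weight m l" L "4 ^ (m - 1)" m "pseudo_factor m l" .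
  have reg: "has_hoelder_regularity (dual_pseudo_spline_symbol m l) \<gamma>"
    unfolding dual_pseudo_spline_symbol_eq by (rule has_regularity)
  then have "dual_pseudo_spline_regularity m l = \<gamma>"
    unfolding dual_pseudo_spline_regularity_def by (rule hoelder_regularity_eqI)
  then show "has_hoelder_regularity (dual_pseudo_spline_symbol m l) (dual_pseudo_spline_regularity m l)"
    "dual_pseudo_spline_regularity m l = 2 * real m - log 2 (growth_rate (pseudo_weight m l))"
    using reg by (simp_all add: \<gamma>_def)
qed

text \<open>The term \<open>2 * (m' - m)\<close> is the gain from additional factors
  \<open>1 + z\<close>, and \<open>log 2 K\<close> is the loss from a larger weight. Every
  inequality of the theorem is this one for suitable indices and \<open>K\<close>.\<close>

lemma regularity_comparison:
  assumes ml: "m \<ge> 1" "l \<le> m - 1" and ml': "m' \<ge> 1" "l' \<le> m' - 1" and "K > 0"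
    and le: "\<And>x. 0 \<le> x \<Longrightarrow> x \<le> 1 \<Longrightarrow> pseudo_poly m' l' x \<le> K * pseudo_poly m l x"
  shows "dual_pseudo_spline_regularity m l + 2 * (real m' - real m) - log 2 K
    \<le> dual_pseudo_spline_regularity m' l'"
proof -
  obtain L where L: "symbol_weight (pseudo_weight m l) L (4 ^ (m - 1))"
    using symbol_weight_pseudo[OF ml] .
  obtain L' where L': "symbol_weight (pseudo_weight m' l') L' (4 ^ (m' - 1))"
    using symbol_weight_pseudo[OF ml'] .
  have "growth_rate (pseudo_weight m' l') \<le> K * growth_rate (pseudo_weight m l)"
    using growth_rate_mono[OF L' L _ \<open>K > 0\<close>] le sin_sq_range by (simp add: pseudo_weight_def)
  moreover have "1 \<le> growth_rate (pseudo_weight m l)" "1 \<le> growth_rate (pseudo_weight m' l')"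
    using symbol_weight.growth_rate_ge_1 L L' by blast+
  ultimately have "log 2 (growth_rate (pseudo_weight m' l'))
      \<le> log 2 K + log 2 (growth_rate (pseudo_weight m l))"
    using \<open>K > 0\<close> log_mono[of 2 "growth_rate (pseudo_weight m' l')" "K * growth_rate (pseudo_weight m l)"]
    by (simp add: log_mult)
  then show ?thesis
    unfolding dual_pseudo_spline_regularity(2)[OF ml] dual_pseudo_spline_regularity(2)[OF ml'] by simp
qed

text \<open>The first clause guarantees that the numbers compared are regularities and not an
  arbitrary value of the definite description in \<open>hoelder_regularity\<close>.\<close>

theorem theorem4:
  fixes \<gamma> :: "nat \<Rightarrow> nat \<Rightarrow> real" and \<gamma>_diag :: "nat \<Rightarrow> real"
  defines "\<gamma> \<equiv> \<lambda>m l. dual_pseudo_spline_regularity m l"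
    and "\<gamma>_diag \<equiv> \<lambda>m. \<gamma> m (m - 1)"
  shows "(\<forall>m l. 1 \<le> m \<and> l \<le> m - 1 \<longrightarrow>
        has_hoelder_regularity (dual_pseudo_spline_symbol m l) (\<gamma> m l)) \<and>
    (\<forall>m l l'. 1 \<le> m \<and> l \<le> l' \<and> l' \<le> m - 1 \<longrightarrow> \<gamma> m l' \<le> \<gamma> m l) \<and>
    (\<forall>m l. 1 \<le> l \<and> l \<le> m - 1 \<longrightarrow>
        \<gamma> m (l - 1) - log 2 ((real m + real l + 1/2) / real l) \<le> \<gamma> m l \<and>
        \<gamma> m l \<le> \<gamma> m (l - 1)) \<and>
    (\<forall>m m' l. 1 \<le> m \<and> l \<le> m - 1 \<and> m < m' \<longrightarrow> \<gamma> m l < \<gamma> m' l) \<and>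
    (\<forall>m l. 1 \<le> m \<and> l \<le> m - 1 \<longrightarrow>
        \<gamma> m l + log 2 (4 * (real m + 1/2) / (real m + real l + 1/2)) \<le> \<gamma> (m + 1) l \<and>
        \<gamma> (m + 1) l \<le> \<gamma> m l + 2) \<and>
    (\<forall>m m'. 1 \<le> m \<and> m < m' \<longrightarrow> \<gamma>_diag m < \<gamma>_diag m') \<and>
    (\<forall>m. 1 \<le> m \<longrightarrow>
        \<gamma>_diag m
          + log 2 (4 * real m * (real m + 3/2) / ((2 * real m + 1/2) * (2 * real m + 3/2)))
          \<le> \<gamma>_diag (m + 1) \<and>
        \<gamma>_diag (m + 1) \<le> \<gamma>_diag m + 2)"
proof -
  have reg: "has_hoelder_regularity (dual_pseudo_spline_symbol m l) (\<gamma> m l)"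
    if "1 \<le> m" "l \<le> m - 1" for m l
    unfolding \<gamma>_def by (rule dual_pseudo_spline_regularity(1)[OF that])
  have dec: "\<gamma> m l' \<le> \<gamma> m l" if "1 \<le> m" "l \<le> l'" "l' \<le> m - 1" for m l l'
    using regularity_comparison[of m l' m l 1] pseudo_poly_mono_right[of _ l l' m] that
    by (simp add: \<gamma>_def)
  have i: "\<gamma> m (l - 1) - log 2 ((real m + real l + 1/2) / real l) \<le> \<gamma> m l"
    if l: "1 \<le> l" "l \<le> m - 1" for m l
  proof -
    have "pseudo_poly m l x \<le> (real m + real l + 1/2) / real l * pseudo_poly m (l - 1) x"
      if "0 \<le> x" "x \<le> 1" for x
      using pseudo_poly_Suc_right_le[OF that, of m "l - 1"] l by simp
    moreover have "0 < (real m + real l + 1/2) / real l" using l by (intro divide_pos_pos) auto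
    ultimately show ?thesis
      using regularity_comparison[of m "l - 1" m l "(real m + real l + 1/2) / real l"] l
      by (simp add: \<gamma>_def)
  qed
  \<comment> \<open>Raising \<open>m\<close> by one gains 2, the logarithm of 4, and the constants
    of the theorem are \<open>4 / K\<close>.\<close>
  have log4: "log 2 x = 2 - log 2 K" if "K > 0" "x = 4 / K" for x K :: real
  proof -
    have "log 2 4 = (2 :: real)" using log2_of_power_eq[of 4 2] by simp
    then show ?thesis using that by (simp add: log_divide)
  qed
  have ii: "\<gamma> m l + log 2 (4 * (real m + 1/2) / (real m + real l + 1/2)) \<le> \<gamma> (m + 1) l"
      (is ?lower) "\<gamma> (m + 1) l \<le> \<gamma> m l + 2" (is ?upper)
    if ml: "1 \<le> m" "l \<le> m - 1" for m l
  proof -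
    define K where "K = (real m + real l + 1/2) / (real m + 1/2)"
    have K: "K > 0" unfolding K_def by (intro divide_pos_pos) auto
    have ml': "1 \<le> m + 1" "l \<le> m + 1 - 1" using ml by simp_all
    have "\<gamma> m l + 2 * (real (m + 1) - real m) - log 2 K \<le> \<gamma> (m + 1) l"
      unfolding \<gamma>_def using pseudo_poly_Suc_left_le(1)[of _ m l]
      by (intro regularity_comparison ml ml' K) (simp add: K_def)
    moreover have "log 2 (4 * (real m + 1/2) / (real m + real l + 1/2)) = 2 - log 2 K"
      by (intro log4 K) (simp add: K_def)
    ultimately show ?lower by simp
    \<comment> \<open>The comparison is read from \<open>m + 1\<close> down to \<open>m\<close> with
      \<open>K = 1\<close>: a larger \<open>m\<close> has the larger weight.\<close>
    have "\<gamma> (m + 1) l + 2 * (real m - real (m + 1)) - log 2 1 \<le> \<gamma> m l"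
      unfolding \<gamma>_def using pseudo_poly_Suc_left_le(2)[of _ m l]
      by (intro regularity_comparison ml ml') simp_all
    then show ?upper by simp
  qed
  have iii: "\<gamma>_diag m
        + log 2 (4 * real m * (real m + 3/2) / ((2 * real m + 1/2) * (2 * real m + 3/2)))
        \<le> \<gamma>_diag (m + 1)" (is ?lower) "\<gamma>_diag (m + 1) \<le> \<gamma>_diag m + 2" (is ?upper)
    if m: "1 \<le> m" for m
  proof -
    define K where "K = (2 * real m + 1/2) * (2 * real m + 3/2) / (real m * (real m + 3/2))"
    have K: "K > 0" unfolding K_def using m by (intro divide_pos_pos mult_pos_pos) auto
    have m1: "1 \<le> m + 1" "m + 1 - 1 \<le> m + 1 - 1" by simp_all
    have "\<gamma> m (m - 1) + 2 * (real (m + 1) - real m) - log 2 K \<le> \<gamma> (m + 1) (m + 1 - 1)"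
      unfolding \<gamma>_def using pseudo_poly_diagonal_le[OF m]
      by (intro regularity_comparison m m1 K order.refl) (simp add: K_def)
    moreover have "log 2 (4 * real m * (real m + 3/2) / ((2 * real m + 1/2) * (2 * real m + 3/2)))
        = 2 - log 2 K"
      by (intro log4 K) (simp add: K_def mult.assoc)
    ultimately show ?lower unfolding \<gamma>_diag_def by simp
    have "pseudo_poly m (m - 1) x \<le> pseudo_poly (Suc m) m x" if x: "0 \<le> x" for x
    proof -
      have "pseudo_poly m (m - 1) x \<le> pseudo_poly m m x"
        using x by (intro pseudo_poly_mono_right) auto
      also have "\<dots> \<le> pseudo_poly (Suc m) m x" by (rule pseudo_poly_Suc_left_le(2)[OF x])
      finally show ?thesis .
    qed
    then have "\<gamma> (m + 1) (m + 1 - 1) + 2 * (real m - real (m + 1)) - log 2 1 \<le> \<gamma> m (m - 1)"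
      unfolding \<gamma>_def by (intro regularity_comparison m m1 order.refl) simp_all
    then show ?upper unfolding \<gamma>_diag_def by simp
  qed
  have log_pos: "0 < log 2 x" if "1 < x" for x :: real
    using that by simp
  \<comment> \<open>For \<open>l \<le> m\<close> the denominator is at most
    \<open>2 * m + 1 / 2\<close>, below the numerator \<open>4 * m + 2\<close>; so the increment is
    positive and monotonicity is strict.\<close>
  have ratio_ii: "1 < 4 * (real m + 1/2) / (real m + real l + 1/2)" if "l \<le> m" for m l
    using that by (subst less_divide_eq) auto
  have inc: "\<gamma> m l < \<gamma> m' l" if ml: "1 \<le> m" "l \<le> m - 1" "m < m'" for m m' l
  proof -
    have "\<gamma> (m + i) l < \<gamma> (m + Suc i) l" for i
    proof -
      have mi: "1 \<le> m + i" "l \<le> m + i - 1" "l \<le> m + i" using ml by auto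
      have "\<gamma> (m + i) l < \<gamma> (m + i) l
          + log 2 (4 * (real (m + i) + 1/2) / (real (m + i) + real l + 1/2))"
        by (simp only: less_add_same_cancel1 log_pos ratio_ii[OF mi(3)])
      also note ii(1)[OF mi(1,2)]
      finally have "\<gamma> (m + i) l < \<gamma> (m + i + 1) l" .
      then show ?thesis by simp
    qed
    then have "\<gamma> (m + 0) l < \<gamma> (m + (m' - m)) l"
      by (rule lift_Suc_mono_less) (use ml in simp)
    then show ?thesis using ml by simp
  qed
  have inc_diag: "\<gamma>_diag m < \<gamma>_diag m'" if m: "1 \<le> m" "m < m'" for m m'
  proof -
    have "\<gamma>_diag (m + i) < \<gamma>_diag (m + Suc i)" for i
    proof -
      define k where "k = m + i"
      have k: "1 \<le> k" using m by (simp add: k_def)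
      \<comment> \<open>The two sides differ by \<open>2 * k - 3 / 4\<close>.\<close>
      have "(2 * real k + 1/2) * (2 * real k + 3/2) < 4 * real k * (real k + 3/2)"
        using k by (simp add: algebra_simps)
      moreover have "0 < (2 * real k + 1/2) * (2 * real k + 3/2)" by (intro mult_pos_pos) auto
      ultimately have "1 < 4 * real k * (real k + 3/2) / ((2 * real k + 1/2) * (2 * real k + 3/2))"
        by (simp only: less_divide_eq_1_pos)
      then have "\<gamma>_diag k < \<gamma>_diag k
          + log 2 (4 * real k * (real k + 3/2) / ((2 * real k + 1/2) * (2 * real k + 3/2)))"
        by (simp only: less_add_same_cancel1 log_pos)
      also note iii(1)[OF k]
      finally have "\<gamma>_diag k < \<gamma>_diag (k + 1)" .
      then show ?thesis by (simp add: k_def)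
    qed
    then have "\<gamma>_diag (m + 0) < \<gamma>_diag (m + (m' - m))"
      by (rule lift_Suc_mono_less) (use m in simp)
    then show ?thesis using m by simp
  qed
  have i_upper: "\<gamma> m l \<le> \<gamma> m (l - 1)" if "1 \<le> l" "l \<le> m - 1" for m l
    using dec[of m "l - 1" l] that by simp
  show ?thesis
    by (intro conjI allI impI)
       ((elim conjE)?, (rule reg dec i i_upper inc ii iii inc_diag; assumption))+
qed

end
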